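(* Let $k$ be a commutative ring with unit and let $G$ be a (discrete) group, finite or infinite. Then there is a natural isomorphism $$H^*\big(AP(k[G]^{\otimes *})\big)\;\simeq\; H^*(BG;\,k),$$ where $AP(k[G]^{\otimes *})=\sum_{n\ge 0}AP(k[G]^{\otimes n})$ is the complex of strictly autopoietic Hochschild cochains with differential $\delta$.
   Context: $BG$ is the classifying space of the discrete group $G$, $k[G]$ is the group ring and $e\in G$ is the identity. All tensor products are over $k$, with $k[G]^{\otimes 0}=k$. The Hochschild cochain complex is $\big(\mathrm{Hom}_k(k[G]^{\otimes *},k[G]),\delta\big)$, where for $f\in \mathrm{Hom}_k(k[G]^{\otimes n},k[G])$ $$(\delta f)(g_1\otimes\cdots\otimes g_{n+1})=g_1f(g_2\otimes\cdots\otimes g_{n+1})+\sum_{i=1}^n(-1)^if(g_1\otimes\cdots\otimes g_ig_{i+1}\otimes\cdots\otimes g_{n+1})+(-1)^{n+1}f(g_1\otimes\cdots\otimes g_n)g_{n+1},$$ and for $n=0$, $(\delta f)(g_1)=g_1f(1)-f(1)g_1$. For $n\ge1$, a cochain $f\in \mathrm{Hom}_k(k[G]^{\otimes n},k[G])$ is autopoietic if for all $(g_1,\dots,g_n)\in G^n$ there is $\lambda_{g_1,\dots,g_n}\in k$ with $f(g_1\otimes\cdots\otimes g_n)=\lambda_{g_1,\dots,g_n}\,(g_1g_2\cdots g_n)$. A cochain of degree $n\ge 0$ is strictly autopoietic if it is autopoietic when $n\geq 1$, and, when $n=0$, $f(1)=\lambda e$ for some $\lambda\in k$. $AP(k[G]^{\otimes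 n})\subseteq \mathrm{Hom}_k(k[G]^{\otimes n},k[G])$ is the $k$-submodule of strictly autopoietic cochains; together these form a subcomplex under $\delta$. *)

theory Defs
  imports "HOL-Homology.Homology" "HOL-Algebra.Module" "HOL-Algebra.AbelCoset"
begin

section \<open>Modules over a commutative ring\<close>

text \<open>The record type of modules extends that of rings; the ring fields \<open>mult\<close> and \<open>one\<close>
  carry no meaning for a module and are left \<open>undefined\<close>.\<close>

definition linear_maps ::
  "('k, 'm) ring_scheme \<Rightarrow> ('k, 'a, 'p) module_scheme \<Rightarrow> ('k, 'b, 'q) module_scheme \<Rightarrow> ('a \<Rightarrow> 'b) set"
  where "linear_maps k M N =
    {f \<in> carrier M \<rightarrow> carrier N.
       (\<forall>x\<in>carrier M. \<forall>y\<in>carrier M. f (x \<oplus>\<^bsub>M\<^esub> y) = f x \<oplus>\<^bsub>N\<^esub> f y) \<and>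
       (\<forall>c\<in>carrier k. \<forall>x\<in>carrier M. f (c \<odot>\<^bsub>M\<^esub> x) = c \<odot>\<^bsub>N\<^esub> f x)}"

definition linear_isos ::
  "('k, 'm) ring_scheme \<Rightarrow> ('k, 'a, 'p) module_scheme \<Rightarrow> ('k, 'b, 'q) module_scheme \<Rightarrow> ('a \<Rightarrow> 'b) set"
  where "linear_isos k M N = {f \<in> linear_maps k M N. bij_betw f (carrier M) (carrier N)}"

definition hom_module ::
  "('k, 'm) ring_scheme \<Rightarrow> ('k, 'a, 'p) module_scheme \<Rightarrow> ('k, 'b, 'q) module_scheme \<Rightarrow> ('k, 'a \<Rightarrow> 'b) module"
  where "hom_module k M N =
    \<lparr>carrier = linear_maps k M N \<inter> extensional (carrier M),
     mult = undefined, one = undefined,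
     zero = (\<lambda>x\<in>carrier M. \<zero>\<^bsub>N\<^esub>),
     add = (\<lambda>f g. \<lambda>x\<in>carrier M. f x \<oplus>\<^bsub>N\<^esub> g x),
     smult = (\<lambda>c f. \<lambda>x\<in>carrier M. c \<odot>\<^bsub>N\<^esub> f x)\<rparr>"

definition quotient_module :: "('k, 'a, 'p) module_scheme \<Rightarrow> 'a set \<Rightarrow> ('k, 'a set) module"
  where "quotient_module M N =
    \<lparr>carrier = a_rcosets\<^bsub>M\<^esub> N,
     mult = undefined, one = undefined,
     zero = N,
     add = set_add M,
     smult = (\<lambda>c X. N <+>\<^bsub>M\<^esub> ((\<lambda>x. c \<odot>\<^bsub>M\<^esub> x) ` X))\<rparr>"

definition submodule_span ::
  "('k, 'm) ring_scheme \<Rightarrow> ('k, 'a, 'p) module_scheme \<Rightarrow> 'a set \<Rightarrow> 'a set"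
  where "submodule_span k M S = \<Inter>{N. submodule N k M \<and> S \<subseteq> N}"

definition free_module :: "('k, 'm) ring_scheme \<Rightarrow> 'a set \<Rightarrow> ('k, 'a \<Rightarrow> 'k) module"
  where "free_module k A =
    \<lparr>carrier = {x. (\<forall>a\<in>A. x a \<in> carrier k) \<and> (\<forall>a. a \<notin> A \<longrightarrow> x a = \<zero>\<^bsub>k\<^esub>) \<and>
                   finite {a. x a \<noteq> \<zero>\<^bsub>k\<^esub>}},
     mult = undefined, one = undefined,
     zero = (\<lambda>a. \<zero>\<^bsub>k\<^esub>),
     add = (\<lambda>x y a. x a \<oplus>\<^bsub>k\<^esub> y a),
     smult = (\<lambda>c x a. c \<otimes>\<^bsub>k\<^esub> x a)\<rparr>"

definition basis_elt :: "('k, 'm) ring_scheme \<Rightarrow> 'a \<Rightarrow> 'a \<Rightarrow> 'k"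
  where "basis_elt k a = (\<lambda>b. if b = a then \<one>\<^bsub>k\<^esub> else \<zero>\<^bsub>k\<^esub>)"

section \<open>Tensor powers over the ground ring\<close>

definition tuples :: "'a set \<Rightarrow> nat \<Rightarrow> 'a list set"
  where "tuples A n = {xs. set xs \<subseteq> A \<and> length xs = n}"

text \<open>The \<open>n\<close>-fold tensor power of \<open>M\<close> is the free module on \<open>n\<close>-tuples of elements of \<open>M\<close>
  modulo additivity and homogeneity in each slot. For \<open>n = 0\<close> there are no relations and it is
  the free module on the empty tuple, which plays the role of \<open>1 \<in> k\<close>.\<close>

definition tensor_relations ::
  "('k, 'm) ring_scheme \<Rightarrow> ('k, 'a, 'p) module_scheme \<Rightarrow> nat \<Rightarrow> ('a list \<Rightarrow> 'k) set"
  where "tensor_relations k M n =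
    (let F = free_module k (tuples (carrier M) n) in
      {basis_elt k (xs[i := a \<oplus>\<^bsub>M\<^esub> b]) \<ominus>\<^bsub>F\<^esub> (basis_elt k (xs[i := a]) \<oplus>\<^bsub>F\<^esub> basis_elt k (xs[i := b])) | xs i a b.
         xs \<in> tuples (carrier M) n \<and> i < n \<and> a \<in> carrier M \<and> b \<in> carrier M} \<union>
      {basis_elt k (xs[i := c \<odot>\<^bsub>M\<^esub> a]) \<ominus>\<^bsub>F\<^esub> (c \<odot>\<^bsub>F\<^esub> basis_elt k (xs[i := a])) | xs i c a.
         xs \<in> tuples (carrier M) n \<and> i < n \<and> c \<in> carrier k \<and> a \<in> carrier M})"

definition tensor_null ::
  "('k, 'm) ring_scheme \<Rightarrow> ('k, 'a, 'p) module_scheme \<Rightarrow> nat \<Rightarrow> ('a list \<Rightarrow> 'k) set"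
  where "tensor_null k M n =
    submodule_span k (free_module k (tuples (carrier M) n)) (tensor_relations k M n)"

definition tensor_power ::
  "('k, 'm) ring_scheme \<Rightarrow> ('k, 'a, 'p) module_scheme \<Rightarrow> nat \<Rightarrow> ('k, ('a list \<Rightarrow> 'k) set) module"
  where "tensor_power k M n =
    quotient_module (free_module k (tuples (carrier M) n)) (tensor_null k M n)"

definition pure_tensor ::
  "('k, 'm) ring_scheme \<Rightarrow> ('k, 'a, 'p) module_scheme \<Rightarrow> 'a list \<Rightarrow> ('a list \<Rightarrow> 'k) set"
  where "pure_tensor k M xs =
    tensor_null k M (length xs) +>\<^bsub>free_module k (tuples (carrier M) (length xs))\<^esub> basis_elt k xs"

section \<open>Cohomology of cochain complexes of modules\<close>

definition cocycles ::
  "(nat \<Rightarrow> ('k, 'a, 'p) module_scheme) \<Rightarrow> (nat \<Rightarrow> 'a \<Rightarrow> 'a) \<Rightarrow> nat \<Rightarrow> 'a set"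
  where "cocycles C d n = {x \<in> carrier (C n). d n x = \<zero>\<^bsub>C (Suc n)\<^esub>}"

definition coboundaries ::
  "(nat \<Rightarrow> ('k, 'a, 'p) module_scheme) \<Rightarrow> (nat \<Rightarrow> 'a \<Rightarrow> 'a) \<Rightarrow> nat \<Rightarrow> 'a set"
  where "coboundaries C d n = (case n of 0 \<Rightarrow> {\<zero>\<^bsub>C 0\<^esub>} | Suc m \<Rightarrow> d m ` carrier (C m))"

definition cohomology ::
  "(nat \<Rightarrow> ('k, 'a, 'p) module_scheme) \<Rightarrow> (nat \<Rightarrow> 'a \<Rightarrow> 'a) \<Rightarrow> nat \<Rightarrow> ('k, 'a set) module"
  where "cohomology C d n = quotient_module ((C n)\<lparr>carrier := cocycles C d n\<rparr>) (coboundaries C d n)"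

text \<open>The map on cohomology, with target the complex \<open>(C, d)\<close>, induced by a cochain map \<open>F\<close>;
  it sends the class of \<open>z\<close> to the class of \<open>F n z\<close>.\<close>

definition cohomology_map ::
  "(nat \<Rightarrow> ('k, 'b, 'p) module_scheme) \<Rightarrow> (nat \<Rightarrow> 'b \<Rightarrow> 'b) \<Rightarrow> (nat \<Rightarrow> 'a \<Rightarrow> 'b) \<Rightarrow> nat \<Rightarrow> 'a set \<Rightarrow> 'b set"
  where "cohomology_map C d F n X = coboundaries C d n <+>\<^bsub>C n\<^esub> (F n ` X)"

section \<open>Hochschild cochains of a group ring\<close>

definition group_ring :: "('k, 'm) ring_scheme \<Rightarrow> ('g, 'n) monoid_scheme \<Rightarrow> ('k, 'g \<Rightarrow> 'k) module"
  where "group_ring k G = (free_module k (carrier G))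
    \<lparr>mult := (\<lambda>x y g. if g \<in> carrier G
        then (\<Oplus>\<^bsub>k\<^esub>h\<in>{h \<in> carrier G. x h \<noteq> \<zero>\<^bsub>k\<^esub>}. x h \<otimes>\<^bsub>k\<^esub> y (inv\<^bsub>G\<^esub> h \<otimes>\<^bsub>G\<^esub> g)) else \<zero>\<^bsub>k\<^esub>),
     one := basis_elt k \<one>\<^bsub>G\<^esub>\<rparr>"

definition list_mult :: "('g, 'n) monoid_scheme \<Rightarrow> 'g list \<Rightarrow> 'g"
  where "list_mult G gs = foldr (\<otimes>\<^bsub>G\<^esub>) gs \<one>\<^bsub>G\<^esub>"

text \<open>\<open>(g\<^sub>1, \<dots>, g\<^sub>n) \<mapsto> (g\<^sub>1, \<dots>, g\<^sub>i g\<^bsub>i+1\<^esub>, \<dots>, g\<^sub>n)\<close> for \<open>1 \<le> i < n\<close>; lists are indexed from \<open>0\<close>.\<close>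

definition merge_at :: "('g, 'n) monoid_scheme \<Rightarrow> nat \<Rightarrow> 'g list \<Rightarrow> 'g list"
  where "merge_at G i gs = take (i - 1) gs @ [gs ! (i - 1) \<otimes>\<^bsub>G\<^esub> gs ! i] @ drop (i + 1) gs"

definition hochschild_cochains ::
  "('k, 'm) ring_scheme \<Rightarrow> ('g, 'n) monoid_scheme \<Rightarrow> nat \<Rightarrow> ('k, (('g \<Rightarrow> 'k) list \<Rightarrow> 'k) set \<Rightarrow> 'g \<Rightarrow> 'k) module"
  where "hochschild_cochains k G n =
    hom_module k (tensor_power k (group_ring k G) n) (group_ring k G)"

definition group_tensor ::
  "('k, 'm) ring_scheme \<Rightarrow> ('g, 'n) monoid_scheme \<Rightarrow> 'g list \<Rightarrow> (('g \<Rightarrow> 'k) list \<Rightarrow> 'k) set"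
  where "group_tensor k G gs = pure_tensor k (group_ring k G) (map (basis_elt k) gs)"

text \<open>The \<open>n\<close>-cochain with prescribed values on the tensors \<open>g\<^sub>1 \<otimes> \<dots> \<otimes> g\<^sub>n\<close> of group elements,
  which form a basis of the tensor power.\<close>

definition cochain_of ::
  "('k, 'm) ring_scheme \<Rightarrow> ('g, 'n) monoid_scheme \<Rightarrow> nat \<Rightarrow> ('g list \<Rightarrow> 'g \<Rightarrow> 'k) \<Rightarrow>
    (('g \<Rightarrow> 'k) list \<Rightarrow> 'k) set \<Rightarrow> 'g \<Rightarrow> 'k"
  where "cochain_of k G n v =
    (THE f. f \<in> carrier (hochschild_cochains k G n) \<and>
            (\<forall>gs\<in>tuples (carrier G) n. f (group_tensor k G gs) = v gs))"

definition hochschild_diff ::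
  "('k, 'm) ring_scheme \<Rightarrow> ('g, 'n) monoid_scheme \<Rightarrow> nat \<Rightarrow>
    ((('g \<Rightarrow> 'k) list \<Rightarrow> 'k) set \<Rightarrow> 'g \<Rightarrow> 'k) \<Rightarrow> (('g \<Rightarrow> 'k) list \<Rightarrow> 'k) set \<Rightarrow> 'g \<Rightarrow> 'k"
  where "hochschild_diff k G n f =
    (let A = group_ring k G; s = (\<lambda>i::nat. (\<ominus>\<^bsub>k\<^esub> \<one>\<^bsub>k\<^esub>) [^]\<^bsub>k\<^esub> i) in
     cochain_of k G (Suc n) (\<lambda>gs.
       (basis_elt k (hd gs) \<otimes>\<^bsub>A\<^esub> f (group_tensor k G (tl gs)))
       \<oplus>\<^bsub>A\<^esub> (\<Oplus>\<^bsub>A\<^esub>i\<in>{1..n}. s i \<odot>\<^bsub>A\<^esub> f (group_tensor k G (merge_at G i gs)))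
       \<oplus>\<^bsub>A\<^esub> (s (Suc n) \<odot>\<^bsub>A\<^esub> (f (group_tensor k G (butlast gs)) \<otimes>\<^bsub>A\<^esub> basis_elt k (last gs)))))"

text \<open>In degree \<open>0\<close> the only tuple is \<open>[]\<close>, with product the identity \<open>e\<close>, so the condition below
  becomes the strictness requirement \<open>f(1) = \<lambda>e\<close>.\<close>

definition AP_cochains ::
  "('k, 'm) ring_scheme \<Rightarrow> ('g, 'n) monoid_scheme \<Rightarrow> nat \<Rightarrow> ('k, (('g \<Rightarrow> 'k) list \<Rightarrow> 'k) set \<Rightarrow> 'g \<Rightarrow> 'k) module"
  where "AP_cochains k G n = (hochschild_cochains k G n)
    \<lparr>carrier := {f \<in> carrier (hochschild_cochains k G n).
        \<forall>gs\<in>tuples (carrier G) n. \<exists>c\<in>carrier k.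
          f (group_tensor k G gs) = c \<odot>\<^bsub>group_ring k G\<^esub> basis_elt k (list_mult G gs)}\<rparr>"

definition AP_cohomology ::
  "('k, 'm) ring_scheme \<Rightarrow> ('g, 'n) monoid_scheme \<Rightarrow> nat \<Rightarrow> ('k, ((('g \<Rightarrow> 'k) list \<Rightarrow> 'k) set \<Rightarrow> 'g \<Rightarrow> 'k) set) module"
  where "AP_cohomology k G = cohomology (AP_cochains k G) (hochschild_diff k G)"

text \<open>Functoriality: for a ring homomorphism \<open>\<rho> : k \<rightarrow> k'\<close> and a group homomorphism
  \<open>\<phi> : H \<rightarrow> G\<close>, the autopoietic cochain with coefficients \<open>\<lambda>\<close> is sent to the one with coefficients
  \<open>(h\<^sub>1, \<dots>, h\<^sub>n) \<mapsto> \<rho> (\<lambda> (\<phi> h\<^sub>1, \<dots>, \<phi> h\<^sub>n))\<close>; the coefficient \<open>\<lambda> (g\<^sub>1, \<dots>, g\<^sub>n)\<close>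
  is recovered as the coefficient of \<open>f (g\<^sub>1 \<otimes> \<dots> \<otimes> g\<^sub>n)\<close> at \<open>g\<^sub>1 \<cdots> g\<^sub>n\<close>.\<close>

definition AP_map ::
  "('k, 'm) ring_scheme \<Rightarrow> ('l, 'm') ring_scheme \<Rightarrow> ('g, 'n) monoid_scheme \<Rightarrow> ('h, 'n') monoid_scheme \<Rightarrow>
    ('k \<Rightarrow> 'l) \<Rightarrow> ('h \<Rightarrow> 'g) \<Rightarrow> nat \<Rightarrow>
    ((('g \<Rightarrow> 'k) list \<Rightarrow> 'k) set \<Rightarrow> 'g \<Rightarrow> 'k) \<Rightarrow> (('h \<Rightarrow> 'l) list \<Rightarrow> 'l) set \<Rightarrow> 'h \<Rightarrow> 'l"
  where "AP_map k k' G H \<rho> \<phi> n f =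
    cochain_of k' H n (\<lambda>hs.
      \<rho> (f (group_tensor k G (map \<phi> hs)) (list_mult G (map \<phi> hs)))
        \<odot>\<^bsub>group_ring k' H\<^esub> basis_elt k' (list_mult H hs))"

definition AP_cohomology_map ::
  "('k, 'm) ring_scheme \<Rightarrow> ('l, 'm') ring_scheme \<Rightarrow> ('g, 'n) monoid_scheme \<Rightarrow> ('h, 'n') monoid_scheme \<Rightarrow>
    ('k \<Rightarrow> 'l) \<Rightarrow> ('h \<Rightarrow> 'g) \<Rightarrow> nat \<Rightarrow>
    ((('g \<Rightarrow> 'k) list \<Rightarrow> 'k) set \<Rightarrow> 'g \<Rightarrow> 'k) set \<Rightarrow> ((('h \<Rightarrow> 'l) list \<Rightarrow> 'l) set \<Rightarrow> 'h \<Rightarrow> 'l) set"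
  where "AP_cohomology_map k k' G H \<rho> \<phi> =
    cohomology_map (AP_cochains k' H) (hochschild_diff k' H) (AP_map k k' G H \<rho> \<phi>)"

section \<open>Singular cohomology with coefficients\<close>

definition singular_cochains ::
  "('k, 'm) ring_scheme \<Rightarrow> 'a topology \<Rightarrow> nat \<Rightarrow> ('k, 'a chain \<Rightarrow> 'k) module"
  where "singular_cochains k X p =
    \<lparr>carrier = hom (chain_group p X) (add_monoid k) \<inter> extensional (singular_chain_set p X),
     mult = undefined, one = undefined,
     zero = (\<lambda>c\<in>singular_chain_set p X. \<zero>\<^bsub>k\<^esub>),
     add = (\<lambda>u v. \<lambda>c\<in>singular_chain_set p X. u c \<oplus>\<^bsub>k\<^esub> v c),
     smult = (\<lambda>a u. \<lambda>c\<in>singular_chain_set p X. a \<otimes>\<^bsub>k\<^esub> u c)\<rparr>"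

definition singular_codiff :: "'a topology \<Rightarrow> nat \<Rightarrow> ('a chain \<Rightarrow> 'k) \<Rightarrow> 'a chain \<Rightarrow> 'k"
  where "singular_codiff X p u = (\<lambda>c\<in>singular_chain_set (Suc p) X. u (chain_boundary (Suc p) c))"

definition singular_cohomology ::
  "('k, 'm) ring_scheme \<Rightarrow> 'a topology \<Rightarrow> nat \<Rightarrow> ('k, ('a chain \<Rightarrow> 'k) set) module"
  where "singular_cohomology k X = cohomology (singular_cochains k X) (singular_codiff X)"

text \<open>The map \<open>H\<^sup>p(X; k) \<rightarrow> H\<^sup>p(Y; k')\<close> induced by a continuous map \<open>w : Y \<rightarrow> X\<close> and a ring
  homomorphism \<open>\<rho> : k \<rightarrow> k'\<close>.\<close>

definition singular_cohomology_map ::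
  "('l, 'm) ring_scheme \<Rightarrow> 'b topology \<Rightarrow> ('k \<Rightarrow> 'l) \<Rightarrow> ('b \<Rightarrow> 'a) \<Rightarrow> nat \<Rightarrow>
    ('a chain \<Rightarrow> 'k) set \<Rightarrow> ('b chain \<Rightarrow> 'l) set"
  where "singular_cohomology_map k' Y \<rho> w =
    cohomology_map (singular_cochains k' Y) (singular_codiff Y)
      (\<lambda>p u. \<lambda>c\<in>singular_chain_set p Y. \<rho> (u (chain_map p w c)))"

section \<open>Simplicial sets, geometric realization, classifying spaces\<close>

text \<open>\<open>face X n i\<close> is \<open>d\<^sub>i\<close> on the \<open>n\<close>-simplices, \<open>degen X n i\<close> is \<open>s\<^sub>i\<close> on the \<open>n\<close>-simplices.\<close>

record 'a simplicial_set =
  simplices :: "nat \<Rightarrow> 'a set"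
  face :: "nat \<Rightarrow> nat \<Rightarrow> 'a \<Rightarrow> 'a"
  degen :: "nat \<Rightarrow> nat \<Rightarrow> 'a \<Rightarrow> 'a"

text \<open>The codegeneracy maps of the standard simplices; the coface maps are \<open>simplical_face\<close>.\<close>

definition simplicial_codegen :: "nat \<Rightarrow> (nat \<Rightarrow> real) \<Rightarrow> nat \<Rightarrow> real"
  where "simplicial_codegen i t =
    (\<lambda>j. if j < i then t j else if j = i then t i + t (Suc i) else t (Suc j))"

text \<open>The disjoint union of one copy of the standard \<open>n\<close>-simplex for each \<open>n\<close>-simplex \<open>\<sigma>\<close>,
  indexed by the pairs \<open>(n, \<sigma>)\<close>.\<close>

definition simplex_sum :: "'a simplicial_set \<Rightarrow> ((nat \<times> 'a) \<times> (nat \<Rightarrow> real)) topology"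
  where "simplex_sum X =
    sum_topology (\<lambda>(n, \<sigma>). subtopology (powertop_real UNIV) (standard_simplex n))
      (Sigma UNIV (simplices X))"

definition glue :: "'a simplicial_set \<Rightarrow> ((nat \<times> 'a) \<times> (nat \<Rightarrow> real)) rel"
  where "glue X =
    {(((n, face X (Suc n) i \<sigma>), t), ((Suc n, \<sigma>), simplical_face i t)) | n i \<sigma> t.
       \<sigma> \<in> simplices X (Suc n) \<and> i \<le> Suc n \<and> t \<in> standard_simplex n} \<union>
    {(((Suc n, degen X n i \<sigma>), t), ((n, \<sigma>), simplicial_codegen i t)) | n i \<sigma> t.
       \<sigma> \<in> simplices X n \<and> i \<le> n \<and> t \<in> standard_simplex (Suc n)}"

definition glue_equiv :: "'a simplicial_set \<Rightarrow> ((nat \<times> 'a) \<times> (nat \<Rightarrow> real)) rel"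
  where "glue_equiv X = (glue X \<union> (glue X)\<inverse>)\<^sup>*"

definition quotient_topology :: "'a topology \<Rightarrow> ('a \<Rightarrow> 'b) \<Rightarrow> 'b topology"
  where "quotient_topology T q =
    topology (\<lambda>U. U \<subseteq> q ` topspace T \<and> openin T {x \<in> topspace T. q x \<in> U})"

lemma openin_quotient_topology:
  "openin (quotient_topology T q) U \<longleftrightarrow> U \<subseteq> q ` topspace T \<and> openin T {x \<in> topspace T. q x \<in> U}"
proof -
  have "istopology (\<lambda>U. U \<subseteq> q ` topspace T \<and> openin T {x \<in> topspace T. q x \<in> U})"
    unfolding istopology_def
  proof (intro conjI allI impI)
    fix U V
    assume U: "U \<subseteq> q ` topspace T \<and> openin T {x \<in> topspace T. q x \<in> U}"
      and V: "V \<subseteq> q ` topspace T \<and> openin T {x \<in> topspace T. q x \<in> V}"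
    have "{x \<in> topspace T. q x \<in> U \<inter> V} = {x \<in> topspace T. q x \<in> U} \<inter> {x \<in> topspace T. q x \<in> V}"
      by auto
    then show "openin T {x \<in> topspace T. q x \<in> U \<inter> V}"
      using U V by (simp add: openin_Int)
    show "U \<inter> V \<subseteq> q ` topspace T" using U by auto
  next
    fix K
    assume K: "\<forall>U\<in>K. U \<subseteq> q ` topspace T \<and> openin T {x \<in> topspace T. q x \<in> U}"
    have "{x \<in> topspace T. q x \<in> \<Union>K} = (\<Union>U\<in>K. {x \<in> topspace T. q x \<in> U})" by auto
    then show "openin T {x \<in> topspace T. q x \<in> \<Union>K}" using K by auto
    show "\<Union>K \<subseteq> q ` topspace T" using K by auto
  qed
  then show ?thesis by (simp add: quotient_topology_def)
qed

lemma quotient_map_quotient_topology: "quotient_map T (quotient_topology T q) q"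
proof -
  have "openin (quotient_topology T q) (q ` topspace T)"
    by (simp add: openin_quotient_topology) (metis (mono_tags, lifting) Collect_cong Collect_mem_eq imageI openin_topspace)
  moreover have "topspace (quotient_topology T q) \<subseteq> q ` topspace T"
    using openin_quotient_topology[of T q] openin_topspace by blast
  ultimately have "topspace (quotient_topology T q) = q ` topspace T"
    using openin_subset by blast
  then show ?thesis by (auto simp: quotient_map_def openin_quotient_topology)
qed

definition realization :: "'a simplicial_set \<Rightarrow> ((nat \<times> 'a) \<times> (nat \<Rightarrow> real)) set topology"
  where "realization X = quotient_topology (simplex_sum X) (\<lambda>x. glue_equiv X `` {x})"

text \<open>The map of realizations, with target the realization of \<open>Y\<close>, induced by a simplicial map
  given by \<open>\<theta> n\<close> on \<open>n\<close>-simplices.\<close>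

definition realization_map ::
  "'b simplicial_set \<Rightarrow> (nat \<Rightarrow> 'a \<Rightarrow> 'b) \<Rightarrow> ((nat \<times> 'a) \<times> (nat \<Rightarrow> real)) set \<Rightarrow> ((nat \<times> 'b) \<times> (nat \<Rightarrow> real)) set"
  where "realization_map Y \<theta> c = glue_equiv Y `` ((\<lambda>((n, \<sigma>), t). ((n, \<theta> n \<sigma>), t)) ` c)"

text \<open>The nerve of \<open>G\<close> regarded as a category with one object.\<close>

definition nerve :: "('g, 'n) monoid_scheme \<Rightarrow> 'g list simplicial_set"
  where "nerve G =
    \<lparr>simplices = tuples (carrier G),
     face = (\<lambda>n i gs. if i = 0 then tl gs else if i = n then butlast gs else merge_at G i gs),
     degen = (\<lambda>n i gs. take i gs @ [\<one>\<^bsub>G\<^esub>] @ drop i gs)\<rparr>"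

definition classifying_space ::
  "('g, 'n) monoid_scheme \<Rightarrow> ((nat \<times> 'g list) \<times> (nat \<Rightarrow> real)) set topology"
  where "classifying_space G = realization (nerve G)"

definition classifying_map ::
  "('g, 'n) monoid_scheme \<Rightarrow> ('h \<Rightarrow> 'g) \<Rightarrow>
    ((nat \<times> 'h list) \<times> (nat \<Rightarrow> real)) set \<Rightarrow> ((nat \<times> 'g list) \<times> (nat \<Rightarrow> real)) set"
  where "classifying_map G \<phi> = realization_map (nerve G) (\<lambda>_. map \<phi>)"

end

theory Submission
  imports Defs "HOL-Analysis.Abstract_Topological_Spaces"
begin

text \<open>An autopoietic cochain is determined by its coefficients \<open>\<lambda> (g\<^sub>1, \<dots>,
  g\<^sub>n)\<close>, and these can be chosen freely. In the formula for \<open>\<delta>\<close>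
  every term is a multiple of the product \<open>g\<^sub>1 \<cdots> g\<^bsub>n+1\<^esub>\<close>, so
  on coefficients \<open>\<delta>\<close> is the alternating sum over the faces of the nerve: the
  autopoietic complex is the complex of simplicial cochains of the nerve of \<open>G\<close>. It
  remains to compare the simplicial cochains of the nerve with the singular cochains of its
  realization \<open>BG\<close>.

  Evaluating a singular cochain on the characteristic maps of the simplices of the nerve is a
  cochain map (\<open>cell_evaluation\<close>), natural in \<open>k\<close> and \<open>G\<close>. It
  has a section \<open>edge_cochain\<close>, also a cochain map, which evaluates simplicial cochains
  on the simplex of the nerve formed by the edges of a singular simplex, so it is surjective on
  cocycles. It is injective on cohomology because replacing a singular simplex by the simplex of the
  nerve with the same edges is chain homotopic to the identity
  (\<open>straighten_base_homotopy\<close>).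

  The edges and the homotopy come from the universal cover \<open>EG \<rightarrow> BG\<close>,
  constructed as the realization of the simplicial set of tuples \<open>(h\<^sub>0, \<dots>,
  h\<^sub>n)\<close>. Three facts about it are needed. First, \<open>EG\<close> is contractible, by
  coning off to the vertex \<open>\<one>\<close> (\<open>contractible_EG\<close>). Second,
  \<open>G\<close> acts freely on \<open>EG\<close> with small open sets that are disjoint from
  their translates (\<open>EG_slice\<close>); the proof regards the points of \<open>EG\<close> as
  step functions from \<open>[0, 1)\<close> to \<open>G\<close> and measures how long a value is
  taken. Hence singular simplices of \<open>BG\<close> lift to \<open>EG\<close>, uniquely up to
  translation (\<open>singular_simplex_lift\<close>, \<open>singular_simplex_lifts_orbit\<close>).
  Third, there is an equivariant function \<open>EG \<rightarrow> G\<close>, the first value of the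
  step function. It attaches a group element to every vertex of a singular simplex of
  \<open>EG\<close>, which gives the edges downstairs, and it allows an equivariant chain homotopy
  to be built by induction on the degree from the acyclicity of \<open>EG\<close>, choosing fillings
  only for simplices with initial vertex \<open>\<one>\<close> (\<open>homotopy_properties\<close>).
  By equivariance it descends to \<open>BG\<close>.

  The remaining work identifies \<open>Hom(k[G]\<^sup>\<otimes>\<^sup>n, k[G])\<close> with the
  functions \<open>G\<^sup>n \<rightarrow> k[G]\<close> (\<open>tensor_power_map_exists\<close>,
  \<open>tensor_power_map_eq\<close>), the tensor power being defined by generators and relations.\<close>

section \<open>Geometric realization\<close>

text \<open>The standard simplex with its topology as a subspace of the product \<open>\<nat> \<Rightarrow> \<real>\<close>.\<close>

abbreviation simplex_top :: "nat \<Rightarrow> (nat \<Rightarrow> real) topology"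
  where "simplex_top n \<equiv> subtopology (powertop_real UNIV) (standard_simplex n)"

text \<open>The vertices of the standard simplices.\<close>

abbreviation vert :: "nat \<Rightarrow> nat \<Rightarrow> real"
  where "vert i \<equiv> (\<lambda>j. if j = i then 1 else 0)"

text \<open>The point of the realization that is represented by a point of the disjoint union of simplices.\<close>

definition cls :: "'a simplicial_set \<Rightarrow> (nat \<times> 'a) \<times> (nat \<Rightarrow> real) \<Rightarrow> ((nat \<times> 'a) \<times> (nat \<Rightarrow> real)) set"
  where "cls X x = glue_equiv X `` {x}"

lemma glue_equiv_refl: "(x, x) \<in> glue_equiv X"
  by (simp add: glue_equiv_def)

lemma glue_equiv_sym: "(x, y) \<in> glue_equiv X \<Longrightarrow> (y, x) \<in> glue_equiv X"
  unfolding glue_equiv_def by (meson sym_Un_converse sym_rtrancl symE)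

lemma glue_equiv_trans: "\<lbrakk>(x, y) \<in> glue_equiv X; (y, z) \<in> glue_equiv X\<rbrakk> \<Longrightarrow> (x, z) \<in> glue_equiv X"
  unfolding glue_equiv_def by (rule rtrancl_trans)

lemma cls_eq_iff: "cls X x = cls X y \<longleftrightarrow> (x, y) \<in> glue_equiv X"
  unfolding cls_def using glue_equiv_refl glue_equiv_sym glue_equiv_trans by (fast+)

lemma cls_glue: "(x, y) \<in> glue X \<Longrightarrow> cls X x = cls X y"
  by (auto simp: cls_eq_iff glue_equiv_def)

lemma self_in_cls: "x \<in> cls X x"
  by (simp add: cls_def glue_equiv_refl)

lemma glue_face:
  "\<lbrakk>\<sigma> \<in> simplices X (Suc n); i \<le> Suc n; t \<in> standard_simplex n\<rbrakk> \<Longrightarrow>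
    (((n, face X (Suc n) i \<sigma>), t), ((Suc n, \<sigma>), simplical_face i t)) \<in> glue X"
  unfolding glue_def by blast

lemma glue_degen:
  "\<lbrakk>\<sigma> \<in> simplices X n; i \<le> n; t \<in> standard_simplex (Suc n)\<rbrakk> \<Longrightarrow>
    (((Suc n, degen X n i \<sigma>), t), ((n, \<sigma>), simplicial_codegen i t)) \<in> glue X"
  unfolding glue_def by blast

lemma glue_cases [consumes 1, case_names face degen]:
  assumes "(x, y) \<in> glue X"
  obtains n i \<sigma> t where "x = ((n, face X (Suc n) i \<sigma>), t)" "y = ((Suc n, \<sigma>), simplical_face i t)"
      "\<sigma> \<in> simplices X (Suc n)" "i \<le> Suc n" "t \<in> standard_simplex n"
    | n i \<sigma> t where "x = ((Suc n, degen X n i \<sigma>), t)" "y = ((n, \<sigma>), simplicial_codegen i t)"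
      "\<sigma> \<in> simplices X n" "i \<le> n" "t \<in> standard_simplex (Suc n)"
  using assms unfolding glue_def by blast

text \<open>A function that is constant on glued points is constant on equivalence classes.\<close>

lemma glue_invariant_cls:
  assumes "\<And>x y. (x, y) \<in> glue X \<Longrightarrow> F x = F y" and "cls X x = cls X y"
  shows "F x = F y"
proof -
  have "(x, y) \<in> (glue X \<union> (glue X)\<inverse>)\<^sup>*"
    using assms(2) by (simp add: cls_eq_iff glue_equiv_def)
  then show ?thesis
    by (induction rule: rtrancl_induct) (use assms(1) in auto)
qed

text \<open>The function induced on equivalence classes by a function on representatives; it is meaningful
  only if that function is constant on the classes.\<close>

definition descend :: "('x \<Rightarrow> 'c) \<Rightarrow> 'x set \<Rightarrow> 'c"
  where "descend F c = F (SOME x. x \<in> c)"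

lemma descend_cls:
  assumes "\<And>x y. (x, y) \<in> glue X \<Longrightarrow> F x = F y"
  shows "descend F (cls X x) = F x"
proof -
  define y where "y = (SOME y. y \<in> cls X x)"
  have "y \<in> cls X x" unfolding y_def by (rule someI) (rule self_in_cls)
  then have "cls X x = cls X y" by (simp add: cls_eq_iff) (simp add: cls_def)
  then have "F x = F y" using glue_invariant_cls[of X F x y] assms by blast
  then show ?thesis by (simp add: descend_def y_def)
qed

lemma topspace_simplex_sum:
  "topspace (simplex_sum X) = {((n, \<sigma>), t). \<sigma> \<in> simplices X n \<and> t \<in> standard_simplex n}"
  by (auto simp: simplex_sum_def)

lemma openin_simplex_sum:
  "openin (simplex_sum X) U \<longleftrightarrow> U \<subseteq> topspace (simplex_sum X) \<and>
    (\<forall>n. \<forall>\<sigma>\<in>simplices X n. openin (simplex_top n) {t. ((n, \<sigma>), t) \<in> U})"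
  unfolding simplex_sum_def openin_sum_topology by auto

lemma continuous_map_from_simplex_sum:
  "continuous_map (simplex_sum X) Z F \<longleftrightarrow>
    (\<forall>n. \<forall>\<sigma>\<in>simplices X n. continuous_map (simplex_top n) Z (\<lambda>t. F ((n, \<sigma>), t)))"
proof -
  have 1: "{x \<in> topspace (simplex_sum X). F x \<in> U} \<subseteq> topspace (simplex_sum X)" for U
    by auto
  have 2: "{t. ((n, \<sigma>), t) \<in> {x \<in> topspace (simplex_sum X). F x \<in> U}} =
    {t \<in> standard_simplex n. F ((n, \<sigma>), t) \<in> U}" if "\<sigma> \<in> simplices X n" for n \<sigma> U
    using that by (auto simp: topspace_simplex_sum)
  show ?thesis
    unfolding continuous_map_def openin_simplex_sum
    using 1 2 by (auto simp: topspace_simplex_sum Pi_iff)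
qed

lemma continuous_map_simplex_inclusion:
  assumes "\<sigma> \<in> simplices X n"
  shows "continuous_map (simplex_top n) (simplex_sum X) (\<lambda>t. ((n, \<sigma>), t))"
proof -
  have "continuous_map (simplex_sum X) (simplex_sum X) (\<lambda>x. x)" by simp
  then show ?thesis using assms unfolding continuous_map_from_simplex_sum by blast
qed

lemma quotient_map_cls: "quotient_map (simplex_sum X) (realization X) (cls X)"
  unfolding realization_def using quotient_map_quotient_topology[of "simplex_sum X" "\<lambda>x. glue_equiv X `` {x}"]
  by (simp add: cls_def[abs_def])

lemma topspace_realization: "topspace (realization X) = cls X ` topspace (simplex_sum X)"
  using quotient_map_cls[of X] by (simp add: quotient_map_def)

lemma cls_in_realization:
  "\<lbrakk>\<sigma> \<in> simplices X n; t \<in> standard_simplex n\<rbrakk> \<Longrightarrow> cls X ((n, \<sigma>), t) \<in> topspace (realization X)"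
  by (auto simp: topspace_realization topspace_simplex_sum)

lemma realization_cases:
  assumes "x \<in> topspace (realization X)"
  obtains n \<sigma> t where "x = cls X ((n, \<sigma>), t)" "\<sigma> \<in> simplices X n" "t \<in> standard_simplex n"
  using assms by (auto simp: topspace_realization topspace_simplex_sum)

lemma continuous_map_from_realization:
  assumes "\<And>n \<sigma>. \<sigma> \<in> simplices X n \<Longrightarrow> continuous_map (simplex_top n) Z (\<lambda>t. F (cls X ((n, \<sigma>), t)))"
  shows "continuous_map (realization X) Z F"
  by (rule continuous_compose_quotient_map[OF quotient_map_cls])
    (use assms in \<open>simp add: continuous_map_from_simplex_sum\<close>)

text \<open>Maps of simplicial sets, given by \<open>\<theta> n\<close> on \<open>n\<close>-simplices.\<close>

definition simplicial_map :: "'a simplicial_set \<Rightarrow> 'b simplicial_set \<Rightarrow> (nat \<Rightarrow> 'a \<Rightarrow> 'b) \<Rightarrow> bool"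
  where "simplicial_map X Y \<theta> \<longleftrightarrow>
    (\<forall>n. \<forall>\<sigma>\<in>simplices X n. \<theta> n \<sigma> \<in> simplices Y n) \<and>
    (\<forall>n. \<forall>\<sigma>\<in>simplices X (Suc n). \<forall>i\<le>Suc n. \<theta> n (face X (Suc n) i \<sigma>) = face Y (Suc n) i (\<theta> (Suc n) \<sigma>)) \<and>
    (\<forall>n. \<forall>\<sigma>\<in>simplices X n. \<forall>i\<le>n. \<theta> (Suc n) (degen X n i \<sigma>) = degen Y n i (\<theta> n \<sigma>))"

lemma realization_map_cls:
  assumes "simplicial_map X Y \<theta>"
  shows "realization_map Y \<theta> (cls X ((n, \<sigma>), t)) = cls Y ((n, \<theta> n \<sigma>), t)"
proof -
  define \<Theta> where "\<Theta> = (\<lambda>((n, \<sigma>), t). ((n, \<theta> n \<sigma>), t) :: (nat \<times> _) \<times> (nat \<Rightarrow> real))"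
  have glue: "cls Y (\<Theta> x) = cls Y (\<Theta> y)" if "(x, y) \<in> glue X" for x y
    using that
  proof (cases rule: glue_cases)
    case (face n i \<sigma> t)
    then have "(\<Theta> x, \<Theta> y) \<in> glue Y"
      using assms glue_face[of "\<theta> (Suc n) \<sigma>" Y n i t] by (auto simp: simplicial_map_def \<Theta>_def)
    then show ?thesis by (rule cls_glue)
  next
    case (degen n i \<sigma> t)
    then have "(\<Theta> x, \<Theta> y) \<in> glue Y"
      using assms glue_degen[of "\<theta> n \<sigma>" Y n i t] by (auto simp: simplicial_map_def \<Theta>_def)
    then show ?thesis by (rule cls_glue)
  qed
  have eq: "cls Y (\<Theta> y) = cls Y (\<Theta> x)" if "y \<in> cls X x" for x y
    by (rule glue_invariant_cls[of X "\<lambda>x. cls Y (\<Theta> x)"]) (use glue that in \<open>auto simp: cls_eq_iff\<close>, simp add: cls_def glue_equiv_sym)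
  have "realization_map Y \<theta> (cls X x) = cls Y (\<Theta> x)" for x
  proof -
    have "realization_map Y \<theta> (cls X x) = (\<Union>y\<in>cls X x. cls Y (\<Theta> y))"
      unfolding realization_map_def \<Theta>_def[symmetric] cls_def[of Y] by blast
    also have "\<dots> = (\<Union>y\<in>cls X x. cls Y (\<Theta> x))"
      using eq by auto
    also have "\<dots> = cls Y (\<Theta> x)"
      using self_in_cls by fastforce
    finally show ?thesis .
  qed
  from this[of "((n, \<sigma>), t)"] show ?thesis by (simp add: \<Theta>_def)
qed

lemma continuous_map_cls:
  assumes "\<sigma> \<in> simplices X n"
  shows "continuous_map (simplex_top n) (realization X) (\<lambda>t. cls X ((n, \<sigma>), t))"
  using continuous_map_compose[OF continuous_map_simplex_inclusion[OF assms]
      quotient_imp_continuous_map[OF quotient_map_cls]] by (simp add: o_def)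

lemma continuous_map_realization_map:
  assumes "simplicial_map X Y \<theta>"
  shows "continuous_map (realization X) (realization Y) (realization_map Y \<theta>)"
  by (rule continuous_map_from_realization, unfold realization_map_cls[OF assms])
    (use assms in \<open>auto simp: simplicial_map_def intro!: continuous_map_cls\<close>)

text \<open>The characteristic map of an \<open>n\<close>-simplex, as a singular simplex of the realization.\<close>

definition cell :: "'a simplicial_set \<Rightarrow> nat \<Rightarrow> 'a \<Rightarrow> (nat \<Rightarrow> real) \<Rightarrow> ((nat \<times> 'a) \<times> (nat \<Rightarrow> real)) set"
  where "cell X n \<sigma> = restrict (\<lambda>t. cls X ((n, \<sigma>), t)) (standard_simplex n)"

lemma singular_simplex_cell:
  assumes "\<sigma> \<in> simplices X n"
  shows "singular_simplex n (realization X) (cell X n \<sigma>)"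
  unfolding singular_simplex_def cell_def
  using continuous_map_cls[OF assms] by (auto intro: continuous_map_eq)

lemma singular_face_cell:
  assumes "\<sigma> \<in> simplices X (Suc n)" "i \<le> Suc n"
  shows "singular_face (Suc n) i (cell X (Suc n) \<sigma>) = cell X n (face X (Suc n) i \<sigma>)"
proof
  fix t
  show "singular_face (Suc n) i (cell X (Suc n) \<sigma>) t = cell X n (face X (Suc n) i \<sigma>) t"
    using cls_glue[OF glue_face[OF assms, of t]] assms simplical_face_in_standard_simplex[of "Suc n" i t]
    by (auto simp: singular_face_def cell_def)
qed

lemma simplex_map_cell:
  assumes "simplicial_map X Y \<theta>"
  shows "simplex_map n (realization_map Y \<theta>) (cell X n \<sigma>) = cell Y n (\<theta> n \<sigma>)"
  by (auto simp: simplex_map_def cell_def realization_map_cls[OF assms] fun_eq_iff restrict_def)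

section \<open>Covering spaces given by free actions\<close>

text \<open>Convexity of a set of sequences, stated pointwise.\<close>

definition segment_convex :: "(nat \<Rightarrow> real) set \<Rightarrow> bool"
  where "segment_convex K \<longleftrightarrow>
    (\<forall>x\<in>K. \<forall>y\<in>K. \<forall>a. 0 \<le> a \<and> a \<le> 1 \<longrightarrow> (\<lambda>i. (1 - a) * x i + a * y i) \<in> K)"

lemma connectedin_segment_convex:
  assumes "segment_convex K"
  shows "connectedin (powertop_real UNIV) K"
proof -
  define g where "g = (\<lambda>(x::nat\<Rightarrow>real) y u i. (1 - u) * x i + u * y i)"
  have "continuous_map (top_of_set {0..1}) (powertop_real UNIV) (g x y)" for x y
    unfolding g_def continuous_map_componentwise
    by (force intro: continuous_intros)
  moreover have "g x y \<in> {0..1} \<rightarrow> K" "g x y 0 = x" "g x y 1 = y" if "x \<in> K" "y \<in> K" for x y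
    using that assms by (auto simp: g_def segment_convex_def)
  ultimately have "path_connectedin (powertop_real UNIV) K"
    unfolding path_connectedin_def path_connected_space_def pathin_def
    by (metis continuous_map_in_subtopology euclidean_product_topology top_greatest topspace_euclidean topspace_euclidean_subtopology)
  then show ?thesis by (rule path_connectedin_imp_connectedin)
qed

lemma segment_convex_halfspaces:
  assumes "segment_convex K"
  shows "segment_convex {x \<in> K. x j \<le> c}" and "segment_convex {x \<in> K. c \<le> x j}"
proof -
  have *: "(1 - a) * u + a * v \<le> c" if "u \<le> c" "v \<le> c" "0 \<le> a" "a \<le> 1" for u v a c :: real
    using that convex_bound_le[of u c v "1 - a" a] by simp
  have **: "c \<le> (1 - a) * u + a * v" if "c \<le> u" "c \<le> v" "0 \<le> a" "a \<le> 1" for u v a :: real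
    using *[of "- u" "- c" "- v" a] that by simp
  show "segment_convex {x \<in> K. x j \<le> c}" using assms * unfolding segment_convex_def by auto
  show "segment_convex {x \<in> K. c \<le> x j}" using assms ** unfolding segment_convex_def by auto
qed

text \<open>A covering map \<open>pr : E \<rightarrow> B\<close> whose fibres are the orbits of a group acting on \<open>E\<close>. Around every
  point of \<open>E\<close> there is an open slice that is disjoint from all of its proper translates, so \<open>pr\<close> is
  injective on the slice, and since \<open>pr\<close> is open it is a homeomorphism from the slice to an open set.\<close>

locale free_cover = group G for G :: "('a, 'm) monoid_scheme" (structure) +
  fixes E :: "'e topology" and B :: "'x topology" and act :: "'a \<Rightarrow> 'e \<Rightarrow> 'e" and pr :: "'e \<Rightarrow> 'x"
  assumes act_continuous: "g \<in> carrier G \<Longrightarrow> continuous_map E E (act g)"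
    and act_mult: "\<lbrakk>g \<in> carrier G; h \<in> carrier G; x \<in> topspace E\<rbrakk> \<Longrightarrow> act g (act h x) = act (g \<otimes> h) x"
    and act_one: "x \<in> topspace E \<Longrightarrow> act \<one> x = x"
    and pr_continuous: "continuous_map E B pr"
    and pr_open: "open_map E B pr"
    and pr_surj: "pr ` topspace E = topspace B"
    and pr_act: "\<lbrakk>g \<in> carrier G; x \<in> topspace E\<rbrakk> \<Longrightarrow> pr (act g x) = pr x"
    and pr_eq: "\<lbrakk>x \<in> topspace E; y \<in> topspace E; pr x = pr y\<rbrakk> \<Longrightarrow> \<exists>g\<in>carrier G. y = act g x"
    and slice: "x \<in> topspace E \<Longrightarrow>
      \<exists>W. openin E W \<and> x \<in> W \<and> (\<forall>g\<in>carrier G. g \<noteq> \<one> \<longrightarrow> act g ` W \<inter> W = {})"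
begin

lemma act_closed [simp]: "\<lbrakk>g \<in> carrier G; x \<in> topspace E\<rbrakk> \<Longrightarrow> act g x \<in> topspace E"
  using act_continuous continuous_map_image_subset_topspace by blast

lemma act_free:
  assumes "x \<in> topspace E" "g \<in> carrier G" "h \<in> carrier G" "act g x = act h x"
  shows "g = h"
proof -
  obtain W where W: "x \<in> W" "\<forall>g\<in>carrier G. g \<noteq> \<one> \<longrightarrow> act g ` W \<inter> W = {}"
    using slice[OF assms(1)] by auto
  have "act (inv h \<otimes> g) x = act (inv h) (act h x)"
    using assms by (simp flip: act_mult)
  also have "\<dots> = x" using assms by (simp add: act_mult act_one)
  finally have "act (inv h \<otimes> g) ` W \<inter> W \<noteq> {}" using W(1) by (metis disjoint_iff imageI)
  then have "inv h \<otimes> g = \<one>" using W(2) assms by auto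
  then show ?thesis using assms
    by (metis inv_closed inv_equality inv_inv)
qed

text \<open>\<open>s\<close> is a continuous lift, over the set \<open>K\<close>, of \<open>\<sigma>\<close> along \<open>pr\<close>.\<close>

definition lift_on :: "(nat \<Rightarrow> real) set \<Rightarrow> ((nat \<Rightarrow> real) \<Rightarrow> 'x) \<Rightarrow> ((nat \<Rightarrow> real) \<Rightarrow> 'e) \<Rightarrow> bool"
  where "lift_on K \<sigma> s \<longleftrightarrow>
    continuous_map (subtopology (powertop_real UNIV) K) E s \<and> (\<forall>x\<in>K. pr (s x) = \<sigma> x)"

lemma lift_on_closed: "\<lbrakk>lift_on K \<sigma> s; x \<in> K\<rbrakk> \<Longrightarrow> s x \<in> topspace E"
  by (auto simp: lift_on_def continuous_map_def)

lemma lift_on_mono: "\<lbrakk>lift_on K \<sigma> s; L \<subseteq> K\<rbrakk> \<Longrightarrow> lift_on L \<sigma> s"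
  unfolding lift_on_def using continuous_map_from_subtopology_mono by blast

lemma lift_on_act:
  assumes "lift_on K \<sigma> s" "g \<in> carrier G"
  shows "lift_on K \<sigma> (\<lambda>x. act g (s x))"
  using assms lift_on_closed[OF assms(1)] continuous_map_compose[OF _ act_continuous[OF assms(2)]]
  by (auto simp: lift_on_def pr_act o_def)

text \<open>Two lifts differ by a function \<open>K \<rightarrow> G\<close>, which is locally constant because of the slices, hence
  constant because \<open>K\<close> is connected.\<close>

lemma lifts_differ_by_constant:
  assumes K: "segment_convex K" and s1: "lift_on K \<sigma> s1" and s2: "lift_on K \<sigma> s2"
    and x0: "x0 \<in> K" and g: "g \<in> carrier G" and eq: "s2 x0 = act g (s1 x0)" and x: "x \<in> K"
  shows "s2 x = act g (s1 x)"
proof -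
  let ?T = "subtopology (powertop_real UNIV) K"
  define Z where "Z h = {y \<in> K. s2 y = act h (s1 y)}" for h
  have c1: "continuous_map ?T E s1" and c2: "continuous_map ?T E s2"
    using s1 s2 by (auto simp: lift_on_def)
  have openZ: "openin ?T (Z h)" if h: "h \<in> carrier G" for h
  proof (subst openin_subopen, intro ballI)
    fix y assume y: "y \<in> Z h"
    then have yK: "y \<in> K" and hy: "s2 y = act h (s1 y)" by (auto simp: Z_def)
    obtain W where W: "openin E W" "s2 y \<in> W" "\<forall>g\<in>carrier G. g \<noteq> \<one> \<longrightarrow> act g ` W \<inter> W = {}"
      using slice[OF lift_on_closed[OF s2 yK]] by blast
    have c1h: "continuous_map ?T E (\<lambda>y. act h (s1 y))"
      using lift_on_act[OF s1 h] by (simp add: lift_on_def)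
    define N where "N = {z \<in> topspace ?T. s2 z \<in> W} \<inter> {z \<in> topspace ?T. act h (s1 z) \<in> W}"
    have N1: "openin ?T N" unfolding N_def
      by (intro openin_Int openin_continuous_map_preimage[OF c2 W(1)] openin_continuous_map_preimage[OF c1h W(1)])
    have N2: "y \<in> N" using yK W(2) hy by (auto simp: N_def)
    have N3: "N \<subseteq> Z h"
    proof
      fix z assume "z \<in> N"
      then have zK: "z \<in> K" and z: "s2 z \<in> W" "act h (s1 z) \<in> W" by (auto simp: N_def)
      have E: "s1 z \<in> topspace E" "s2 z \<in> topspace E" using lift_on_closed s1 s2 zK by auto
      have "pr (act h (s1 z)) = pr (s2 z)" using s1 s2 zK E h by (auto simp: lift_on_def pr_act)
      then obtain k where k: "k \<in> carrier G" "s2 z = act k (act h (s1 z))"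
        using pr_eq[of "act h (s1 z)" "s2 z"] E h by auto
      then have "act k ` W \<inter> W \<noteq> {}" using z by auto
      then have "k = \<one>" using W(3) k by auto
      then show "z \<in> Z h" using k E h zK by (simp add: Z_def act_one)
    qed
    show "\<exists>N. openin ?T N \<and> y \<in> N \<and> N \<subseteq> Z h" using N1 N2 N3 by blast
  qed
  have cover: "K \<subseteq> Z g \<union> (\<Union>h\<in>carrier G - {g}. Z h)"
  proof
    fix y assume y: "y \<in> K"
    have "\<exists>h\<in>carrier G. s2 y = act h (s1 y)"
      using y s1 s2 lift_on_closed by (intro pr_eq) (auto simp: lift_on_def)
    then show "y \<in> Z g \<union> (\<Union>h\<in>carrier G - {g}. Z h)" using y by (auto simp: Z_def)
  qed
  have disj: "Z g \<inter> (\<Union>h\<in>carrier G - {g}. Z h) = {}"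
    using act_free lift_on_closed[OF s1] g by (fastforce simp: Z_def)
  have "connected_space ?T"
    using connectedin_segment_convex[OF K] by (simp add: connectedin_def)
  moreover have "openin ?T (Z g)" "openin ?T (\<Union>h\<in>carrier G - {g}. Z h)"
    using openZ g by auto
  ultimately have "Z g = {} \<or> (\<Union>h\<in>carrier G - {g}. Z h) = {}"
    using cover disj unfolding connected_space_def by auto
  moreover have "x0 \<in> Z g" using x0 eq by (simp add: Z_def)
  ultimately show ?thesis using cover x by (auto simp: Z_def)
qed

lemma local_lift:
  assumes W: "openin E W" "\<forall>g\<in>carrier G. g \<noteq> \<one> \<longrightarrow> act g ` W \<inter> W = {}"
    and \<sigma>: "continuous_map (subtopology (powertop_real UNIV) K) B \<sigma>" and im: "\<sigma> ` K \<subseteq> pr ` W"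
  shows "\<exists>s. lift_on K \<sigma> s"
proof -
  have WE: "W \<subseteq> topspace E" using W(1) by (rule openin_subset)
  have inj: "inj_on pr W"
  proof (rule inj_onI)
    fix x y assume xy: "x \<in> W" "y \<in> W" "pr x = pr y"
    then obtain g where g: "g \<in> carrier G" "y = act g x" using pr_eq[of x y] WE by auto
    then have "g = \<one>" using W(2) xy by blast
    then show "x = y" using g xy WE by (auto simp: act_one)
  qed
  define s where "s = (\<lambda>x. inv_into W pr (\<sigma> x))"
  have sW: "s x \<in> W" "pr (s x) = \<sigma> x" if "x \<in> K" for x
  proof -
    have "\<sigma> x \<in> pr ` W" using im that by auto
    then show "s x \<in> W" "pr (s x) = \<sigma> x" unfolding s_def by (rule inv_into_into, rule f_inv_into_f)
  qed
  have "continuous_map (subtopology (powertop_real UNIV) K) E s"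
    unfolding continuous_map_def
  proof (intro conjI allI impI)
    show "s \<in> topspace (subtopology (powertop_real UNIV) K) \<rightarrow> topspace E"
      using sW WE by auto
    fix V assume V: "openin E V"
    have "s x \<in> V \<longleftrightarrow> \<sigma> x \<in> pr ` (W \<inter> V)" if "x \<in> K" for x
    proof
      assume "s x \<in> V"
      then have "s x \<in> W \<inter> V" using sW(1)[OF that] by simp
      then show "\<sigma> x \<in> pr ` (W \<inter> V)" using sW(2)[OF that] by (intro image_eqI[of _ pr "s x"]) simp_all
    next
      assume "\<sigma> x \<in> pr ` (W \<inter> V)"
      then obtain y where y: "\<sigma> x = pr y" "y \<in> W" "y \<in> V" by blast
      then have "s x = y" using sW[OF that] by (intro inj_onD[OF inj]) simp_all
      then show "s x \<in> V" using y by simp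
    qed
    then have "{x \<in> topspace (subtopology (powertop_real UNIV) K). s x \<in> V} =
          {x \<in> topspace (subtopology (powertop_real UNIV) K). \<sigma> x \<in> pr ` (W \<inter> V)}"
      by auto
    moreover have "openin B (pr ` (W \<inter> V))"
      using pr_open W(1) V by (simp add: open_map_def openin_Int)
    ultimately show "openin (subtopology (powertop_real UNIV) K)
        {x \<in> topspace (subtopology (powertop_real UNIV) K). s x \<in> V}"
      using openin_continuous_map_preimage[OF \<sigma>] by simp
  qed
  then show ?thesis using sW by (auto simp: lift_on_def)
qed

text \<open>If \<open>K\<close> is cut by a hyperplane and both halves have a lift, then so does \<open>K\<close>: one of the lifts can be
  translated so that the two agree on the wall, which is again convex.\<close>

lemma glue_lifts:
  assumes K: "segment_convex K" and s1: "lift_on {x \<in> K. x j \<le> c} \<sigma> s1" and s2: "lift_on {x \<in> K. c \<le> x j} \<sigma> s2"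
  shows "\<exists>s. lift_on K \<sigma> s"
proof -
  have "\<exists>g\<in>carrier G. \<forall>x\<in>K. x j = c \<longrightarrow> s2 x = act g (s1 x)"
  proof (cases "\<exists>x\<in>K. x j = c")
    case True
    then obtain x0 where x0: "x0 \<in> K" "x0 j = c" by blast
    define L where "L = {x \<in> {x \<in> K. x j \<le> c}. c \<le> x j}"
    have L: "segment_convex L" unfolding L_def by (intro segment_convex_halfspaces K)
    have l: "lift_on L \<sigma> s1" "lift_on L \<sigma> s2"
      by (rule lift_on_mono[OF s1], force simp: L_def, rule lift_on_mono[OF s2], force simp: L_def)
    have "x0 \<in> L" using x0 by (simp add: L_def)
    then obtain g where g: "g \<in> carrier G" "s2 x0 = act g (s1 x0)"
      using pr_eq[of "s1 x0" "s2 x0"] l lift_on_closed by (auto simp: lift_on_def)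
    have "s2 x = act g (s1 x)" if "x \<in> K" "x j = c" for x
      using lifts_differ_by_constant[OF L l \<open>x0 \<in> L\<close> g, of x] that by (simp add: L_def)
    then show ?thesis using g by blast
  qed auto
  then obtain g where g: "g \<in> carrier G" and agree: "\<And>x. \<lbrakk>x \<in> K; x j = c\<rbrakk> \<Longrightarrow> act g (s1 x) = s2 x" by metis
  let ?T = "subtopology (powertop_real UNIV) K"
  have c1: "continuous_map (subtopology (powertop_real UNIV) {x \<in> K. x j \<le> c}) E (\<lambda>x. act g (s1 x))"
    using lift_on_act[OF s1 g] by (simp add: lift_on_def)
  have c2: "continuous_map (subtopology (powertop_real UNIV) {x \<in> K. c \<le> x j}) E s2"
    using s2 by (simp add: lift_on_def)
  have "continuous_map ?T E (\<lambda>x. if x j \<le> c then act g (s1 x) else s2 x)"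
  proof (rule continuous_map_cases_le)
    show "continuous_map ?T euclideanreal (\<lambda>x. x j)"
      by (intro continuous_map_from_subtopology continuous_map_product_projection) auto
    have "K \<inter> {x \<in> K. x j \<le> c} = {x \<in> K. x j \<le> c}" "K \<inter> {x \<in> K. c \<le> x j} = {x \<in> K. c \<le> x j}" by auto
    then show "continuous_map (subtopology ?T {x \<in> topspace ?T. x j \<le> c}) E (\<lambda>x. act g (s1 x))"
      and "continuous_map (subtopology ?T {x \<in> topspace ?T. c \<le> x j}) E s2"
      using c1 c2 by (simp_all add: subtopology_subtopology)
  qed (use agree in auto)
  moreover have "pr (if x j \<le> c then act g (s1 x) else s2 x) = \<sigma> x" if "x \<in> K" for x
    using lift_on_act[OF s1 g] s2 that by (auto simp: lift_on_def)
  ultimately show ?thesis unfolding lift_on_def by blast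
qed

text \<open>By the Lebesgue number lemma, all convex subsets of the simplex of width at most \<open>d\<close> in every
  coordinate have a lift. The width is then released one coordinate at a time, by stacking slabs
  of thickness \<open>d\<close> with the gluing lemma.\<close>

lemma lift_exists:
  assumes \<sigma>: "continuous_map (simplex_top n) B \<sigma>"
  shows "\<exists>s. lift_on (standard_simplex n) \<sigma> s"
proof -
  let ?D = "standard_simplex n"
  define \<W> where "\<W> = {W. openin E W \<and> (\<forall>g\<in>carrier G. g \<noteq> \<one> \<longrightarrow> act g ` W \<inter> W = {})}"
  define \<C> where "\<C> = {U. openin (powertop_real UNIV) U \<and> (\<exists>W\<in>\<W>. \<sigma> ` (U \<inter> ?D) \<subseteq> pr ` W)}"
  have cov: "?D \<subseteq> \<Union>\<C>"
  proof
    fix t assume t: "t \<in> ?D"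
    then have "\<sigma> t \<in> topspace B" using \<sigma> by (auto simp: continuous_map_def)
    then obtain e where e: "e \<in> topspace E" "pr e = \<sigma> t" using pr_surj by force
    obtain W where W: "W \<in> \<W>" "e \<in> W" using slice[OF e(1)] by (auto simp: \<W>_def)
    have "openin B (pr ` W)" using pr_open W by (auto simp: open_map_def \<W>_def)
    from openin_continuous_map_preimage[OF \<sigma> this]
    obtain U where U: "openin (powertop_real UNIV) U" "{x \<in> ?D. \<sigma> x \<in> pr ` W} = U \<inter> ?D"
      by (auto simp: openin_subtopology)
    then have "U \<in> \<C>" using W by (auto simp: \<C>_def)
    moreover have "t \<in> U" using U(2) t e W(2) by (metis (mono_tags, lifting) IntD1 image_eqI mem_Collect_eq)
    ultimately show "t \<in> \<Union>\<C>" by blast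
  qed
  obtain d where d: "0 < d" "\<And>K. \<lbrakk>K \<subseteq> ?D; \<And>x y i. \<lbrakk>i \<le> n; x \<in> K; y \<in> K\<rbrakk> \<Longrightarrow> \<bar>x i - y i\<bar> \<le> d\<rbrakk>
                       \<Longrightarrow> \<exists>U. U \<in> \<C> \<and> K \<subseteq> U"
    using llemma[of n \<C>] cov unfolding \<C>_def by (smt (verit, ccfv_threshold) mem_Collect_eq)
  \<comment> \<open>only the coordinates below \<open>j\<close> are required to be narrow; \<open>j\<close> descends from \<open>Suc n\<close> to \<open>0\<close>\<close>
  have main: "\<exists>s. lift_on K \<sigma> s"
    if "j \<le> Suc n" "segment_convex K" "K \<subseteq> ?D" "\<And>x y i. \<lbrakk>i < j; x \<in> K; y \<in> K\<rbrakk> \<Longrightarrow> \<bar>x i - y i\<bar> \<le> d" for j K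
    using that
  proof (induction arbitrary: K rule: inc_induct)
    case base
    then obtain U where "U \<in> \<C>" "K \<subseteq> U" using d(2)[of K] by (auto simp: less_Suc_eq_le)
    then obtain W where W: "W \<in> \<W>" "\<sigma> ` K \<subseteq> pr ` W" using base by (auto simp: \<C>_def) blast
    show ?case
      by (rule local_lift[of W]) (use W \<sigma> base continuous_map_from_subtopology_mono in \<open>auto simp: \<W>_def\<close>)
  next
    case (step j)
    have "\<exists>s. lift_on {x \<in> K. x j \<le> real m * d} \<sigma> s" for m
    proof (induction m)
      case 0
      have "\<exists>s. lift_on {x \<in> K. x j \<le> 0} \<sigma> s"
      proof (rule step.IH)
        show "segment_convex {x \<in> K. x j \<le> 0}" by (intro segment_convex_halfspaces step.prems)
        have z: "x j = 0" if "x \<in> {x \<in> K. x j \<le> 0}" for x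
        proof -
          have "x \<in> ?D" using that step.prems(2) by blast
          then show ?thesis using that by (auto simp: standard_simplex_def intro: antisym)
        qed
        fix x y i assume "i < Suc j" "x \<in> {x \<in> K. x j \<le> 0}" "y \<in> {x \<in> K. x j \<le> 0}"
        then show "\<bar>x i - y i\<bar> \<le> d" using step.prems(3)[of i x y] z[of x] z[of y] d(1)
          by (cases "i = j") auto
      qed (use step.prems in auto)
      then show ?case by simp
    next
      case (Suc m)
      let ?K' = "{x \<in> K. x j \<le> real (Suc m) * d}"
      have K': "segment_convex ?K'" by (intro segment_convex_halfspaces step.prems)
      obtain s1 where s1: "lift_on {x \<in> K. x j \<le> real m * d} \<sigma> s1" using Suc by blast
      have "real m * d \<le> real (Suc m) * d" using d(1) by (simp add: algebra_simps)
      then have "{x \<in> ?K'. x j \<le> real m * d} = {x \<in> K. x j \<le> real m * d}" by auto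
      then have l1: "lift_on {x \<in> ?K'. x j \<le> real m * d} \<sigma> s1" using s1 by simp
      have "\<exists>s. lift_on {x \<in> ?K'. real m * d \<le> x j} \<sigma> s"
      proof (rule step.IH)
        show "segment_convex {x \<in> ?K'. real m * d \<le> x j}"
          by (intro segment_convex_halfspaces step.prems)
        fix x y i assume "i < Suc j" "x \<in> {x \<in> ?K'. real m * d \<le> x j}" "y \<in> {x \<in> ?K'. real m * d \<le> x j}"
        then show "\<bar>x i - y i\<bar> \<le> d" using step.prems(3)[of i x y]
          by (cases "i = j") (auto simp: algebra_simps)
      qed (use step.prems in auto)
      then show ?case using glue_lifts[OF K' l1] by blast
    qed
    moreover obtain m :: nat where "1 \<le> real m * d"
      using real_arch_simple[of "1 / d"] d(1) by (auto simp: field_simps)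
    moreover have "x j \<le> 1" if "x \<in> K" for x
      using that step.prems by (auto simp: standard_simplex_def)
    ultimately have "{x \<in> K. x j \<le> real m * d} = K" by force
    then show ?case using \<open>\<And>m. \<exists>s. lift_on {x \<in> K. x j \<le> real m * d} \<sigma> s\<close>[of m] by simp
  qed
  have "segment_convex ?D" unfolding segment_convex_def using convex_standard_simplex by blast
  then show ?thesis using main[of 0 ?D] by auto
qed

lemma singular_simplex_lift:
  assumes "singular_simplex n B \<sigma>"
  shows "\<exists>\<tau>. singular_simplex n E \<tau> \<and> simplex_map n pr \<tau> = \<sigma>"
proof -
  obtain s where s: "lift_on (standard_simplex n) \<sigma> s"
    using lift_exists assms by (auto simp: singular_simplex_def)
  define \<tau> where "\<tau> = restrict s (standard_simplex n)"
  have "singular_simplex n E \<tau>"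
    using s by (auto simp: singular_simplex_def \<tau>_def lift_on_def intro: continuous_map_eq)
  moreover have "simplex_map n pr \<tau> = \<sigma>"
  proof
    fix t show "simplex_map n pr \<tau> t = \<sigma> t"
      using s assms by (auto simp: simplex_map_def \<tau>_def lift_on_def singular_simplex_def restrict_def extensional_def)
  qed
  ultimately show ?thesis by blast
qed

lemma singular_simplex_lifts_orbit:
  assumes "singular_simplex n E \<tau>" "singular_simplex n E \<tau>'" "simplex_map n pr \<tau> = simplex_map n pr \<tau>'"
  shows "\<exists>g\<in>carrier G. \<tau>' = simplex_map n (act g) \<tau>"
proof -
  let ?D = "standard_simplex n"
  have D: "segment_convex ?D" unfolding segment_convex_def using convex_standard_simplex by blast
  have eq: "pr (\<tau> t) = pr (\<tau>' t)" if "t \<in> ?D" for t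
    using fun_cong[OF assms(3), of t] that by (simp add: simplex_map_def)
  have l: "lift_on ?D (\<lambda>t. pr (\<tau> t)) \<tau>" "lift_on ?D (\<lambda>t. pr (\<tau> t)) \<tau>'"
    using assms eq by (auto simp: lift_on_def singular_simplex_def)
  obtain t0 where t0: "t0 \<in> ?D" using nonempty_standard_simplex by blast
  obtain g where g: "g \<in> carrier G" "\<tau>' t0 = act g (\<tau> t0)"
    using pr_eq[of "\<tau> t0" "\<tau>' t0"] eq t0 lift_on_closed[OF l(1)] lift_on_closed[OF l(2)] by auto
  have "\<tau>' = simplex_map n (act g) \<tau>"
  proof
    fix t show "\<tau>' t = simplex_map n (act g) \<tau> t"
      using lifts_differ_by_constant[OF D l t0 g, of t] assms(2)
      by (auto simp: simplex_map_def singular_simplex_def restrict_def extensional_def)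
  qed
  then show ?thesis using g by blast
qed

end

section \<open>The universal bundle over the classifying space\<close>

text \<open>The simplicial set whose \<open>n\<close>-simplices are the tuples \<open>(h\<^sub>0, \<dots>, h\<^sub>n)\<close> of group elements; \<open>d\<^sub>i\<close> omits and
  \<open>s\<^sub>i\<close> repeats the entry \<open>h\<^sub>i\<close>. The group acts by left multiplication of all entries.\<close>

definition EG :: "('g, 'n) monoid_scheme \<Rightarrow> 'g list simplicial_set"
  where "EG G =
    \<lparr>simplices = (\<lambda>n. tuples (carrier G) (Suc n)),
     face = (\<lambda>n i hs. take i hs @ drop (Suc i) hs),
     degen = (\<lambda>n i hs. take (Suc i) hs @ drop i hs)\<rparr>"

text \<open>The projection to the nerve, \<open>(h\<^sub>0, \<dots>, h\<^sub>n) \<mapsto> (h\<^sub>0\<^sup>-\<^sup>1 h\<^sub>1, \<dots>, h\<^bsub>n-1\<^esub>\<^sup>-\<^sup>1 h\<^sub>n)\<close>.\<close>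

definition quotients :: "('g, 'n) monoid_scheme \<Rightarrow> 'g list \<Rightarrow> 'g list"
  where "quotients G hs = map (\<lambda>i. inv\<^bsub>G\<^esub> (hs ! i) \<otimes>\<^bsub>G\<^esub> hs ! Suc i) [0..<length hs - 1]"

lemma EG_sel [simp]:
  "simplices (EG G) n = tuples (carrier G) (Suc n)"
  "face (EG G) n i hs = take i hs @ drop (Suc i) hs"
  "degen (EG G) n i hs = take (Suc i) hs @ drop i hs"
  by (simp_all add: EG_def)

lemma nerve_sel:
  "simplices (nerve G) n = tuples (carrier G) n"
  "face (nerve G) n i gs = (if i = 0 then tl gs else if i = n then butlast gs else merge_at G i gs)"
  "degen (nerve G) n i gs = take i gs @ [\<one>\<^bsub>G\<^esub>] @ drop i gs"
  by (simp_all add: nerve_def)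

lemma (in group) cancel_inv_left:
  assumes "x \<in> carrier G" "y \<in> carrier G"
  shows "x \<otimes> (inv x \<otimes> y) = y" and "inv x \<otimes> (x \<otimes> y) = y"
proof -
  have "x \<otimes> (inv x \<otimes> y) = x \<otimes> inv x \<otimes> y" "inv x \<otimes> (x \<otimes> y) = inv x \<otimes> x \<otimes> y"
    using assms by (simp_all only: m_assoc inv_closed)
  then show "x \<otimes> (inv x \<otimes> y) = y" "inv x \<otimes> (x \<otimes> y) = y"
    using assms by simp_all
qed

lemma tuples_nth: "\<lbrakk>xs \<in> tuples A n; i < n\<rbrakk> \<Longrightarrow> xs ! i \<in> A"
  by (auto simp: tuples_def)

lemma tuplesI: "\<lbrakk>length xs = n; \<And>i. i < n \<Longrightarrow> xs ! i \<in> A\<rbrakk> \<Longrightarrow> xs \<in> tuples A n"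
  by (auto simp: tuples_def in_set_conv_nth)

lemma tuples_length: "xs \<in> tuples A n \<Longrightarrow> length xs = n"
  by (simp add: tuples_def)

lemma length_quotients [simp]: "length (quotients G hs) = length hs - 1"
  by (simp add: quotients_def)

lemma nth_quotients: "i < length hs - 1 \<Longrightarrow> quotients G hs ! i = inv\<^bsub>G\<^esub> (hs ! i) \<otimes>\<^bsub>G\<^esub> hs ! Suc i"
  by (simp add: quotients_def)

lemma nth_EG_face: "\<lbrakk>i < length hs; j < length hs - 1\<rbrakk> \<Longrightarrow>
    (take i hs @ drop (Suc i) hs) ! j = hs ! (if j < i then j else Suc j)"
  by (auto simp: nth_append min_def)

lemma nth_EG_degen: "\<lbrakk>i < length hs; j < Suc (length hs)\<rbrakk> \<Longrightarrow>
    (take (Suc i) hs @ drop i hs) ! j = hs ! (if j \<le> i then j else j - 1)"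
  using nth_append_right[of "take (Suc i) hs" j "drop i hs"] by (auto simp: nth_append)

lemma (in group) quotients_in:
  assumes "hs \<in> tuples (carrier G) (Suc n)"
  shows "quotients G hs \<in> tuples (carrier G) n"
  by (intro tuplesI) (use assms in \<open>simp_all add: nth_quotients tuples_length tuples_nth\<close>)

lemma nth_merge_at:
  assumes "0 < i" "i < length gs" "Suc j < length gs"
  shows "merge_at G i gs ! j =
    (if Suc j < i then gs ! j else if Suc j = i then gs ! j \<otimes>\<^bsub>G\<^esub> gs ! Suc j else gs ! Suc j)"
proof -
  obtain k where k: "i = Suc k" using assms(1) by (cases i) auto
  consider "j < k" | "j = k" | m where "j = Suc (k + m)"
    by (metis less_imp_Suc_add linorder_neqE_nat)
  then show ?thesis using assms by cases (auto simp: merge_at_def nth_append k)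
qed

lemma (in group) quotients_face:
  assumes hs: "hs \<in> tuples (carrier G) (Suc (Suc n))" and i: "i \<le> Suc n"
  shows "quotients G (take i hs @ drop (Suc i) hs) = face (nerve G) (Suc n) i (quotients G hs)"
proof (rule nth_equalityI)
  have len: "length hs = Suc (Suc n)" using hs by (rule tuples_length)
  show "length (quotients G (take i hs @ drop (Suc i) hs)) = length (face (nerve G) (Suc n) i (quotients G hs))"
    using i len by (auto simp: nerve_sel merge_at_def)
  fix j assume "j < length (quotients G (take i hs @ drop (Suc i) hs))"
  then have j: "j < n" using i len by simp
  have C: "hs ! k \<in> carrier G" if "k \<le> Suc n" for k using tuples_nth[OF hs] that by simp
  have L: "quotients G (take i hs @ drop (Suc i) hs) ! j =
      inv (hs ! (if j < i then j else Suc j)) \<otimes> hs ! (if Suc j < i then Suc j else Suc (Suc j))"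
    using i j len by (simp add: nth_quotients nth_EG_face)
  show "quotients G (take i hs @ drop (Suc i) hs) ! j = face (nerve G) (Suc n) i (quotients G hs) ! j"
  proof (cases "i = 0 \<or> i = Suc n")
    case True
    then show ?thesis using L i j len by (auto simp: nerve_sel nth_tl nth_butlast nth_quotients)
  next
    case False
    have "merge_at G i (quotients G hs) ! j =
      (if Suc j < i then quotients G hs ! j else if Suc j = i then quotients G hs ! j \<otimes> quotients G hs ! Suc j
       else quotients G hs ! Suc j)"
      using False i j len by (intro nth_merge_at) auto
    moreover have "inv (hs ! j) \<otimes> hs ! Suc j \<otimes> (inv (hs ! Suc j) \<otimes> hs ! Suc (Suc j)) =
        inv (hs ! j) \<otimes> hs ! Suc (Suc j)"
      using C[of j] C[of "Suc j"] C[of "Suc (Suc j)"] j by (simp add: m_assoc cancel_inv_left)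
    ultimately show ?thesis using L False i j len by (auto simp: nerve_sel nth_quotients)
  qed
qed

lemma (in group) quotients_degen:
  assumes hs: "hs \<in> tuples (carrier G) (Suc n)" and i: "i \<le> n"
  shows "quotients G (take (Suc i) hs @ drop i hs) = degen (nerve G) n i (quotients G hs)"
proof (rule nth_equalityI)
  have len: "length hs = Suc n" using hs by (rule tuples_length)
  show "length (quotients G (take (Suc i) hs @ drop i hs)) = length (degen (nerve G) n i (quotients G hs))"
    using i len by (simp add: nerve_sel)
  fix j assume "j < length (quotients G (take (Suc i) hs @ drop i hs))"
  then have j: "j \<le> n" using i len by simp
  have C: "hs ! k \<in> carrier G" if "k \<le> n" for k using tuples_nth[OF hs] that by simp
  have "quotients G (take (Suc i) hs @ drop i hs) ! j =
      inv (hs ! (if j \<le> i then j else j - 1)) \<otimes> hs ! (if Suc j \<le> i then Suc j else j)"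
    using i j len by (simp add: nth_quotients nth_EG_degen del: take_Suc)
  moreover have "degen (nerve G) n i (quotients G hs) ! j =
      (if j < i then quotients G hs ! j else if j = i then \<one> else quotients G hs ! (j - 1))"
  proof -
    consider "j < i" | "j = i" | m where "j = Suc (i + m)"
      by (metis less_imp_Suc_add linorder_neqE_nat)
    then show ?thesis using i j len by cases (auto simp: nerve_sel nth_append)
  qed
  ultimately show "quotients G (take (Suc i) hs @ drop i hs) ! j = degen (nerve G) n i (quotients G hs) ! j"
    using i j len C[of j] by (auto simp: nth_quotients)
qed

lemma (in group) simplicial_map_quotients: "simplicial_map (EG G) (nerve G) (\<lambda>_. quotients G)"
  unfolding simplicial_map_def using quotients_in quotients_face quotients_degen
  by (auto simp: nerve_sel(1))

lemma (in group) map_mult_in: "\<lbrakk>g \<in> carrier G; hs \<in> tuples (carrier G) n\<rbrakk> \<Longrightarrow> map ((\<otimes>) g) hs \<in> tuples (carrier G) n"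
  by (auto simp: tuples_def)

lemma (in group) simplicial_map_mult: "g \<in> carrier G \<Longrightarrow> simplicial_map (EG G) (EG G) (\<lambda>_. map ((\<otimes>) g))"
  unfolding simplicial_map_def using map_mult_in by (auto simp: take_map drop_map)

lemma (in group) quotients_mult:
  assumes "g \<in> carrier G" "hs \<in> tuples (carrier G) n"
  shows "quotients G (map ((\<otimes>) g) hs) = quotients G hs"
proof (rule nth_equalityI)
  fix i assume "i < length (quotients G (map ((\<otimes>) g) hs))"
  then have i: "Suc i < n" using assms by (simp add: tuples_length)
  then have "hs ! i \<in> carrier G" "hs ! Suc i \<in> carrier G" using assms by (auto intro: tuples_nth)
  moreover have "inv (g \<otimes> a) \<otimes> (g \<otimes> b) = inv a \<otimes> b" if "a \<in> carrier G" "b \<in> carrier G" for a b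
    using that assms(1) by (simp add: inv_mult_group m_assoc cancel_inv_left)
  ultimately show "quotients G (map ((\<otimes>) g) hs) ! i = quotients G hs ! i"
    using i assms by (simp add: nth_quotients tuples_length)
qed simp

lemma (in group) quotients_eq_imp:
  assumes hs: "hs \<in> tuples (carrier G) (Suc n)" and hs': "hs' \<in> tuples (carrier G) (Suc n)"
    and eq: "quotients G hs = quotients G hs'"
  shows "\<exists>g\<in>carrier G. hs' = map ((\<otimes>) g) hs"
proof (intro bexI)
  have C: "hs ! i \<in> carrier G" "hs' ! i \<in> carrier G" if "i \<le> n" for i
    using that hs hs' by (auto intro: tuples_nth)
  define g where "g = hs' ! 0 \<otimes> inv (hs ! 0)"
  show g: "g \<in> carrier G" using C by (simp add: g_def)
  have "hs' ! i = g \<otimes> hs ! i" if "i \<le> n" for i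
    using that
  proof (induction i)
    case 0
    then show ?case using C[of 0] by (simp add: g_def m_assoc)
  next
    case (Suc i)
    have "inv (hs ! i) \<otimes> hs ! Suc i = inv (hs' ! i) \<otimes> hs' ! Suc i"
      using arg_cong[OF eq, of "\<lambda>l. l ! i"] Suc.prems hs hs' by (simp add: nth_quotients tuples_length)
    then have "hs' ! Suc i = hs' ! i \<otimes> (inv (hs ! i) \<otimes> hs ! Suc i)"
      using C[of i] C[of "Suc i"] Suc.prems by (simp add: cancel_inv_left)
    also have "\<dots> = g \<otimes> hs ! Suc i"
      using Suc C[of i] C[of "Suc i"] g by (simp add: m_assoc cancel_inv_left)
    finally show ?case .
  qed
  then show "hs' = map ((\<otimes>) g) hs"
    using hs hs' by (intro nth_equalityI) (auto simp: tuples_length)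
qed

lemma list_mult_simps [simp]:
  "list_mult G [] = \<one>\<^bsub>G\<^esub>" "list_mult G (g # gs) = g \<otimes>\<^bsub>G\<^esub> list_mult G gs"
  by (simp_all add: list_mult_def)

lemma (in group) list_mult_closed [simp]: "set gs \<subseteq> carrier G \<Longrightarrow> list_mult G gs \<in> carrier G"
  by (induction gs) auto

lemma (in group) list_mult_append:
  "\<lbrakk>set gs \<subseteq> carrier G; set hs \<subseteq> carrier G\<rbrakk> \<Longrightarrow> list_mult G (gs @ hs) = list_mult G gs \<otimes> list_mult G hs"
  by (induction gs) (auto simp: m_assoc)

lemma (in group) quotients_surj:
  assumes gs: "gs \<in> tuples (carrier G) n"
  shows "\<exists>hs\<in>tuples (carrier G) (Suc n). quotients G hs = gs"
proof (intro bexI)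
  let ?hs = "map (\<lambda>i. list_mult G (take i gs)) [0..<Suc n]"
  have gsC: "set gs \<subseteq> carrier G" "length gs = n" using gs by (auto simp: tuples_def)
  have T: "set (take i gs) \<subseteq> carrier G" for i using gsC by (meson order_trans set_take_subset)
  show "?hs \<in> tuples (carrier G) (Suc n)"
    using T by (intro tuplesI) (auto simp del: upt_Suc)
  show "quotients G ?hs = gs"
  proof (rule nth_equalityI)
    show "length (quotients G ?hs) = length gs" by (simp add: gsC)
    fix i assume "i < length (quotients G ?hs)"
    then have i: "i < n" by simp
    have gi: "gs ! i \<in> carrier G" using gs i by (rule tuples_nth)
    have "list_mult G (take (Suc i) gs) = list_mult G (take i gs) \<otimes> gs ! i"
      using i gsC T gi by (simp add: take_Suc_conv_app_nth list_mult_append)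
    then show "quotients G ?hs ! i = gs ! i"
      using i T[of i] gi by (simp add: nth_quotients cancel_inv_left del: upt_Suc)
  qed
qed

text \<open>The total space \<open>EG\<close> of the universal bundle, the action of \<open>G\<close> on it, and the projection to \<open>BG\<close>.\<close>

abbreviation EG_space :: "('g, 'n) monoid_scheme \<Rightarrow> ((nat \<times> 'g list) \<times> (nat \<Rightarrow> real)) set topology"
  where "EG_space G \<equiv> realization (EG G)"

abbreviation EG_act :: "('g, 'n) monoid_scheme \<Rightarrow> 'g \<Rightarrow>
    ((nat \<times> 'g list) \<times> (nat \<Rightarrow> real)) set \<Rightarrow> ((nat \<times> 'g list) \<times> (nat \<Rightarrow> real)) set"
  where "EG_act G g \<equiv> realization_map (EG G) (\<lambda>_. map ((\<otimes>\<^bsub>G\<^esub>) g))"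

abbreviation EG_proj :: "('g, 'n) monoid_scheme \<Rightarrow>
    ((nat \<times> 'g list) \<times> (nat \<Rightarrow> real)) set \<Rightarrow> ((nat \<times> 'g list) \<times> (nat \<Rightarrow> real)) set"
  where "EG_proj G \<equiv> realization_map (nerve G) (\<lambda>_. quotients G)"

context group
begin

lemma EG_act_cls: "g \<in> carrier G \<Longrightarrow> EG_act G g (cls (EG G) ((n, hs), t)) = cls (EG G) ((n, map ((\<otimes>) g) hs), t)"
  by (rule realization_map_cls) (rule simplicial_map_mult)

lemma EG_proj_cls: "EG_proj G (cls (EG G) ((n, hs), t)) = cls (nerve G) ((n, quotients G hs), t)"
  by (rule realization_map_cls) (rule simplicial_map_quotients)

text \<open>Gluing of points of the nerve lifts to gluing of points above, with any prescribed lift of the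
  first point.\<close>

lemma glue_nerve_lift:
  assumes "(x, y) \<in> glue (nerve G) \<union> (glue (nerve G))\<inverse>"
    and x: "x = ((n, quotients G hs), t)" "hs \<in> tuples (carrier G) (Suc n)"
  shows "\<exists>m hs' t'. y = ((m, quotients G hs'), t') \<and> hs' \<in> tuples (carrier G) (Suc m) \<and>
    cls (EG G) ((n, hs), t) = cls (EG G) ((m, hs'), t')"
proof -
  consider "(x, y) \<in> glue (nerve G)" | "(y, x) \<in> glue (nerve G)" using assms(1) by blast
  then show ?thesis
  proof cases
    case 1
    then show ?thesis
    proof (cases rule: glue_cases)
      case (face n' i \<sigma> t')
      then have n: "n' = n" "t' = t" and \<sigma>: "quotients G hs = face (nerve G) (Suc n) i \<sigma>" "\<sigma> \<in> tuples (carrier G) (Suc n)"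
        using x by (auto simp: nerve_sel(1))
      obtain hs0 where hs0: "hs0 \<in> tuples (carrier G) (Suc (Suc n))" "quotients G hs0 = \<sigma>"
        using quotients_surj[OF \<sigma>(2)] by blast
      have f0: "take i hs0 @ drop (Suc i) hs0 \<in> tuples (carrier G) (Suc n)"
        using hs0 face(4) n by (auto simp: tuples_def dest: in_set_takeD in_set_dropD)
      obtain g where g: "g \<in> carrier G" "hs = map ((\<otimes>) g) (take i hs0 @ drop (Suc i) hs0)"
        using quotients_eq_imp[OF f0 x(2)] quotients_face[OF hs0(1)] \<sigma> hs0 face(4) n by metis
      have "y = ((Suc n, quotients G (map ((\<otimes>) g) hs0)), simplical_face i t)"
        using face n hs0 g by (simp add: quotients_mult)
      moreover have "map ((\<otimes>) g) hs0 \<in> tuples (carrier G) (Suc (Suc n))" by (rule map_mult_in[OF g(1) hs0(1)])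
      moreover have "cls (EG G) ((n, hs), t) = cls (EG G) ((Suc n, map ((\<otimes>) g) hs0), simplical_face i t)"
        using cls_glue[OF glue_face[of "map ((\<otimes>) g) hs0" "EG G" n i t]] face n g calculation(2)
        by (simp add: take_map drop_map)
      ultimately show ?thesis by blast
    next
      case (degen n' i \<sigma> t')
      then have n: "n = Suc n'" "t' = t" and \<sigma>: "quotients G hs = degen (nerve G) n' i \<sigma>" "\<sigma> \<in> tuples (carrier G) n'"
        using x by (auto simp: nerve_sel(1))
      obtain hs0 where hs0: "hs0 \<in> tuples (carrier G) (Suc n')" "quotients G hs0 = \<sigma>"
        using quotients_surj[OF \<sigma>(2)] by blast
      have f0: "take (Suc i) hs0 @ drop i hs0 \<in> tuples (carrier G) (Suc n)"
        using hs0 degen(4) n by (auto simp: tuples_def dest: in_set_takeD in_set_dropD simp del: take_Suc)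
      obtain g where g: "g \<in> carrier G" "hs = map ((\<otimes>) g) (take (Suc i) hs0 @ drop i hs0)"
        using quotients_eq_imp[OF f0 x(2)] quotients_degen[OF hs0(1)] \<sigma> hs0 degen(4) n by metis
      have "y = ((n', quotients G (map ((\<otimes>) g) hs0)), simplicial_codegen i t)"
        using degen n hs0 g by (simp add: quotients_mult)
      moreover have "map ((\<otimes>) g) hs0 \<in> tuples (carrier G) (Suc n')" by (rule map_mult_in[OF g(1) hs0(1)])
      moreover have "cls (EG G) ((n, hs), t) = cls (EG G) ((n', map ((\<otimes>) g) hs0), simplicial_codegen i t)"
        using cls_glue[OF glue_degen[of "map ((\<otimes>) g) hs0" "EG G" n' i t]] degen n g calculation(2)
        by (simp add: take_map drop_map)
      ultimately show ?thesis by blast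
    qed
  next
    case 2
    then show ?thesis
    proof (cases rule: glue_cases)
      case (face n' i \<sigma> t')
      then have n: "n = Suc n'" "\<sigma> = quotients G hs" "t = simplical_face i t'" using x by auto
      have "y = ((n', quotients G (take i hs @ drop (Suc i) hs)), t')"
        using face n x quotients_face[of hs n' i] by simp
      moreover have "take i hs @ drop (Suc i) hs \<in> tuples (carrier G) (Suc n')"
        using x face(4) n by (auto simp: tuples_def dest: in_set_takeD in_set_dropD)
      moreover have "cls (EG G) ((n, hs), t) = cls (EG G) ((n', take i hs @ drop (Suc i) hs), t')"
        using cls_glue[OF glue_face[of hs "EG G" n' i t']] face n x by simp
      ultimately show ?thesis by blast
    next
      case (degen n' i \<sigma> t')
      then have n: "n' = n" "\<sigma> = quotients G hs" "t = simplicial_codegen i t'" using x by auto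
      have "y = ((Suc n, quotients G (take (Suc i) hs @ drop i hs)), t')"
        using degen n x quotients_degen[of hs n i] by simp
      moreover have "take (Suc i) hs @ drop i hs \<in> tuples (carrier G) (Suc (Suc n))"
        using x degen(4) n by (auto simp: tuples_def dest: in_set_takeD in_set_dropD simp del: take_Suc)
      moreover have "cls (EG G) ((n, hs), t) = cls (EG G) ((Suc n, take (Suc i) hs @ drop i hs), t')"
        using cls_glue[OF glue_degen[of hs "EG G" n i t']] degen n x by simp
      ultimately show ?thesis by blast
    qed
  qed
qed

lemma cls_nerve_lift:
  assumes "cls (nerve G) ((n, quotients G hs), t) = cls (nerve G) y" and hs: "hs \<in> tuples (carrier G) (Suc n)"
  shows "\<exists>m hs' t'. y = ((m, quotients G hs'), t') \<and> hs' \<in> tuples (carrier G) (Suc m) \<and>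
    cls (EG G) ((n, hs), t) = cls (EG G) ((m, hs'), t')"
proof -
  have "(((n, quotients G hs), t), y) \<in> (glue (nerve G) \<union> (glue (nerve G))\<inverse>)\<^sup>*"
    using assms by (simp add: cls_eq_iff glue_equiv_def)
  then show ?thesis
  proof (induction rule: rtrancl_induct)
    case base
    then show ?case using hs by blast
  next
    case (step y z)
    then obtain m hs' t' where y: "y = ((m, quotients G hs'), t')" "hs' \<in> tuples (carrier G) (Suc m)"
      "cls (EG G) ((n, hs), t) = cls (EG G) ((m, hs'), t')" by blast
    show ?case using glue_nerve_lift[OF step(2) y(1,2)] y(3) by metis
  qed
qed

lemma EG_cases:
  assumes "x \<in> topspace (EG_space G)"
  obtains n hs t where "x = cls (EG G) ((n, hs), t)" "hs \<in> tuples (carrier G) (Suc n)" "t \<in> standard_simplex n"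
  using realization_cases[OF assms] by auto

lemma EG_proj_eq:
  assumes "x \<in> topspace (EG_space G)" "y \<in> topspace (EG_space G)" "EG_proj G x = EG_proj G y"
  shows "\<exists>g\<in>carrier G. y = EG_act G g x"
proof -
  obtain n hs t where x: "x = cls (EG G) ((n, hs), t)" "hs \<in> tuples (carrier G) (Suc n)"
    using assms(1) by (rule EG_cases)
  obtain m hs' t' where y: "y = cls (EG G) ((m, hs'), t')" "hs' \<in> tuples (carrier G) (Suc m)"
    using assms(2) by (rule EG_cases)
  have "cls (nerve G) ((n, quotients G hs), t) = cls (nerve G) ((m, quotients G hs'), t')"
    using assms(3) x y by (simp add: EG_proj_cls)
  then obtain hs'' where h: "quotients G hs' = quotients G hs''" "hs'' \<in> tuples (carrier G) (Suc m)" "x = cls (EG G) ((m, hs''), t')"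
    using cls_nerve_lift[of n hs t "((m, quotients G hs'), t')"] x by auto
  then obtain g where g: "g \<in> carrier G" "hs' = map ((\<otimes>) g) hs''"
    using quotients_eq_imp[OF h(2) y(2)] by auto
  then have "y = EG_act G g x" using h y by (simp add: EG_act_cls)
  then show ?thesis using g by blast
qed

lemma EG_proj_surj: "EG_proj G ` topspace (EG_space G) = topspace (classifying_space G)"
proof
  show "EG_proj G ` topspace (EG_space G) \<subseteq> topspace (classifying_space G)"
    unfolding classifying_space_def
    by (rule continuous_map_image_subset_topspace[OF continuous_map_realization_map[OF simplicial_map_quotients]])
  show "topspace (classifying_space G) \<subseteq> EG_proj G ` topspace (EG_space G)"
  proof
    fix b assume "b \<in> topspace (classifying_space G)"
    then obtain n \<sigma> t where b: "b = cls (nerve G) ((n, \<sigma>), t)" "\<sigma> \<in> tuples (carrier G) n" "t \<in> standard_simplex n"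
      unfolding classifying_space_def by (auto simp: nerve_sel(1) elim: realization_cases)
    obtain hs where hs: "hs \<in> tuples (carrier G) (Suc n)" "quotients G hs = \<sigma>" using quotients_surj[OF b(2)] by blast
    have "b = EG_proj G (cls (EG G) ((n, hs), t))" using hs b by (simp add: EG_proj_cls)
    moreover have "cls (EG G) ((n, hs), t) \<in> topspace (EG_space G)" using hs b by (intro cls_in_realization) auto
    ultimately show "b \<in> EG_proj G ` topspace (EG_space G)" by blast
  qed
qed

lemma EG_proj_open: "open_map (EG_space G) (classifying_space G) (EG_proj G)"
  unfolding open_map_def
proof (intro allI impI)
  fix U assume U: "openin (EG_space G) U"
  have UE: "U \<subseteq> topspace (EG_space G)" using U by (rule openin_subset)
  have sub: "EG_proj G ` U \<subseteq> topspace (classifying_space G)" using EG_proj_surj UE by blast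
  have "openin (simplex_sum (nerve G)) {x \<in> topspace (simplex_sum (nerve G)). cls (nerve G) x \<in> EG_proj G ` U}"
    unfolding openin_simplex_sum
  proof (intro conjI allI ballI)
    fix n \<sigma> assume "\<sigma> \<in> simplices (nerve G) n"
    then have \<sigma>: "\<sigma> \<in> tuples (carrier G) n" by (simp add: nerve_sel)
    have "{t. ((n, \<sigma>), t) \<in> {x \<in> topspace (simplex_sum (nerve G)). cls (nerve G) x \<in> EG_proj G ` U}} =
        (\<Union>hs\<in>{hs \<in> tuples (carrier G) (Suc n). quotients G hs = \<sigma>}.
          {t \<in> topspace (simplex_top n). cls (EG G) ((n, hs), t) \<in> U})" (is "?L = ?R")
    proof
      show "?L \<subseteq> ?R"
      proof
        fix t assume "t \<in> ?L"
        then have t: "t \<in> standard_simplex n" and "cls (nerve G) ((n, \<sigma>), t) \<in> EG_proj G ` U"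
          by (auto simp: topspace_simplex_sum)
        then obtain x where x: "x \<in> U" "cls (nerve G) ((n, \<sigma>), t) = EG_proj G x" by blast
        obtain m hs t' where x': "x = cls (EG G) ((m, hs), t')" "hs \<in> tuples (carrier G) (Suc m)"
          using x(1) UE EG_cases by blast
        obtain hs' where "\<sigma> = quotients G hs'" "hs' \<in> tuples (carrier G) (Suc n)" "x = cls (EG G) ((n, hs'), t)"
          using cls_nerve_lift[of m hs t' "((n, \<sigma>), t)"] x x' by (auto simp: EG_proj_cls)
        then show "t \<in> ?R" using x(1) t by auto
      qed
      show "?R \<subseteq> ?L"
        using \<sigma> by (auto simp: topspace_simplex_sum nerve_sel(1) EG_proj_cls image_iff intro!: bexI)
    qed
    also have "openin (simplex_top n) \<dots>"
    proof -
      have "openin (simplex_top n) {t \<in> topspace (simplex_top n). cls (EG G) ((n, hs), t) \<in> U}"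
        if "hs \<in> tuples (carrier G) (Suc n)" for hs
        by (rule openin_continuous_map_preimage[OF continuous_map_cls U]) (use that in simp)
      then show ?thesis by (intro openin_Union) blast
    qed
    finally show "openin (simplex_top n) {t. ((n, \<sigma>), t) \<in> {x \<in> topspace (simplex_sum (nerve G)). cls (nerve G) x \<in> EG_proj G ` U}}" .
  qed auto
  then show "openin (classifying_space G) (EG_proj G ` U)"
    using quotient_map_cls[of "nerve G"] sub unfolding quotient_map_def classifying_space_def by blast
qed

end

section \<open>Points of the universal bundle as step functions\<close>

text \<open>The end points of the intervals of length \<open>t\<^sub>0, t\<^sub>1, \<dots>\<close> placed one after the other.\<close>

definition psum :: "(nat \<Rightarrow> real) \<Rightarrow> nat \<Rightarrow> real"
  where "psum t i = (\<Sum>j<i. t j)"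

text \<open>A point \<open>((n, hs), t)\<close> describes the step function on \<open>[0, 1)\<close> with value \<open>h\<^sub>i\<close> on the \<open>i\<close>-th interval,
  of length \<open>t\<^sub>i\<close>; glued points describe the same step function. \<open>sojourn s g\<close> is the length of the
  part of \<open>[0, s)\<close> on which the value is \<open>g\<close>. It is continuous, and for fixed \<open>s\<close> the values add up to
  at most \<open>s\<close>, so at most one \<open>g\<close> can have a share of more than one half. Unlike the barycentric
  coordinates alone, these functions see the order of the values, hence separate the
  translates of a point even by elements of finite order.\<close>

definition sojourn :: "real \<Rightarrow> 'g \<Rightarrow> (nat \<times> 'g list) \<times> (nat \<Rightarrow> real) \<Rightarrow> real"
  where "sojourn s g = (\<lambda>((n, hs), t).
    \<Sum>i\<le>n. if hs ! i = g then min s (psum t (Suc i)) - min s (psum t i) else 0)"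

lemma sojourn_simp: "sojourn s g ((n, hs), t) =
    (\<Sum>i\<le>n. if hs ! i = g then min s (psum t (Suc i)) - min s (psum t i) else 0)"
  by (simp add: sojourn_def)

lemma sum_skip:
  fixes F :: "nat \<Rightarrow> real"
  assumes "k \<le> Suc n" "F k = 0"
  shows "sum F {..Suc n} = (\<Sum>j\<le>n. F (if j < k then j else Suc j))"
proof -
  have "sum F {..Suc n} = sum F ({..Suc n} - {k})"
    using assms by (intro sum.mono_neutral_right) auto
  also have "\<dots> = (\<Sum>j\<le>n. F (if j < k then j else Suc j))"
  proof (rule sum.reindex_bij_betw[symmetric])
    show "bij_betw (\<lambda>j. if j < k then j else Suc j) {..n} ({..Suc n} - {k})"
      by (rule bij_betw_byWitness[where f' = "\<lambda>j. if j < k then j else j - 1"]) (use assms in auto)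
  qed
  finally show ?thesis .
qed

lemma sum_merge:
  fixes F :: "nat \<Rightarrow> real"
  assumes "k \<le> n"
  shows "sum F {..Suc n} = (\<Sum>j\<le>n. if j < k then F j else if j = k then F k + F (Suc k) else F (Suc j))"
  using assms
proof (induction n rule: dec_induct)
  case base
  have "sum F {..Suc k} = sum F {..<k} + F k + F (Suc k)"
    by (simp flip: lessThan_Suc_atMost)
  also have "sum F {..<k} = (\<Sum>j<k. if j < k then F j else if j = k then F k + F (Suc k) else F (Suc j))"
    by (rule sum.cong) auto
  finally show ?case by (simp flip: lessThan_Suc_atMost)
next
  case (step n)
  then show ?case by simp
qed

lemma psum_face: "psum (simplical_face k t) j = (if j \<le> k then psum t j else psum t (j - 1))"
proof (induction j)
  case (Suc j)
  then show ?case
    by (cases j) (auto simp: psum_def simplical_face_def not_le less_Suc_eq_le le_Suc_eq)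
qed (simp add: psum_def)

lemma psum_codegen: "psum (simplicial_codegen k t) j = (if j \<le> k then psum t j else psum t (Suc j))"
proof (induction j)
  case (Suc j)
  then show ?case
    by (auto simp: psum_def simplicial_codegen_def not_le less_Suc_eq_le le_Suc_eq)
qed (simp add: psum_def)

lemma sojourn_face:
  assumes "length hs = Suc (Suc n)" "k \<le> Suc n"
  shows "sojourn s g ((n, take k hs @ drop (Suc k) hs), t) = sojourn s g ((Suc n, hs), simplical_face k t)"
proof -
  define F where "F i = (if hs ! i = g then min s (psum (simplical_face k t) (Suc i)) - min s (psum (simplical_face k t) i) else 0)" for i
  have "F k = 0" by (simp add: F_def psum_face)
  then have "sojourn s g ((Suc n, hs), simplical_face k t) = (\<Sum>j\<le>n. F (if j < k then j else Suc j))"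
    unfolding sojourn_simp F_def[symmetric] using assms(2) by (intro sum_skip)
  also have "\<dots> = sojourn s g ((n, take k hs @ drop (Suc k) hs), t)"
    unfolding sojourn_simp by (rule sum.cong) (use assms in \<open>auto simp: nth_EG_face F_def psum_face\<close>)
  finally show ?thesis by simp
qed

lemma sojourn_degen:
  assumes "length hs = Suc n" "k \<le> n"
  shows "sojourn s g ((Suc n, take (Suc k) hs @ drop k hs), t) = sojourn s g ((n, hs), simplicial_codegen k t)"
proof -
  define F where "F i = (if (take (Suc k) hs @ drop k hs) ! i = g then min s (psum t (Suc i)) - min s (psum t i) else 0)" for i
  have "sojourn s g ((Suc n, take (Suc k) hs @ drop k hs), t) =
    (\<Sum>j\<le>n. if j < k then F j else if j = k then F k + F (Suc k) else F (Suc j))"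
    unfolding sojourn_simp F_def[symmetric] by (rule sum_merge) (rule assms)
  also have "\<dots> = sojourn s g ((n, hs), simplicial_codegen k t)"
    unfolding sojourn_simp
    by (rule sum.cong)
      (use assms in \<open>auto simp: F_def nth_EG_degen psum_codegen simp del: take_Suc\<close>)
  finally show ?thesis .
qed

lemma sojourn_glue:
  assumes "(x, y) \<in> glue (EG G)"
  shows "sojourn s g x = sojourn s g y"
  using assms by (cases rule: glue_cases) (auto simp: tuples_length sojourn_face sojourn_degen simp del: take_Suc)

lemma psum_mono: "t \<in> standard_simplex n \<Longrightarrow> i \<le> j \<Longrightarrow> psum t i \<le> psum t j"
  unfolding psum_def by (rule sum_mono2) (auto simp: standard_simplex_def)

text \<open>At most one value can occupy more than half of \<open>[0, s)\<close>.\<close>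

lemma sojourn_disjoint:
  assumes t: "t \<in> standard_simplex n" and s: "0 < s" and gg: "s / 2 < sojourn s g ((n, hs), t)" "s / 2 < sojourn s g' ((n, hs), t)"
  shows "g = g'"
proof (rule ccontr)
  assume "g \<noteq> g'"
  have "sojourn s g ((n, hs), t) + sojourn s g' ((n, hs), t) \<le> (\<Sum>i\<le>n. min s (psum t (Suc i)) - min s (psum t i))"
    unfolding sojourn_simp sum.distrib[symmetric]
    by (rule sum_mono) (use \<open>g \<noteq> g'\<close> psum_mono[OF t] in \<open>auto simp: min.mono intro: min.coboundedI2\<close>)
  also have "\<dots> = min s (psum t (Suc n)) - min s (psum t 0)"
    by (induction n) auto
  also have "\<dots> \<le> s" using s by (simp add: psum_def)
  finally show False using gg by simp
qed

text \<open>The first interval of positive length belongs to the value that fills \<open>[0, s)\<close> for small \<open>s\<close>.\<close>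

lemma sojourn_least:
  assumes t: "t \<in> standard_simplex n" and s: "0 < s" "s \<le> t (LEAST i. 0 < t i)"
  shows "s / 2 < sojourn s (hs ! (LEAST i. 0 < t i)) ((n, hs), t)" and "(LEAST i. 0 < t i) \<le> n"
proof -
  define i where "i = (LEAST i. 0 < t i)"
  have s_le: "s \<le> t i" using s by (simp add: i_def)
  have "i \<le> n"
  proof (rule ccontr)
    assume "\<not> i \<le> n"
    then have "t i = 0" using t by (auto simp: standard_simplex_def)
    then show False using s(1) s_le by simp
  qed
  then show "(LEAST i. 0 < t i) \<le> n" by (simp add: i_def)
  have "t j = 0" if "j < i" for j
  proof -
    have "0 \<le> t j" using t by (simp add: standard_simplex_def)
    moreover have "\<not> 0 < t j" using not_less_Least[OF that[unfolded i_def]] .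
    ultimately show ?thesis by linarith
  qed
  then have P: "psum t i = 0" "psum t (Suc i) = t i" by (auto simp: psum_def)
  define F where "F j = (if hs ! j = hs ! i then min s (psum t (Suc j)) - min s (psum t j) else 0)" for j
  have "0 \<le> F j" for j
    using psum_mono[OF t, of j "Suc j"] by (auto simp: F_def min.mono intro: min.coboundedI2)
  then have "F i \<le> sum F {..n}" using \<open>i \<le> n\<close> by (intro member_le_sum) auto
  moreover have "F i = s" using P s(1) s_le by (simp add: F_def)
  ultimately show "s / 2 < sojourn s (hs ! (LEAST i. 0 < t i)) ((n, hs), t)"
    unfolding sojourn_simp F_def i_def[symmetric] using s(1) by simp
qed

lemma least_pos:
  assumes "t \<in> standard_simplex n"
  shows "0 < t (LEAST i. 0 < t i)"
proof -
  have "\<exists>i. 0 < t i"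
  proof (rule ccontr)
    assume "\<not> ?thesis"
    then have "t i \<le> 0" for i by (simp add: not_less)
    moreover have "0 \<le> t i" for i using assms by (simp add: standard_simplex_def)
    ultimately have "t i = 0" for i by (rule antisym)
    then show False using assms by (simp add: standard_simplex_def)
  qed
  then show ?thesis by (rule LeastI_ex)
qed

lemma continuous_map_sojourn: "continuous_map (simplex_top n) euclideanreal (\<lambda>t. sojourn s g ((m, hs), t))"
proof -
  have *: "continuous_map (simplex_top n) euclideanreal (\<lambda>t. psum t i)" for i
    unfolding psum_def
    by (intro continuous_map_sum continuous_map_from_subtopology continuous_map_product_projection) auto
  have "continuous_map (simplex_top n) euclideanreal
      (\<lambda>t. if hs ! i = g then min s (psum t (Suc i)) - min s (psum t i) else 0)" for i
    using * by (cases "hs ! i = g") (auto intro!: continuous_map_diff continuous_map_real_min)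
  then show ?thesis unfolding sojourn_simp by (intro continuous_map_sum) auto
qed

abbreviation sojourn_cls :: "real \<Rightarrow> 'g \<Rightarrow> ((nat \<times> 'g list) \<times> (nat \<Rightarrow> real)) set \<Rightarrow> real"
  where "sojourn_cls s g \<equiv> descend (sojourn s g)"

lemma sojourn_cls: "sojourn_cls s g (cls (EG G) x) = sojourn s g x"
  by (rule descend_cls) (rule sojourn_glue)

lemma continuous_map_sojourn_cls: "continuous_map (realization (EG G)) euclideanreal (sojourn_cls s g)"
  by (rule continuous_map_from_realization) (simp add: sojourn_cls continuous_map_sojourn)

text \<open>The value of the step function near \<open>0\<close>. This function is equivariant, but in general not continuous.\<close>

definition first_value :: "((nat \<times> 'g list) \<times> (nat \<Rightarrow> real)) set \<Rightarrow> 'g"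
  where "first_value x = (THE g. \<exists>s0>0. \<forall>s. 0 < s \<and> s \<le> s0 \<longrightarrow> s / 2 < sojourn_cls s g x)"

lemma first_value_cls:
  assumes t: "t \<in> standard_simplex n"
  shows "first_value (cls (EG G) ((n, hs), t)) = hs ! (LEAST i. 0 < t i)"
  unfolding first_value_def sojourn_cls
proof (rule the_equality)
  show "\<exists>s0>0. \<forall>s. 0 < s \<and> s \<le> s0 \<longrightarrow> s / 2 < sojourn s (hs ! (LEAST i. 0 < t i)) ((n, hs), t)"
    by (rule exI[where x = "t (LEAST i. 0 < t i)"]) (intro conjI allI impI, rule least_pos[OF t], elim conjE, rule sojourn_least(1)[OF t])
next
  fix g assume "\<exists>s0>0. \<forall>s. 0 < s \<and> s \<le> s0 \<longrightarrow> s / 2 < sojourn s g ((n, hs), t)"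
  then obtain s0 where s0: "0 < s0" "\<And>s. \<lbrakk>0 < s; s \<le> s0\<rbrakk> \<Longrightarrow> s / 2 < sojourn s g ((n, hs), t)" by blast
  define s where "s = min s0 (t (LEAST i. 0 < t i))"
  have "0 < s" "s \<le> s0" "s \<le> t (LEAST i. 0 < t i)" using s0 least_pos[OF t] by (auto simp: s_def)
  then show "g = hs ! (LEAST i. 0 < t i)"
    by (intro sojourn_disjoint[OF t \<open>0 < s\<close> s0(2) sojourn_least(1)[OF t]])
qed

lemma least_vert: "(LEAST j. 0 < vert i j) = i"
  by (rule Least_equality) (auto split: if_splits)

section \<open>Contractibility\<close>

text \<open>The coordinates of the point that divides the segment from the cone point to \<open>t\<close>; the cone point
  becomes vertex \<open>0\<close> and has weight \<open>u\<close>.\<close>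

definition cone_coords :: "real \<Rightarrow> (nat \<Rightarrow> real) \<Rightarrow> nat \<Rightarrow> real"
  where "cone_coords u t = (\<lambda>i. if i = 0 then u else (1 - u) * t (i - 1))"

lemma cone_coords_in:
  assumes u: "0 \<le> u" "u \<le> 1" and t: "t \<in> standard_simplex n"
  shows "cone_coords u t \<in> standard_simplex (Suc n)"
proof -
  have "(\<Sum>i\<le>Suc n. cone_coords u t i) = u + (\<Sum>i\<le>n. (1 - u) * t i)"
    unfolding sum.atMost_Suc_shift by (simp add: cone_coords_def)
  also have "\<dots> = 1" using t by (simp add: standard_simplex_def flip: sum_distrib_left)
  finally show ?thesis
    using u t by (auto simp: standard_simplex_def cone_coords_def mult_le_one)
qed

lemma cone_coords_face: "cone_coords u (simplical_face k t) = simplical_face (Suc k) (cone_coords u t)"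
  by (auto simp: cone_coords_def simplical_face_def fun_eq_iff)

lemma cone_coords_codegen: "cone_coords u (simplicial_codegen k t) = simplicial_codegen (Suc k) (cone_coords u t)"
  by (auto simp: cone_coords_def simplicial_codegen_def fun_eq_iff algebra_simps)

context group
begin

text \<open>Joining a point to the vertex \<open>\<one>\<close>.\<close>

definition EG_cone :: "real \<Rightarrow> (nat \<times> 'a list) \<times> (nat \<Rightarrow> real) \<Rightarrow> (nat \<times> 'a list) \<times> (nat \<Rightarrow> real)"
  where "EG_cone u = (\<lambda>((n, hs), t). ((Suc n, \<one> # hs), cone_coords u t))"

lemma one_Cons_in: "hs \<in> tuples (carrier G) n \<Longrightarrow> \<one> # hs \<in> tuples (carrier G) (Suc n)"
  by (auto simp: tuples_def)

lemma EG_cone_glue: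
  assumes xy: "(x, y) \<in> glue (EG G)" and u: "0 \<le> u" "u \<le> 1"
  shows "cls (EG G) (EG_cone u x) = cls (EG G) (EG_cone u y)"
  using xy
proof (cases rule: glue_cases)
  case (face n i \<sigma> t)
  have "(EG_cone u x, EG_cone u y) \<in> glue (EG G)"
    using glue_face[of "\<one> # \<sigma>" "EG G" "Suc n" "Suc i" "cone_coords u t"] face u
    by (simp add: EG_cone_def cone_coords_face cone_coords_in one_Cons_in)
  then show ?thesis by (rule cls_glue)
next
  case (degen n i \<sigma> t)
  have "(EG_cone u x, EG_cone u y) \<in> glue (EG G)"
    using glue_degen[of "\<one> # \<sigma>" "EG G" "Suc n" "Suc i" "cone_coords u t"] degen u
    by (simp add: EG_cone_def cone_coords_codegen cone_coords_in one_Cons_in)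
  then show ?thesis by (rule cls_glue)
qed

lemma EG_cone_0:
  assumes "hs \<in> tuples (carrier G) (Suc n)" "t \<in> standard_simplex n"
  shows "cls (EG G) (EG_cone 0 ((n, hs), t)) = cls (EG G) ((n, hs), t)"
proof -
  have "cone_coords 0 t = simplical_face 0 t"
    by (auto simp: cone_coords_def simplical_face_def fun_eq_iff)
  then show ?thesis
    using cls_glue[OF glue_face[of "\<one> # hs" "EG G" n 0 t]] assms
    by (simp add: EG_cone_def one_Cons_in)
qed

lemma EG_cone_1:
  assumes "hs \<in> tuples (carrier G) (Suc n)"
  shows "cls (EG G) (EG_cone 1 ((n, hs), t)) = cls (EG G) ((0, [\<one>]), vert 0)"
proof -
  have "cls (EG G) ((n, \<one> # hs), vert 0) = cls (EG G) ((0, [\<one>]), vert 0)" if "hs \<in> tuples (carrier G) n" for n hs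
    using that
  proof (induction n arbitrary: hs)
    case 0
    then show ?case by (simp add: tuples_def)
  next
    case (Suc n)
    have v: "simplical_face (Suc n) (vert 0) = (vert 0 :: nat \<Rightarrow> real)"
      by (auto simp: simplical_face_def fun_eq_iff)
    have "butlast hs \<in> tuples (carrier G) n" using Suc.prems by (auto simp: tuples_def dest: in_set_butlastD)
    moreover have "take (Suc n) (\<one> # hs) @ drop (Suc (Suc n)) (\<one> # hs) = \<one> # butlast hs"
      using Suc.prems by (simp add: tuples_def butlast_conv_take)
    ultimately show ?case
      using cls_glue[OF glue_face[of "\<one> # hs" "EG G" n "Suc n" "vert 0"]] Suc one_Cons_in[of hs "Suc n"]
      by (simp add: v)
  qed
  moreover have "cone_coords 1 t = vert 0" by (auto simp: cone_coords_def fun_eq_iff)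
  ultimately show ?thesis using assms by (simp add: EG_cone_def)
qed

text \<open>The cone construction is a homotopy from the identity to a constant map. It is continuous on the
  realization because the product of a quotient map with the unit interval is a quotient map.\<close>

lemma contractible_EG: "contractible_space (realization (EG G))"
proof -
  let ?I = "top_of_set {0..1::real}" and ?E = "realization (EG G)" and ?S = "simplex_sum (EG G)"
  define q where "q = (\<lambda>(u::real, x). (u, cls (EG G) x))"
  define H where "H = (\<lambda>(u::real, x). cls (EG G) (EG_cone u x))"
  have q: "quotient_map (prod_topology ?I ?S) (prod_topology ?I ?E) q"
    unfolding q_def
    by (rule quotient_map_prod_right)
      (auto simp: quotient_map_cls locally_compact_space_euclidean Hausdorff_space_subtopology
        intro!: compact_imp_locally_compact_space compact_space_subtopology)
  have H: "continuous_map (prod_topology ?I ?S) ?E H"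
  proof (rule pasting_lemma[where I = "{(n, \<sigma>). \<sigma> \<in> simplices (EG G) n}" and f = "\<lambda>_. H"
          and T = "\<lambda>i. {0..1} \<times> {x \<in> topspace ?S. fst x = i}"])
    fix i assume "i \<in> {(n, \<sigma>). \<sigma> \<in> simplices (EG G) n}"
    then obtain n \<sigma> where i: "i = (n, \<sigma>)" "\<sigma> \<in> tuples (carrier G) (Suc n)" by auto
    let ?T = "{x \<in> topspace ?S. fst x = i}"
    have "openin ?S ?T"
      unfolding openin_simplex_sum
    proof (intro conjI allI ballI)
      fix m \<tau> assume "\<tau> \<in> simplices (EG G) m"
      then have "{t. ((m, \<tau>), t) \<in> ?T} = (if i = (m, \<tau>) then topspace (simplex_top m) else {})"
        by (auto simp: topspace_simplex_sum)
      then show "openin (simplex_top m) {t. ((m, \<tau>), t) \<in> ?T}"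
        by (simp only: openin_topspace openin_empty split: if_split) simp
    qed auto
    then show "openin (prod_topology ?I ?S) ({0..1} \<times> ?T)"
      by (auto simp: openin_prod_Times_iff)
    have snd: "continuous_map ?S (powertop_real UNIV) snd"
      by (auto simp: continuous_map_from_simplex_sum intro: continuous_map_from_subtopology)
    let ?P = "subtopology (prod_topology ?I ?S) ({0..1} \<times> ?T)"
    have proj: "continuous_map ?P euclideanreal (\<lambda>z. snd (snd z) j)" for j
    proof -
      have "continuous_map (prod_topology ?I ?S) euclideanreal ((\<lambda>t. t j) \<circ> (snd \<circ> snd))"
        by (intro continuous_map_compose[OF continuous_map_compose[OF continuous_map_snd snd]] continuous_map_product_projection) auto
      then show ?thesis by (simp add: o_def continuous_map_from_subtopology)
    qed
    have u: "continuous_map ?P euclideanreal fst"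
      using continuous_map_fst[of ?I ?S] by (auto intro: continuous_map_from_subtopology simp: continuous_map_in_subtopology)
    have "continuous_map ?P (powertop_real UNIV) (\<lambda>z. cone_coords (fst z) (snd (snd z)))"
      unfolding continuous_map_componentwise_UNIV
    proof
      fix j
      have "continuous_map ?P euclideanreal (\<lambda>z. (1 - fst z) * snd (snd z) (j - 1))"
        by (intro continuous_map_real_mult continuous_map_diff u proj) auto
      then show "continuous_map ?P euclideanreal (\<lambda>z. cone_coords (fst z) (snd (snd z)) j)"
        using u by (cases "j = 0") (auto simp: cone_coords_def)
    qed
    then have "continuous_map ?P (simplex_top (Suc n)) (\<lambda>z. cone_coords (fst z) (snd (snd z)))"
      using i by (auto simp: continuous_map_in_subtopology topspace_simplex_sum intro!: cone_coords_in)
    moreover have "continuous_map (simplex_top (Suc n)) ?E (\<lambda>t. cls (EG G) ((Suc n, \<one> # \<sigma>), t))"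
      by (rule continuous_map_cls) (use i in \<open>simp add: one_Cons_in\<close>)
    ultimately have "continuous_map ?P ?E ((\<lambda>t. cls (EG G) ((Suc n, \<one> # \<sigma>), t)) \<circ> (\<lambda>z. cone_coords (fst z) (snd (snd z))))"
      by (rule continuous_map_compose)
    then show "continuous_map ?P ?E H"
      by (rule continuous_map_eq) (auto simp: H_def EG_cone_def i)
  next
    fix z assume "z \<in> topspace (prod_topology ?I ?S)"
    then show "\<exists>j. j \<in> {(n, \<sigma>). \<sigma> \<in> simplices (EG G) n} \<and> z \<in> {0..1} \<times> {x \<in> topspace ?S. fst x = j} \<and> H z = H z"
      by (auto simp: topspace_simplex_sum)
  qed auto
  have Hq: "H x = H y" if "x \<in> topspace (prod_topology ?I ?S)" "y \<in> topspace (prod_topology ?I ?S)" "q x = q y" for x y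
  proof -
    obtain u a where x: "x = (u, a)" by (cases x)
    obtain v b where y: "y = (v, b)" by (cases y)
    have *: "x = (u, a)" "y = (u, b)" "0 \<le> u" "u \<le> 1" "cls (EG G) a = cls (EG G) b"
      using that by (simp_all add: q_def x y topspace_prod_topology mem_Times_iff)
    have "cls (EG G) (EG_cone u a) = cls (EG G) (EG_cone u b)"
      by (rule glue_invariant_cls[of "EG G" "\<lambda>x. cls (EG G) (EG_cone u x)"]) (use EG_cone_glue * in auto)
    then show ?thesis using * by (simp add: H_def)
  qed
  obtain h where h: "continuous_map (prod_topology ?I ?E) ?E h"
    "\<And>z. z \<in> topspace (prod_topology ?I ?S) \<Longrightarrow> h (q z) = H z"
  proof (rule quotient_map_lift_exists[OF q H])
    show "H x = H y" if "x \<in> topspace (prod_topology ?I ?S)" "y \<in> topspace (prod_topology ?I ?S)" "q x = q y" for x y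
      by (rule Hq[OF that])
  next
    fix g
    assume g: "continuous_map (prod_topology ?I ?E) ?E g"
      "\<And>z. z \<in> topspace (prod_topology ?I ?S) \<Longrightarrow> g (q z) = H z"
    show thesis by (rule that[OF g])
  qed
  have h': "h (u, cls (EG G) ((n, hs), t)) = cls (EG G) (EG_cone u ((n, hs), t))"
    if "0 \<le> u" "u \<le> 1" "hs \<in> tuples (carrier G) (Suc n)" "t \<in> standard_simplex n" for u n hs t
    using h(2)[of "(u, ((n, hs), t))"] that by (simp add: q_def H_def topspace_simplex_sum)
  have "homotopic_with (\<lambda>_. True) ?E ?E id (\<lambda>_. cls (EG G) ((0, [\<one>]), vert 0))"
  proof (subst homotopic_with, simp, intro exI conjI ballI)
    show "continuous_map (prod_topology ?I ?E) ?E h" by (rule h)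
    fix x assume "x \<in> topspace ?E"
    then obtain n hs t where x: "x = cls (EG G) ((n, hs), t)" "hs \<in> tuples (carrier G) (Suc n)" "t \<in> standard_simplex n"
      by (metis realization_cases EG_sel(1))
    show "h (0, x) = id x" "h (1, x) = cls (EG G) ((0, [\<one>]), vert 0)"
      unfolding x(1) using h'[of 0 hs n t] h'[of 1 hs n t] EG_cone_0[OF x(2,3)] EG_cone_1[OF x(2), of t] x(2,3)
      by simp_all
  qed auto
  then show ?thesis unfolding contractible_space_def by (rule exI)
qed

end

section \<open>Straightening singular simplices\<close>

text \<open>A free cover with contractible total space and an equivariant family of singular simplices in it,
  indexed by tuples of vertices, together with an equivariant choice \<open>first\<close> of a group element for
  every point, which recovers the vertices of those simplices. The function \<open>first\<close> need not be
  continuous.\<close>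

locale free_cover_cells = free_cover G E B act pr
  for G :: "('a, 'm) monoid_scheme" (structure) and E :: "'e topology" and B :: "'x topology" and act :: "'a \<Rightarrow> 'e \<Rightarrow> 'e" and pr +
  fixes first :: "'e \<Rightarrow> 'a" and ecell :: "nat \<Rightarrow> 'a list \<Rightarrow> (nat \<Rightarrow> real) \<Rightarrow> 'e"
  assumes contractible: "contractible_space E"
    and first_closed: "x \<in> topspace E \<Longrightarrow> first x \<in> carrier G"
    and first_act: "\<lbrakk>g \<in> carrier G; x \<in> topspace E\<rbrakk> \<Longrightarrow> first (act g x) = g \<otimes> first x"
    and ecell_simplex: "hs \<in> tuples (carrier G) (Suc n) \<Longrightarrow> singular_simplex n E (ecell n hs)"
    and ecell_face: "\<lbrakk>hs \<in> tuples (carrier G) (Suc (Suc n)); i \<le> Suc n\<rbrakk> \<Longrightarrow>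
        singular_face (Suc n) i (ecell (Suc n) hs) = ecell n (take i hs @ drop (Suc i) hs)"
    and ecell_act: "\<lbrakk>g \<in> carrier G; hs \<in> tuples (carrier G) (Suc n)\<rbrakk> \<Longrightarrow>
        simplex_map n (act g) (ecell n hs) = ecell n (map ((\<otimes>) g) hs)"
    and first_ecell: "\<lbrakk>hs \<in> tuples (carrier G) (Suc n); i \<le> n\<rbrakk> \<Longrightarrow> first (ecell n hs (vert i)) = hs ! i"
begin

lemma simplex_closed: "\<lbrakk>singular_simplex n E \<tau>; t \<in> standard_simplex n\<rbrakk> \<Longrightarrow> \<tau> t \<in> topspace E"
  by (auto simp: singular_simplex_def continuous_map_def)

lemma simplex_map_act_simplex:
  "\<lbrakk>g \<in> carrier G; singular_simplex n E \<tau>\<rbrakk> \<Longrightarrow> singular_simplex n E (simplex_map n (act g) \<tau>)"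
  using act_continuous singular_simplex_simplex_map by blast

lemma simplex_map_act_act:
  assumes "g \<in> carrier G" "h \<in> carrier G" "singular_simplex n E \<tau>"
  shows "simplex_map n (act g) (simplex_map n (act h) \<tau>) = simplex_map n (act (g \<otimes> h)) \<tau>"
  using assms simplex_closed[OF assms(3)] by (auto simp: simplex_map_def act_mult)

lemma simplex_map_act_one: "singular_simplex n E \<tau> \<Longrightarrow> simplex_map n (act \<one>) \<tau> = \<tau>"
  by (erule simplex_map_id_gen) (rule act_one)

lemma simplex_map_pr_act:
  assumes "g \<in> carrier G" "singular_simplex n E \<tau>"
  shows "simplex_map n pr (simplex_map n (act g) \<tau>) = simplex_map n pr \<tau>"
  using assms simplex_closed[OF assms(2)] by (auto simp: simplex_map_def pr_act)

lemma chain_map_act_act: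
  assumes "g \<in> carrier G" "h \<in> carrier G" "singular_chain n E c"
  shows "chain_map n (act g) (chain_map n (act h) c) = chain_map n (act (g \<otimes> h)) c"
  using assms(3) unfolding singular_chain_def
  by (induction c rule: frag_induction) (auto simp: simplex_map_act_act assms chain_map_diff)

lemma chain_map_pr_act:
  assumes "g \<in> carrier G" "singular_chain n E c"
  shows "chain_map n pr (chain_map n (act g) c) = chain_map n pr c"
  using assms(2) unfolding singular_chain_def
  by (induction c rule: frag_induction) (auto simp: simplex_map_pr_act assms chain_map_diff)

lemma chain_map_act_chain: "\<lbrakk>g \<in> carrier G; singular_chain n E c\<rbrakk> \<Longrightarrow> singular_chain n E (chain_map n (act g) c)"
  using act_continuous singular_chain_chain_map by blast

text \<open>The group elements attached to the vertices of a singular simplex.\<close>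

definition vertices :: "nat \<Rightarrow> ((nat \<Rightarrow> real) \<Rightarrow> 'e) \<Rightarrow> 'a list"
  where "vertices n \<tau> = map (\<lambda>i. first (\<tau> (vert i))) [0..<Suc n]"

lemma length_vertices [simp]: "length (vertices n \<tau>) = Suc n"
  by (simp add: vertices_def)

lemma nth_vertices: "i \<le> n \<Longrightarrow> vertices n \<tau> ! i = first (\<tau> (vert i))"
  by (simp add: vertices_def nth_append less_Suc_eq_le del: upt_Suc)

lemma vertices_in: "singular_simplex n E \<tau> \<Longrightarrow> vertices n \<tau> \<in> tuples (carrier G) (Suc n)"
  by (rule tuplesI) (auto simp: nth_vertices less_Suc_eq_le intro!: first_closed simplex_closed)

lemma vertices_face:
  assumes "singular_simplex (Suc n) E \<tau>" "i \<le> Suc n"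
  shows "vertices n (singular_face (Suc n) i \<tau>) = take i (vertices (Suc n) \<tau>) @ drop (Suc i) (vertices (Suc n) \<tau>)"
proof (rule nth_equalityI)
  fix j assume "j < length (vertices n (singular_face (Suc n) i \<tau>))"
  then have j: "j \<le> n" by simp
  have "simplical_face i (vert j) = (vert (if j < i then j else Suc j) :: nat \<Rightarrow> real)"
    by (auto simp: simplical_face_def fun_eq_iff)
  then have "singular_face (Suc n) i \<tau> (vert j) = \<tau> (vert (if j < i then j else Suc j))"
    using j by (simp add: singular_face_def)
  then show "vertices n (singular_face (Suc n) i \<tau>) ! j =
      (take i (vertices (Suc n) \<tau>) @ drop (Suc i) (vertices (Suc n) \<tau>)) ! j"
    using j assms(2) by (subst nth_EG_face) (simp_all add: nth_vertices)
qed (use assms in simp)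

lemma vertices_act:
  assumes "g \<in> carrier G" "singular_simplex n E \<tau>"
  shows "vertices n (simplex_map n (act g) \<tau>) = map ((\<otimes>) g) (vertices n \<tau>)"
proof (rule nth_equalityI)
  fix i assume "i < length (vertices n (simplex_map n (act g) \<tau>))"
  then have i: "i \<le> n" by simp
  then have "\<tau> (vert i) \<in> topspace E" using simplex_closed[OF assms(2)] by simp
  then show "vertices n (simplex_map n (act g) \<tau>) ! i = map ((\<otimes>) g) (vertices n \<tau>) ! i"
    using i assms(1) by (simp add: nth_vertices simplex_map_def first_act less_Suc_eq_le)
qed simp

lemma vertices_ecell:
  assumes "hs \<in> tuples (carrier G) (Suc n)"
  shows "vertices n (ecell n hs) = hs"
  by (rule nth_equalityI) (use assms in \<open>auto simp: nth_vertices tuples_length first_ecell less_Suc_eq_le\<close>)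

text \<open>The chain map that replaces a singular simplex by the given simplex with the same vertices.\<close>

definition straighten :: "nat \<Rightarrow> 'e chain \<Rightarrow> 'e chain"
  where "straighten n = frag_extend (\<lambda>\<tau>. frag_of (ecell n (vertices n \<tau>)))"

lemma straighten_of: "straighten n (frag_of \<tau>) = frag_of (ecell n (vertices n \<tau>))"
  by (simp add: straighten_def)

lemma straighten_chain: "singular_chain n E c \<Longrightarrow> singular_chain n E (straighten n c)"
  unfolding straighten_def
  by (rule singular_chain_extend) (auto simp: singular_chain_of singular_chain_def intro!: ecell_simplex vertices_in)

lemma straighten_boundary:
  assumes "singular_chain (Suc n) E c"
  shows "chain_boundary (Suc n) (straighten (Suc n) c) = straighten n (chain_boundary (Suc n) c)"
  using assms unfolding singular_chain_def
proof (induction c rule: frag_induction)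
  case (one \<tau>)
  have "ecell n (vertices n (singular_face (Suc n) i \<tau>)) =
      singular_face (Suc n) i (ecell (Suc n) (vertices (Suc n) \<tau>))" if "i \<le> Suc n" for i
    using one that by (simp add: vertices_face ecell_face vertices_in)
  then show ?case
    by (simp add: straighten_of chain_boundary_of straighten_def frag_extend_sum frag_extend_cmul o_def del: sum.atMost_Suc)
qed (auto simp: straighten_def chain_boundary_diff frag_extend_diff)

lemma straighten_act:
  assumes "g \<in> carrier G" "singular_chain n E c"
  shows "straighten n (chain_map n (act g) c) = chain_map n (act g) (straighten n c)"
  using assms(2) unfolding singular_chain_def
proof (induction c rule: frag_induction)
  case (one \<tau>)
  then show ?case using assms(1) by (simp add: straighten_of vertices_act ecell_act vertices_in)
qed (auto simp: straighten_def chain_map_diff frag_extend_diff)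

text \<open>Acyclicity of the total space. In degree \<open>0\<close> the cycle must have augmentation \<open>0\<close>, which is expressed
  by its image under a constant map.\<close>

lemma cycle_bounds:
  assumes c: "singular_chain n E c" and cyc: "chain_boundary n c = 0"
    and deg0: "\<And>a::'e. n = 0 \<Longrightarrow> chain_map 0 (\<lambda>_. a) c = 0"
  shows "\<exists>d. singular_chain (Suc n) E d \<and> chain_boundary (Suc n) d = c"
proof (cases "topspace E = {}")
  case True
  then show ?thesis using c by (intro exI[where x = 0]) (simp add: singular_chain_empty)
next
  case False
  obtain a where a: "homotopic_with (\<lambda>_. True) E E id (\<lambda>_. a)"
    using contractible by (auto simp: contractible_space_def)
  have "continuous_map E E (\<lambda>_. a)" using homotopic_with_imp_continuous_maps[OF a] by simp
  then have aE: "a \<in> topspace E" using False by (auto simp: continuous_map_def Pi_iff)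
  have rc: "singular_relcycle n E {} c" using c cyc by (simp add: singular_cycle)
  have "homotopic_with (\<lambda>h. h \<in> {} \<rightarrow> {}) E E id (\<lambda>_. a)"
    using a by (simp add: Pi_def)
  from homotopic_imp_homologous_rel_chain_maps[OF this rc]
  have "homologous_rel n E {} c (chain_map n (\<lambda>_. a) c)"
    using c by (simp add: chain_map_ident)
  moreover have "singular_relboundary n E {} (chain_map n (\<lambda>_. a) c)"
  proof (cases "n = 0")
    case True
    then show ?thesis using deg0 by simp
  next
    case False
    let ?A = "subtopology E {a}"
    have A: "topspace ?A = {a}" using aE by auto
    have "continuous_map E ?A (\<lambda>_. a)" using aE by (simp add: continuous_map_in_subtopology)
    then have "singular_relcycle n ?A {} (chain_map n (\<lambda>_. a) c)"
      using singular_relcycle_chain_map[OF rc] by blast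
    then have "singular_relboundary n ?A {} (chain_map n (\<lambda>_. a) c)"
      using singular_boundary_eq_cycle_singleton[OF A] False by simp
    then have "singular_relboundary n (subtopology E UNIV) {} (chain_map n (\<lambda>_. a) c)"
      by (rule singular_boundary_mono[OF subset_UNIV])
    then show ?thesis by simp
  qed
  ultimately have "singular_relboundary n E {} (c - chain_map n (\<lambda>_. a) c + chain_map n (\<lambda>_. a) c)"
    unfolding homologous_rel_def by (rule singular_relboundary_add)
  then show ?thesis by (simp add: singular_boundary)
qed

text \<open>A chain that fills the cycle which the next stage of the homotopy has to bound, where \<open>L\<close> is the
  previous stage.\<close>

definition filling :: "('e chain \<Rightarrow> 'e chain) \<Rightarrow> nat \<Rightarrow> ((nat \<Rightarrow> real) \<Rightarrow> 'e) \<Rightarrow> 'e chain"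
  where "filling L n \<tau> = (SOME d. singular_chain (Suc n) E d \<and>
    chain_boundary (Suc n) d = frag_of \<tau> - straighten n (frag_of \<tau>) - L (chain_boundary n (frag_of \<tau>)))"

text \<open>The equivariant extension of \<open>\<kappa>\<close> from the simplices whose initial vertex is the identity.\<close>

definition equivariant :: "nat \<Rightarrow> (((nat \<Rightarrow> real) \<Rightarrow> 'e) \<Rightarrow> 'e chain) \<Rightarrow> ((nat \<Rightarrow> real) \<Rightarrow> 'e) \<Rightarrow> 'e chain"
  where "equivariant n \<kappa> \<tau> =
    chain_map (Suc n) (act (first (\<tau> (vert 0)))) (\<kappa> (simplex_map n (act (inv (first (\<tau> (vert 0))))) \<tau>))"

text \<open>An equivariant chain homotopy from straightening to the identity. The degree is shifted by one:
  \<open>homotopy n\<close> raises chains of degree \<open>n - 1\<close>, and \<open>homotopy 0\<close> is the zero map.\<close>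

primrec homotopy :: "nat \<Rightarrow> 'e chain \<Rightarrow> 'e chain"
  where "homotopy 0 = (\<lambda>_. 0)"
  | "homotopy (Suc n) = frag_extend (equivariant n (filling (homotopy n) n))"

lemma homotopy_linear [simp]: "homotopy n 0 = 0" "homotopy n (a - b) = homotopy n a - homotopy n b"
  by (cases n; simp add: frag_extend_diff)+

lemma homotopy_properties:
  "(\<forall>c. singular_chain (n - 1) E c \<longrightarrow> singular_chain n E (homotopy n c)) \<and>
   (\<forall>g\<in>carrier G. \<forall>c. singular_chain (n - 1) E c \<longrightarrow>
      homotopy n (chain_map (n - 1) (act g) c) = chain_map n (act g) (homotopy n c)) \<and>
   (\<forall>m c. n = Suc m \<longrightarrow> singular_chain m E c \<longrightarrow>
      chain_boundary n (homotopy n c) = c - straighten m c - homotopy m (chain_boundary m c))"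
proof (induction n)
  case 0
  then show ?case by simp
next
  case (Suc n)
  have H1: "singular_chain n E (homotopy n c)" if "singular_chain (n - 1) E c" for c
    using Suc that by blast
  have H2: "homotopy n (chain_map (n - 1) (act g) c) = chain_map n (act g) (homotopy n c)"
    if "g \<in> carrier G" "singular_chain (n - 1) E c" for g c
    using Suc that by blast
  have H3: "chain_boundary n (homotopy n c) = c - straighten m c - homotopy m (chain_boundary m c)"
    if "n = Suc m" "singular_chain m E c" for m c
    using Suc that by blast
  define \<kappa> where "\<kappa> = filling (homotopy n) n"
  have fill: "singular_chain (Suc n) E (\<kappa> \<tau>) \<and>
      chain_boundary (Suc n) (\<kappa> \<tau>) = frag_of \<tau> - straighten n (frag_of \<tau>) - homotopy n (chain_boundary n (frag_of \<tau>))"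
    if \<tau>: "singular_simplex n E \<tau>" for \<tau>
    unfolding \<kappa>_def filling_def
  proof (rule someI_ex, rule cycle_bounds)
    have c: "singular_chain n E (frag_of \<tau>)" using \<tau> by (simp add: singular_chain_of)
    have b: "singular_chain (n - 1) E (chain_boundary n (frag_of \<tau>))"
      using singular_chain_boundary[OF c] by simp
    show "singular_chain n E (frag_of \<tau> - straighten n (frag_of \<tau>) - homotopy n (chain_boundary n (frag_of \<tau>)))"
      by (intro singular_chain_diff c straighten_chain H1 b)
    show "chain_boundary n (frag_of \<tau> - straighten n (frag_of \<tau>) - homotopy n (chain_boundary n (frag_of \<tau>))) = 0"
    proof (cases n)
      case 0
      then show ?thesis by (simp add: chain_boundary_def)
    next
      case (Suc m)
      have "chain_boundary m (chain_boundary n (frag_of \<tau>)) = 0"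
        using chain_boundary_boundary_alt[of m E "frag_of \<tau>"] c Suc by simp
      then show ?thesis
        using H3[OF Suc, of "chain_boundary n (frag_of \<tau>)"] b c Suc
        by (simp add: chain_boundary_diff straighten_boundary)
    qed
    show "chain_map 0 (\<lambda>_. a) (frag_of \<tau> - straighten n (frag_of \<tau>) - homotopy n (chain_boundary n (frag_of \<tau>))) = 0"
      if "n = 0" for a
      using that by (simp add: chain_map_diff straighten_of simplex_map_def o_def)
  qed
  have hom: "homotopy (Suc n) (frag_of \<tau>) = equivariant n \<kappa> \<tau>" for \<tau>
    by (simp add: \<kappa>_def)
  have fc: "first (\<tau> (vert 0)) \<in> carrier G" if "singular_simplex n E \<tau>" for \<tau>
    using first_closed simplex_closed[OF that] by simp
  have P1: "singular_chain (Suc n) E (homotopy (Suc n) c)" if c: "singular_chain n E c" for c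
    unfolding homotopy.simps \<kappa>_def[symmetric]
  proof (rule singular_chain_extend)
    fix \<tau> assume "\<tau> \<in> Poly_Mapping.keys c"
    then have \<tau>: "singular_simplex n E \<tau>" using c by (auto simp: singular_chain_def)
    show "singular_chain (Suc n) E (equivariant n \<kappa> \<tau>)"
      unfolding equivariant_def using fill[OF simplex_map_act_simplex[OF inv_closed[OF fc[OF \<tau>]] \<tau>]]
      by (intro chain_map_act_chain fc[OF \<tau>]) simp
  qed
  have P2: "homotopy (Suc n) (chain_map n (act g) c) = chain_map (Suc n) (act g) (homotopy (Suc n) c)"
    if g: "g \<in> carrier G" and c: "singular_chain n E c" for g c
    using c unfolding singular_chain_def
  proof (induction c rule: frag_induction)
    case (one \<tau>)
    then have \<tau>: "singular_simplex n E \<tau>" by simp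
    let ?h = "first (\<tau> (vert 0))"
    have h: "?h \<in> carrier G" by (rule fc[OF \<tau>])
    have "first (simplex_map n (act g) \<tau> (vert 0)) = g \<otimes> ?h"
      using simplex_closed[OF \<tau>, of "vert 0"] g by (simp add: simplex_map_def first_act)
    moreover have "simplex_map n (act (inv (g \<otimes> ?h))) (simplex_map n (act g) \<tau>) = simplex_map n (act (inv ?h)) \<tau>"
      using g h \<tau> by (simp add: simplex_map_act_act inv_mult_group m_assoc)
    moreover have "singular_chain (Suc n) E (\<kappa> (simplex_map n (act (inv ?h)) \<tau>))"
      using fill simplex_map_act_simplex[OF _ \<tau>] h by blast
    ultimately show ?case
      unfolding chain_map_of hom equivariant_def using g h by (simp add: chain_map_act_act)
  next
    case (diff a b)
    then show ?case by (simp only: chain_map_diff homotopy_linear)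
  qed (simp del: homotopy.simps)
  have P3: "chain_boundary (Suc n) (homotopy (Suc n) c) = c - straighten n c - homotopy n (chain_boundary n c)"
    if c: "singular_chain n E c" for c
    using c unfolding singular_chain_def
  proof (induction c rule: frag_induction)
    case (one \<tau>)
    then have \<tau>: "singular_simplex n E \<tau>" by simp
    let ?h = "first (\<tau> (vert 0))"
    let ?\<tau>' = "simplex_map n (act (inv ?h)) \<tau>"
    have h: "?h \<in> carrier G" by (rule fc[OF \<tau>])
    have \<tau>': "singular_simplex n E ?\<tau>'" using h \<tau> by (simp add: simplex_map_act_simplex)
    have c': "singular_chain n E (frag_of ?\<tau>')" using \<tau>' by (simp add: singular_chain_of)
    have b': "singular_chain (n - 1) E (chain_boundary n (frag_of ?\<tau>'))"
      using singular_chain_boundary[OF c'] by simp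
    have eq: "chain_map n (act ?h) (frag_of ?\<tau>') = frag_of \<tau>"
      using h \<tau> by (simp add: simplex_map_act_act simplex_map_act_one)
    have "chain_boundary (Suc n) (homotopy (Suc n) (frag_of \<tau>)) =
        chain_map n (act ?h) (chain_boundary (Suc n) (\<kappa> ?\<tau>'))"
      unfolding hom equivariant_def using chain_boundary_chain_map[of "Suc n" E "\<kappa> ?\<tau>'"] fill[OF \<tau>'] by simp
    also have "\<dots> = chain_map n (act ?h) (frag_of ?\<tau>') - straighten n (chain_map n (act ?h) (frag_of ?\<tau>'))
        - homotopy n (chain_boundary n (chain_map n (act ?h) (frag_of ?\<tau>')))"
      using fill[OF \<tau>'] straighten_act[OF h c'] H2[OF h b'] chain_boundary_chain_map[OF c', of "act ?h"]
      by (simp add: chain_map_diff del: chain_map_of)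
    finally show ?case unfolding eq .
  next
    case (diff a b)
    then show ?case by (simp add: chain_boundary_diff straighten_def frag_extend_diff del: homotopy.simps)
  qed (simp add: straighten_def del: homotopy.simps)
  show ?case using P1 P2 P3 by (simp del: homotopy.simps)
qed

lemma homotopy_chain: "singular_chain n E c \<Longrightarrow> singular_chain (Suc n) E (homotopy (Suc n) c)"
  using homotopy_properties[of "Suc n"] by simp

lemma homotopy_act:
  "\<lbrakk>g \<in> carrier G; singular_chain n E c\<rbrakk> \<Longrightarrow>
    homotopy (Suc n) (chain_map n (act g) c) = chain_map (Suc n) (act g) (homotopy (Suc n) c)"
  using homotopy_properties[of "Suc n"] by simp

lemma homotopy_boundary:
  "singular_chain n E c \<Longrightarrow> chain_boundary (Suc n) (homotopy (Suc n) c) =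
    c - straighten n c - homotopy n (chain_boundary n c)"
  using homotopy_properties[of "Suc n"] by simp

text \<open>A lift of a singular simplex, chosen arbitrarily; the constructions below do not depend on it.\<close>

definition lifted :: "nat \<Rightarrow> ((nat \<Rightarrow> real) \<Rightarrow> 'x) \<Rightarrow> (nat \<Rightarrow> real) \<Rightarrow> 'e"
  where "lifted n \<sigma> = (SOME \<tau>. singular_simplex n E \<tau> \<and> simplex_map n pr \<tau> = \<sigma>)"

lemma lifted:
  assumes "singular_simplex n B \<sigma>"
  shows "singular_simplex n E (lifted n \<sigma>)" and "simplex_map n pr (lifted n \<sigma>) = \<sigma>"
  using someI_ex[OF singular_simplex_lift[OF assms]] by (simp_all add: lifted_def)

lemma pr_simplex: "singular_simplex n E \<tau> \<Longrightarrow> singular_simplex n B (simplex_map n pr \<tau>)"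
  using pr_continuous by (rule singular_simplex_simplex_map[rotated])

lemma lifted_pr:
  assumes \<tau>: "singular_simplex n E \<tau>"
  shows "\<exists>g\<in>carrier G. lifted n (simplex_map n pr \<tau>) = simplex_map n (act g) \<tau>"
  using singular_simplex_lifts_orbit[OF \<tau>] lifted[OF pr_simplex[OF \<tau>]] by metis

text \<open>Straightening and its homotopy on the base, obtained from those upstairs by equivariance.\<close>

definition straighten_base :: "nat \<Rightarrow> 'x chain \<Rightarrow> 'x chain"
  where "straighten_base n =
    frag_extend (\<lambda>\<sigma>. frag_of (simplex_map n pr (ecell n (vertices n (lifted n \<sigma>)))))"

definition homotopy_base :: "nat \<Rightarrow> 'x chain \<Rightarrow> 'x chain"
  where "homotopy_base n = frag_extend (\<lambda>\<sigma>. chain_map (Suc n) pr (homotopy (Suc n) (frag_of (lifted n \<sigma>))))"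

lemma homotopy_base_chain: "singular_chain n B c \<Longrightarrow> singular_chain (Suc n) B (homotopy_base n c)"
  unfolding homotopy_base_def
  by (rule singular_chain_extend)
    (use pr_continuous in \<open>auto simp: singular_chain_def[of n B] singular_chain_of lifted
        simp del: homotopy.simps intro!: singular_chain_chain_map homotopy_chain\<close>)

lemma straighten_base_pr:
  assumes "singular_chain n E c"
  shows "straighten_base n (chain_map n pr c) = chain_map n pr (straighten n c)"
  using assms unfolding singular_chain_def
proof (induction c rule: frag_induction)
  case (one \<tau>)
  then have \<tau>: "singular_simplex n E \<tau>" by simp
  obtain g where "g \<in> carrier G" "lifted n (simplex_map n pr \<tau>) = simplex_map n (act g) \<tau>"
    using lifted_pr[OF \<tau>] by blast
  then show ?case
    using \<tau> by (simp add: straighten_base_def straighten_of vertices_act vertices_in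
        simplex_map_pr_act ecell_simplex flip: ecell_act)
qed (auto simp: straighten_base_def straighten_def chain_map_diff frag_extend_diff)

lemma homotopy_base_pr:
  assumes "singular_chain n E c"
  shows "homotopy_base n (chain_map n pr c) = chain_map (Suc n) pr (homotopy (Suc n) c)"
  using assms unfolding singular_chain_def
proof (induction c rule: frag_induction)
  case (one \<tau>)
  then have \<tau>: "singular_simplex n E \<tau>" by simp
  then have c: "singular_chain n E (frag_of \<tau>)" by (simp add: singular_chain_of)
  obtain g where g: "g \<in> carrier G" "lifted n (simplex_map n pr \<tau>) = simplex_map n (act g) \<tau>"
    using lifted_pr[OF \<tau>] by blast
  then have "homotopy_base n (chain_map n pr (frag_of \<tau>)) =
      chain_map (Suc n) pr (homotopy (Suc n) (chain_map n (act g) (frag_of \<tau>)))"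
    by (simp add: homotopy_base_def del: homotopy.simps)
  also have "\<dots> = chain_map (Suc n) pr (homotopy (Suc n) (frag_of \<tau>))"
    using homotopy_act[OF g(1) c] chain_map_pr_act[OF g(1) homotopy_chain[OF c]] by simp
  finally show ?case .
next
  case (diff a b)
  then show ?case
    by (simp only: chain_map_diff homotopy_linear) (simp add: homotopy_base_def frag_extend_diff del: homotopy.simps)
qed (simp add: homotopy_base_def del: homotopy.simps)

lemma lift_chain:
  assumes "singular_chain n B c"
  shows "\<exists>d. singular_chain n E d \<and> chain_map n pr d = c"
  using assms unfolding singular_chain_def
proof (induction c rule: frag_induction)
  case zero
  then show ?case by (intro exI[where x = 0]) simp
next
  case (one \<sigma>)
  then show ?case using lifted[of n \<sigma>] by (intro exI[where x = "frag_of (lifted n \<sigma>)"]) simp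
next
  case (diff a b)
  then obtain d e where "Poly_Mapping.keys d \<subseteq> singular_simplex_set n E" "chain_map n pr d = a"
    "Poly_Mapping.keys e \<subseteq> singular_simplex_set n E" "chain_map n pr e = b" by auto
  then show ?case using singular_chain_diff[of n E d e]
    by (intro exI[where x = "d - e"]) (simp add: chain_map_diff singular_chain_def)
qed

lemma straighten_base_homotopy:
  assumes "singular_chain (Suc n) B c"
  shows "chain_boundary (Suc (Suc n)) (homotopy_base (Suc n) c) =
    c - straighten_base (Suc n) c - homotopy_base n (chain_boundary (Suc n) c)"
proof -
  obtain d where d: "singular_chain (Suc n) E d" "chain_map (Suc n) pr d = c" using lift_chain[OF assms] by blast
  have b: "singular_chain n E (chain_boundary (Suc n) d)" using d(1) by (rule singular_chain_boundary_alt)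
  have "chain_boundary (Suc (Suc n)) (homotopy_base (Suc n) c) =
      chain_map (Suc n) pr (chain_boundary (Suc (Suc n)) (homotopy (Suc (Suc n)) d))"
    using homotopy_base_pr[OF d(1)] chain_boundary_chain_map[OF homotopy_chain[OF d(1)], of pr] d(2) by simp
  also have "\<dots> = c - straighten_base (Suc n) c - chain_map (Suc n) pr (homotopy (Suc n) (chain_boundary (Suc n) d))"
    unfolding homotopy_boundary[OF d(1)] using straighten_base_pr[OF d(1)] d(2) by (simp add: chain_map_diff del: homotopy.simps)
  also have "chain_map (Suc n) pr (homotopy (Suc n) (chain_boundary (Suc n) d)) = homotopy_base n (chain_boundary (Suc n) c)"
    using homotopy_base_pr[OF b] chain_boundary_chain_map[OF d(1), of pr] d(2) by simp
  finally show ?thesis .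
qed

lemma straighten_base_homotopy_0:
  assumes "singular_chain 0 B c"
  shows "chain_boundary (Suc 0) (homotopy_base 0 c) = c - straighten_base 0 c"
proof -
  obtain d where d: "singular_chain 0 E d" "chain_map 0 pr d = c" using lift_chain[OF assms] by blast
  have "chain_boundary (Suc 0) (homotopy_base 0 c) =
      chain_map 0 pr (chain_boundary (Suc 0) (homotopy (Suc 0) d))"
    using homotopy_base_pr[OF d(1)] chain_boundary_chain_map[OF homotopy_chain[OF d(1)], of pr] d(2) by simp
  also have "\<dots> = c - straighten_base 0 c"
    unfolding homotopy_boundary[OF d(1)] using straighten_base_pr[OF d(1)] d(2) by (simp add: chain_map_diff)
  finally show ?thesis .
qed

text \<open>The tuple of group elements along the edges from one vertex to the next; it is the simplex of the
  nerve that corresponds to a singular simplex of the base.\<close>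

definition edges :: "nat \<Rightarrow> ((nat \<Rightarrow> real) \<Rightarrow> 'x) \<Rightarrow> 'a list"
  where "edges n \<sigma> = quotients G (vertices n (lifted n \<sigma>))"

lemma edges_pr:
  assumes "singular_simplex n E \<tau>"
  shows "edges n (simplex_map n pr \<tau>) = quotients G (vertices n \<tau>)"
proof -
  obtain g where "g \<in> carrier G" "lifted n (simplex_map n pr \<tau>) = simplex_map n (act g) \<tau>"
    using lifted_pr[OF assms] by blast
  then show ?thesis
    using quotients_mult[OF _ vertices_in[OF assms]] assms by (simp add: edges_def vertices_act)
qed

lemma edges_in: "singular_simplex n B \<sigma> \<Longrightarrow> edges n \<sigma> \<in> tuples (carrier G) n"
  unfolding edges_def by (intro quotients_in vertices_in lifted)

lemma edges_face:
  assumes \<sigma>: "singular_simplex (Suc n) B \<sigma>" and i: "i \<le> Suc n"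
  shows "edges n (singular_face (Suc n) i \<sigma>) = face (nerve G) (Suc n) i (edges (Suc n) \<sigma>)"
proof -
  let ?\<tau> = "lifted (Suc n) \<sigma>"
  have \<tau>: "singular_simplex (Suc n) E ?\<tau>" "simplex_map (Suc n) pr ?\<tau> = \<sigma>" by (rule lifted[OF \<sigma>])+
  have f: "singular_simplex n E (singular_face (Suc n) i ?\<tau>)"
    using singular_simplex_singular_face[OF \<tau>(1) _ i] by simp
  have "singular_face (Suc n) i \<sigma> = simplex_map n pr (singular_face (Suc n) i ?\<tau>)"
  proof -
    have "singular_face (Suc n) i (simplex_map (Suc n) pr ?\<tau>) = simplex_map n pr (singular_face (Suc n) i ?\<tau>)"
      using i by (fastforce simp add: singular_face_def simplex_map_def simplical_face_in_standard_simplex)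
    then show ?thesis by (simp only: \<tau>(2))
  qed
  then show ?thesis
    using edges_pr[OF f] vertices_face[OF \<tau>(1) i] quotients_face[OF vertices_in[OF \<tau>(1)] i]
    by (simp add: edges_def)
qed

end

section \<open>The universal bundle is a free cover of the classifying space\<close>

context group
begin

text \<open>Translation permutes the values of the step function.\<close>

lemma sojourn_mult:
  assumes a: "a \<in> carrier G" and g: "g \<in> carrier G" and hs: "hs \<in> tuples (carrier G) (Suc n)"
  shows "sojourn s (a \<otimes> g) ((n, map ((\<otimes>) a) hs), t) = sojourn s g ((n, hs), t)"
  unfolding sojourn_simp
proof (rule sum.cong)
  fix i assume "i \<in> {..n}"
  then have "i < length hs" "hs ! i \<in> carrier G" using hs by (auto simp: tuples_length intro: tuples_nth)
  then show "(if map ((\<otimes>) a) hs ! i = a \<otimes> g then min s (psum t (Suc i)) - min s (psum t i) else 0) =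
      (if hs ! i = g then min s (psum t (Suc i)) - min s (psum t i) else 0)"
    using a g by simp
qed simp

text \<open>If the step function of \<open>x\<close> has the value \<open>g0\<close> on \<open>[0, s)\<close>, then the points at which \<open>g0\<close> occupies more
  than half of \<open>[0, s)\<close> form a slice.\<close>

lemma EG_slice:
  assumes x: "x \<in> topspace (EG_space G)"
  shows "\<exists>W. openin (EG_space G) W \<and> x \<in> W \<and> (\<forall>g\<in>carrier G. g \<noteq> \<one> \<longrightarrow> EG_act G g ` W \<inter> W = {})"
proof -
  obtain n hs t where x': "x = cls (EG G) ((n, hs), t)" "hs \<in> tuples (carrier G) (Suc n)" "t \<in> standard_simplex n"
    using x by (rule EG_cases)
  define i where "i = (LEAST i. 0 < t i)"
  define s g0 where "s = t i" and "g0 = hs ! i"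
  have s: "0 < s" using least_pos[OF x'(3)] by (simp add: s_def i_def)
  have sojourn: "s / 2 < sojourn s g0 ((n, hs), t)"
    using sojourn_least(1)[OF x'(3), of s hs] s by (simp add: s_def i_def g0_def)
  have "i \<le> n"
    using sojourn_least(2)[OF x'(3), of s] s by (simp add: s_def i_def)
  then have g0: "g0 \<in> carrier G" using tuples_nth[OF x'(2), of i] by (simp add: g0_def)
  define W where "W = {e \<in> topspace (EG_space G). sojourn_cls s g0 e \<in> {s / 2<..}}"
  have "openin (EG_space G) W"
    unfolding W_def by (rule openin_continuous_map_preimage[OF continuous_map_sojourn_cls]) simp
  moreover have "x \<in> W" using x x' sojourn by (simp add: W_def sojourn_cls)
  moreover have "EG_act G a ` W \<inter> W = {}" if a: "a \<in> carrier G" "a \<noteq> \<one>" for a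
  proof (rule ccontr)
    assume "EG_act G a ` W \<inter> W \<noteq> {}"
    then obtain e where e: "e \<in> W" "EG_act G a e \<in> W" by blast
    then have "e \<in> topspace (EG_space G)" by (simp add: W_def)
    then obtain m ks u where e': "e = cls (EG G) ((m, ks), u)" "ks \<in> tuples (carrier G) (Suc m)" "u \<in> standard_simplex m"
      by (rule EG_cases)
    have "sojourn s g0 ((m, map ((\<otimes>) a) ks), u) = sojourn s (inv a \<otimes> g0) ((m, ks), u)"
      using sojourn_mult[of a "inv a \<otimes> g0" ks m s u] a g0 e' by (simp add: cancel_inv_left)
    then have "s / 2 < sojourn s g0 ((m, ks), u)" "s / 2 < sojourn s (inv a \<otimes> g0) ((m, ks), u)"
      using e a e'(1) by (simp_all add: W_def EG_act_cls sojourn_cls)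
    then have "g0 = inv a \<otimes> g0" by (rule sojourn_disjoint[OF e'(3) s])
    then have "inv a = \<one>" using a g0 by (metis inv_closed r_cancel_one')
    then show False using a by (metis inv_inv inv_one)
  qed
  ultimately show ?thesis by blast
qed

lemma first_value_closed:
  assumes "x \<in> topspace (EG_space G)"
  shows "first_value x \<in> carrier G"
proof -
  obtain n hs t where x': "x = cls (EG G) ((n, hs), t)" "hs \<in> tuples (carrier G) (Suc n)" "t \<in> standard_simplex n"
    using assms by (rule EG_cases)
  then show ?thesis
    using tuples_nth[OF x'(2)] sojourn_least(2)[OF x'(3) least_pos[OF x'(3)]] by (simp add: first_value_cls)
qed

lemma first_value_act:
  assumes "g \<in> carrier G" "x \<in> topspace (EG_space G)"
  shows "first_value (EG_act G g x) = g \<otimes> first_value x"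
proof -
  obtain n hs t where x': "x = cls (EG G) ((n, hs), t)" "hs \<in> tuples (carrier G) (Suc n)" "t \<in> standard_simplex n"
    using assms(2) by (rule EG_cases)
  then show ?thesis
    using assms(1) sojourn_least(2)[OF x'(3) least_pos[OF x'(3)]]
    by (simp add: first_value_cls EG_act_cls tuples_length less_Suc_eq_le)
qed

lemma free_cover_EG:
  "free_cover G (EG_space G) (classifying_space G) (EG_act G) (EG_proj G)"
proof unfold_locales
  fix g h x assume g: "g \<in> carrier G" and h: "h \<in> carrier G" and x: "x \<in> topspace (EG_space G)"
  obtain n hs t where x': "x = cls (EG G) ((n, hs), t)" "hs \<in> tuples (carrier G) (Suc n)"
    using x by (rule EG_cases)
  have "map ((\<otimes>) g) (map ((\<otimes>) h) hs) = map ((\<otimes>) (g \<otimes> h)) hs"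
    using x'(2) g h by (auto simp: tuples_def m_assoc)
  then show "EG_act G g (EG_act G h x) = EG_act G (g \<otimes> h) x"
    using g h x' by (simp add: EG_act_cls del: map_map)
next
  fix x assume x: "x \<in> topspace (EG_space G)"
  obtain n hs t where x': "x = cls (EG G) ((n, hs), t)" "hs \<in> tuples (carrier G) (Suc n)"
    using x by (rule EG_cases)
  have "map ((\<otimes>) \<one>) hs = hs" using x'(2) by (intro map_idI) (auto simp: tuples_def)
  then show "EG_act G \<one> x = x" using x' by (simp add: EG_act_cls)
next
  fix g x assume g: "g \<in> carrier G" and x: "x \<in> topspace (EG_space G)"
  obtain n hs t where x': "x = cls (EG G) ((n, hs), t)" "hs \<in> tuples (carrier G) (Suc n)"
    using x by (rule EG_cases)
  then show "EG_proj G (EG_act G g x) = EG_proj G x"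
    using g by (simp add: EG_act_cls EG_proj_cls quotients_mult)
qed (use EG_proj_eq EG_slice EG_proj_open EG_proj_surj continuous_map_realization_map[OF simplicial_map_mult]
      continuous_map_realization_map[OF simplicial_map_quotients] in \<open>simp_all add: classifying_space_def\<close>)

lemma free_cover_cells_EG:
  "free_cover_cells G (EG_space G) (classifying_space G) (EG_act G) (EG_proj G) first_value (cell (EG G))"
proof (rule free_cover_cells.intro[OF free_cover_EG], unfold_locales)
  fix hs n i assume hs: "hs \<in> tuples (carrier G) (Suc n)" and i: "i \<le> n"
  then show "first_value (cell (EG G) n hs (vert i)) = hs ! i"
    by (simp add: cell_def first_value_cls least_vert)
qed (auto simp: contractible_EG first_value_closed first_value_act singular_simplex_cell singular_face_cell
      simplex_map_cell simplicial_map_mult)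

sublocale EG: free_cover_cells G "EG_space G" "classifying_space G" "EG_act G" "EG_proj G" first_value "cell (EG G)"
  by (rule free_cover_cells_EG)

lemma edges_cell:
  assumes "gs \<in> tuples (carrier G) n"
  shows "EG.edges n (cell (nerve G) n gs) = gs"
proof -
  obtain hs where hs: "hs \<in> tuples (carrier G) (Suc n)" "quotients G hs = gs" using quotients_surj[OF assms] by blast
  have "cell (nerve G) n gs = simplex_map n (EG_proj G) (cell (EG G) n hs)"
    using simplex_map_cell[OF simplicial_map_quotients, of n hs] hs by simp
  then show ?thesis
    using EG.edges_pr[OF EG.ecell_simplex[OF hs(1)]] hs by (simp add: EG.vertices_ecell)
qed

lemma straighten_base_of:
  "EG.straighten_base n (frag_of \<sigma>) = frag_of (cell (nerve G) n (EG.edges n \<sigma>))"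
  by (simp add: EG.straighten_base_def EG.edges_def simplex_map_cell[OF simplicial_map_quotients])

end

section \<open>Modules of functions\<close>

text \<open>A ring as a module over itself.\<close>

definition self_module :: "('k, 'm) ring_scheme \<Rightarrow> ('k, 'k) module"
  where "self_module k = \<lparr>carrier = carrier k, mult = mult k, one = one k, zero = zero k, add = add k, smult = mult k\<rparr>"

lemma self_module_sel [simp]:
  "carrier (self_module k) = carrier k" "\<zero>\<^bsub>self_module k\<^esub> = \<zero>\<^bsub>k\<^esub>"
  "x \<oplus>\<^bsub>self_module k\<^esub> y = x \<oplus>\<^bsub>k\<^esub> y" "c \<odot>\<^bsub>self_module k\<^esub> x = c \<otimes>\<^bsub>k\<^esub> x"
  by (simp_all add: self_module_def)

lemma (in cring) module_self: "module R (self_module R)"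
proof (rule moduleI[OF is_cring])
  show "abelian_group (self_module R)"
    by (rule abelian_groupI) (auto simp: a_ac intro: l_neg)
qed (auto simp: l_distr r_distr m_assoc)

text \<open>A set of functions with pointwise operations, determined by their values on \<open>D\<close>, is a module as
  soon as it is closed under the operations.\<close>

lemma function_module:
  fixes k (structure) and N :: "('k, 'b, 'q) module_scheme" and M :: "('k, 'a \<Rightarrow> 'b, 'p) module_scheme"
  assumes N: "module k N"
    and val: "\<And>f x. \<lbrakk>f \<in> carrier M; x \<in> D\<rbrakk> \<Longrightarrow> f x \<in> carrier N"
    and ext: "\<And>f g. \<lbrakk>f \<in> carrier M; g \<in> carrier M; \<And>x. x \<in> D \<Longrightarrow> f x = g x\<rbrakk> \<Longrightarrow> f = g"
    and add: "\<And>f g. \<lbrakk>f \<in> carrier M; g \<in> carrier M\<rbrakk> \<Longrightarrow> f \<oplus>\<^bsub>M\<^esub> g \<in> carrier M"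
      "\<And>f g x. \<lbrakk>f \<in> carrier M; g \<in> carrier M; x \<in> D\<rbrakk> \<Longrightarrow> (f \<oplus>\<^bsub>M\<^esub> g) x = f x \<oplus>\<^bsub>N\<^esub> g x"
    and smult: "\<And>c f. \<lbrakk>c \<in> carrier k; f \<in> carrier M\<rbrakk> \<Longrightarrow> c \<odot>\<^bsub>M\<^esub> f \<in> carrier M"
      "\<And>c f x. \<lbrakk>c \<in> carrier k; f \<in> carrier M; x \<in> D\<rbrakk> \<Longrightarrow> (c \<odot>\<^bsub>M\<^esub> f) x = c \<odot>\<^bsub>N\<^esub> f x"
    and zero: "\<zero>\<^bsub>M\<^esub> \<in> carrier M" "\<And>x. x \<in> D \<Longrightarrow> \<zero>\<^bsub>M\<^esub> x = \<zero>\<^bsub>N\<^esub>"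
  shows "module k M"
proof -
  interpret N: module k N by (rule N)
  show ?thesis
  proof (rule moduleI)
    show "abelian_group M"
    proof (rule abelian_groupI)
      fix f assume f: "f \<in> carrier M"
      have m: "\<ominus> \<one> \<in> carrier k" by simp
      show "\<exists>g\<in>carrier M. g \<oplus>\<^bsub>M\<^esub> f = \<zero>\<^bsub>M\<^esub>"
      proof (rule bexI)
        show "\<ominus> \<one> \<odot>\<^bsub>M\<^esub> f \<in> carrier M" by (rule smult(1)[OF m f])
        show "\<ominus> \<one> \<odot>\<^bsub>M\<^esub> f \<oplus>\<^bsub>M\<^esub> f = \<zero>\<^bsub>M\<^esub>"
          by (rule ext) (simp_all add: add smult zero f val N.smult_l_minus N.M.l_neg)
      qed
    qed (auto intro!: ext simp: add zero val N.M.a_ac)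
  qed (auto intro!: ext simp: add smult zero val N.smult_l_distr N.smult_r_distr N.smult_assoc1 N.is_cring)
qed

section \<open>Linear maps, free modules and quotients\<close>

lemma linear_mapsD:
  assumes "f \<in> linear_maps k M N"
  shows "x \<in> carrier M \<Longrightarrow> f x \<in> carrier N"
    and "\<lbrakk>x \<in> carrier M; y \<in> carrier M\<rbrakk> \<Longrightarrow> f (x \<oplus>\<^bsub>M\<^esub> y) = f x \<oplus>\<^bsub>N\<^esub> f y"
    and "\<lbrakk>c \<in> carrier k; x \<in> carrier M\<rbrakk> \<Longrightarrow> f (c \<odot>\<^bsub>M\<^esub> x) = c \<odot>\<^bsub>N\<^esub> f x"
  using assms by (auto simp: linear_maps_def)

lemma linear_mapsI:
  assumes "\<And>x. x \<in> carrier M \<Longrightarrow> f x \<in> carrier N"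
    and "\<And>x y. \<lbrakk>x \<in> carrier M; y \<in> carrier M\<rbrakk> \<Longrightarrow> f (x \<oplus>\<^bsub>M\<^esub> y) = f x \<oplus>\<^bsub>N\<^esub> f y"
    and "\<And>c x. \<lbrakk>c \<in> carrier k; x \<in> carrier M\<rbrakk> \<Longrightarrow> f (c \<odot>\<^bsub>M\<^esub> x) = c \<odot>\<^bsub>N\<^esub> f x"
  shows "f \<in> linear_maps k M N"
  using assms by (auto simp: linear_maps_def)

lemma linear_maps_zero_minus:
  assumes M: "module k M" and N: "module k N" and f: "f \<in> linear_maps k M N"
  shows "f \<zero>\<^bsub>M\<^esub> = \<zero>\<^bsub>N\<^esub>"
    and "\<lbrakk>x \<in> carrier M; y \<in> carrier M\<rbrakk> \<Longrightarrow> f (x \<ominus>\<^bsub>M\<^esub> y) = f x \<ominus>\<^bsub>N\<^esub> f y"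
proof -
  interpret M: module k M by (rule M)
  interpret N: module k N by (rule N)
  note f = linear_mapsD[OF f]
  have "f (\<zero>\<^bsub>k\<^esub> \<odot>\<^bsub>M\<^esub> \<zero>\<^bsub>M\<^esub>) = \<zero>\<^bsub>k\<^esub> \<odot>\<^bsub>N\<^esub> f \<zero>\<^bsub>M\<^esub>" by (intro f) auto
  then show "f \<zero>\<^bsub>M\<^esub> = \<zero>\<^bsub>N\<^esub>" by (simp add: f)
  assume x: "x \<in> carrier M" and y: "y \<in> carrier M"
  have "\<ominus>\<^bsub>M\<^esub> y = (\<ominus>\<^bsub>k\<^esub> \<one>\<^bsub>k\<^esub>) \<odot>\<^bsub>M\<^esub> y" using y by (simp add: M.smult_l_minus)
  then have "f (\<ominus>\<^bsub>M\<^esub> y) = \<ominus>\<^bsub>N\<^esub> f y" using y by (simp add: f N.smult_l_minus)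
  then show "f (x \<ominus>\<^bsub>M\<^esub> y) = f x \<ominus>\<^bsub>N\<^esub> f y" using x y by (simp add: a_minus_def f)
qed

lemma free_module_iff:
  "x \<in> carrier (free_module k A) \<longleftrightarrow> (\<forall>a\<in>A. x a \<in> carrier k) \<and> (\<forall>a. a \<notin> A \<longrightarrow> x a = \<zero>\<^bsub>k\<^esub>) \<and> finite {a. x a \<noteq> \<zero>\<^bsub>k\<^esub>}"
  by (simp add: free_module_def)

lemma free_module_sel [simp]:
  "\<zero>\<^bsub>free_module k A\<^esub> = (\<lambda>a. \<zero>\<^bsub>k\<^esub>)"
  "x \<oplus>\<^bsub>free_module k A\<^esub> y = (\<lambda>a. x a \<oplus>\<^bsub>k\<^esub> y a)"
  "c \<odot>\<^bsub>free_module k A\<^esub> x = (\<lambda>a. c \<otimes>\<^bsub>k\<^esub> x a)"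
  by (simp_all add: free_module_def)

lemma group_ring_sel [simp]:
  "carrier (group_ring k G) = carrier (free_module k (carrier G))"
  "\<zero>\<^bsub>group_ring k G\<^esub> = (\<lambda>a. \<zero>\<^bsub>k\<^esub>)"
  "x \<oplus>\<^bsub>group_ring k G\<^esub> y = (\<lambda>a. x a \<oplus>\<^bsub>k\<^esub> y a)"
  "c \<odot>\<^bsub>group_ring k G\<^esub> x = (\<lambda>a. c \<otimes>\<^bsub>k\<^esub> x a)"
  by (simp_all add: group_ring_def free_module_def)

context cring
begin

lemma free_add_closed:
  assumes "x \<in> carrier (free_module R A)" "y \<in> carrier (free_module R A)"
  shows "(\<lambda>a. x a \<oplus> y a) \<in> carrier (free_module R A)"
proof -
  have "{a. x a \<oplus> y a \<noteq> \<zero>} \<subseteq> {a. x a \<noteq> \<zero>} \<union> {a. y a \<noteq> \<zero>}" by auto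
  then have "finite {a. x a \<oplus> y a \<noteq> \<zero>}" using assms by (auto simp: free_module_iff intro: finite_subset)
  then show ?thesis using assms by (auto simp: free_module_iff)
qed

lemma free_smult_closed:
  assumes "c \<in> carrier R" "x \<in> carrier (free_module R A)"
  shows "(\<lambda>a. c \<otimes> x a) \<in> carrier (free_module R A)"
proof -
  have "{a. c \<otimes> x a \<noteq> \<zero>} \<subseteq> {a. x a \<noteq> \<zero>}" using assms by auto
  then have "finite {a. c \<otimes> x a \<noteq> \<zero>}" using assms by (auto simp: free_module_iff intro: finite_subset)
  then show ?thesis using assms by (auto simp: free_module_iff)
qed

lemma free_val: "x \<in> carrier (free_module R A) \<Longrightarrow> x a \<in> carrier R"
  by (cases "a \<in> A") (auto simp: free_module_iff)

lemma free_zero: "(\<lambda>_. \<zero>) \<in> carrier (free_module R A)"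
  by (simp add: free_module_iff)

lemma module_free: "module R (free_module R A)"
proof (rule function_module[OF module_self, where D = UNIV])
  show "f \<oplus>\<^bsub>free_module R A\<^esub> g \<in> carrier (free_module R A)"
    if "f \<in> carrier (free_module R A)" "g \<in> carrier (free_module R A)" for f g
    using free_add_closed[OF that] by simp
  show "c \<odot>\<^bsub>free_module R A\<^esub> f \<in> carrier (free_module R A)"
    if "c \<in> carrier R" "f \<in> carrier (free_module R A)" for c f
    using free_smult_closed[OF that] by simp
qed (use free_val free_zero in \<open>simp_all add: fun_eq_iff\<close>)

lemma module_group_ring: "module R (group_ring R G)"
proof (rule function_module[OF module_self, where D = UNIV])
  show "f \<oplus>\<^bsub>group_ring R G\<^esub> g \<in> carrier (group_ring R G)"
    if "f \<in> carrier (group_ring R G)" "g \<in> carrier (group_ring R G)" for f g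
    using free_add_closed that by simp
  show "c \<odot>\<^bsub>group_ring R G\<^esub> f \<in> carrier (group_ring R G)"
    if "c \<in> carrier R" "f \<in> carrier (group_ring R G)" for c f
    using free_smult_closed that by simp
qed (use free_val free_zero in \<open>simp_all add: fun_eq_iff\<close>)

lemma basis_elt_in: "a \<in> A \<Longrightarrow> basis_elt R a \<in> carrier (free_module R A)"
  by (auto simp: basis_elt_def free_module_iff)

lemma linear_maps_free_eq:
  assumes M: "module R M" and f: "f \<in> linear_maps R (free_module R A) M" and g: "g \<in> linear_maps R (free_module R A) M"
    and eq: "\<And>a. a \<in> A \<Longrightarrow> f (basis_elt R a) = g (basis_elt R a)"
    and x: "x \<in> carrier (free_module R A)"
  shows "f x = g x"
proof -
  have "f x = g x" if "finite F" "x \<in> carrier (free_module R A)" "{a. x a \<noteq> \<zero>} \<subseteq> F" for F x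
    using that
  proof (induction F arbitrary: x rule: finite_induct)
    case empty
    then have "x = \<zero>\<^bsub>free_module R A\<^esub>" by auto
    then show ?case
      using linear_maps_zero_minus(1)[OF module_free M f] linear_maps_zero_minus(1)[OF module_free M g]
      by (simp del: free_module_sel)
  next
    case (insert a F)
    show ?case
    proof (cases "a \<in> A")
      case False
      then have "{b. x b \<noteq> \<zero>} \<subseteq> F" using insert.prems by (auto simp: free_module_iff)
      then show ?thesis using insert.IH insert.prems by blast
    next
      case True
      define y where "y = x(a := \<zero>)"
      have "{b. y b \<noteq> \<zero>} \<subseteq> {b. x b \<noteq> \<zero>}" by (auto simp: y_def)
      then have y: "y \<in> carrier (free_module R A)" using insert.prems True
        by (auto simp: y_def free_module_iff intro: finite_subset)
      have "{b. y b \<noteq> \<zero>} \<subseteq> F" using insert.prems by (auto simp: y_def)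
      then have IH: "f y = g y" using insert.IH y by blast
      have xa: "x a \<in> carrier R" by (rule free_val[OF insert.prems(1)])
      have "x = y \<oplus>\<^bsub>free_module R A\<^esub> x a \<odot>\<^bsub>free_module R A\<^esub> basis_elt R a"
        using free_val[OF insert.prems(1)] xa by (auto simp: y_def basis_elt_def fun_eq_iff)
      moreover have "x a \<odot>\<^bsub>free_module R A\<^esub> basis_elt R a \<in> carrier (free_module R A)"
        using free_smult_closed[OF xa basis_elt_in[OF True]] by simp
      ultimately have "f x = f y \<oplus>\<^bsub>M\<^esub> x a \<odot>\<^bsub>M\<^esub> f (basis_elt R a)" "g x = g y \<oplus>\<^bsub>M\<^esub> x a \<odot>\<^bsub>M\<^esub> g (basis_elt R a)"
        using linear_mapsD(2,3)[OF f] linear_mapsD(2,3)[OF g] y xa basis_elt_in[OF True] by metis+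
      then show ?thesis using IH eq[OF True] by simp
    qed
  qed
  then show ?thesis using x by (auto simp: free_module_iff)
qed

end

text \<open>The linear map on a free module with values \<open>w\<close> on the basis.\<close>

definition linear_extension ::
  "('k, 'm) ring_scheme \<Rightarrow> ('k, 'b, 'q) module_scheme \<Rightarrow> ('a \<Rightarrow> 'b) \<Rightarrow> ('a \<Rightarrow> 'k) \<Rightarrow> 'b"
  where "linear_extension k M w x = (\<Oplus>\<^bsub>M\<^esub>a\<in>{a. x a \<noteq> \<zero>\<^bsub>k\<^esub>}. x a \<odot>\<^bsub>M\<^esub> w a)"

context module
begin

lemma linear_extension_eq:
  assumes x: "x \<in> carrier (free_module R A)" and w: "w \<in> A \<rightarrow> carrier M"
    and F: "finite F" "{a. x a \<noteq> \<zero>} \<subseteq> F" "F \<subseteq> A"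
  shows "linear_extension R M w x = (\<Oplus>\<^bsub>M\<^esub>a\<in>F. x a \<odot>\<^bsub>M\<^esub> w a)"
  unfolding linear_extension_def
proof (rule M.add.finprod_mono_neutral_cong_left)
  show "\<And>i. i \<in> F - {a. x a \<noteq> \<zero>} \<Longrightarrow> x i \<odot>\<^bsub>M\<^esub> w i = \<zero>\<^bsub>M\<^esub>"
    using w F by (auto simp: Pi_iff subset_iff)
  show "(\<lambda>a. x a \<odot>\<^bsub>M\<^esub> w a) \<in> F \<rightarrow> carrier M"
    using w F R.free_val[OF x] by (auto simp: Pi_iff subset_iff)
qed (use F in auto)

lemma smult_commute:
  "\<lbrakk>c \<in> carrier R; d \<in> carrier R; y \<in> carrier M\<rbrakk> \<Longrightarrow> c \<odot>\<^bsub>M\<^esub> (d \<odot>\<^bsub>M\<^esub> y) = d \<odot>\<^bsub>M\<^esub> (c \<odot>\<^bsub>M\<^esub> y)"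
  by (metis R.m_comm smult_assoc1)

lemma support_subset: "x \<in> carrier (free_module R A) \<Longrightarrow> {a. x a \<noteq> \<zero>} \<subseteq> A"
  by (auto simp: free_module_iff)

lemma linear_extension_linear:
  assumes w: "w \<in> A \<rightarrow> carrier M"
  shows "linear_extension R M w \<in> linear_maps R (free_module R A) M"
proof (rule linear_mapsI)
  fix x assume x: "x \<in> carrier (free_module R A)"
  then have f: "finite {a. x a \<noteq> \<zero>}" by (simp add: free_module_iff)
  show "linear_extension R M w x \<in> carrier M"
    using R.free_val[OF x] w support_subset[OF x] unfolding linear_extension_def
    by (intro M.finsum_closed) (auto simp: Pi_iff subset_iff intro!: smult_closed)
  fix c assume c: "c \<in> carrier R"
  have cx: "(\<lambda>a. c \<otimes> x a) \<in> carrier (free_module R A)" by (rule R.free_smult_closed[OF c x])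
  have "{a. c \<otimes> x a \<noteq> \<zero>} \<subseteq> {a. x a \<noteq> \<zero>}" using c by auto
  then have "linear_extension R M w (\<lambda>a. c \<otimes> x a) = (\<Oplus>\<^bsub>M\<^esub>a\<in>{a. x a \<noteq> \<zero>}. (c \<otimes> x a) \<odot>\<^bsub>M\<^esub> w a)"
    by (rule linear_extension_eq[OF cx w f _ support_subset[OF x]])
  also have "\<dots> = (\<Oplus>\<^bsub>M\<^esub>a\<in>{a. x a \<noteq> \<zero>}. c \<odot>\<^bsub>M\<^esub> (x a \<odot>\<^bsub>M\<^esub> w a))"
    using c R.free_val[OF x] w support_subset[OF x]
    by (intro M.finsum_cong') (auto simp: smult_assoc1 Pi_iff subset_iff intro!: smult_closed)
  also have "\<dots> = c \<odot>\<^bsub>M\<^esub> linear_extension R M w x"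
    unfolding linear_extension_def using c R.free_val[OF x] w support_subset[OF x] f
    by (intro finsum_smult_ldistr[symmetric]) (auto simp: Pi_iff subset_iff intro!: smult_closed)
  finally show "linear_extension R M w (c \<odot>\<^bsub>free_module R A\<^esub> x) = c \<odot>\<^bsub>M\<^esub> linear_extension R M w x" by simp
next
  fix x y assume x: "x \<in> carrier (free_module R A)" and y: "y \<in> carrier (free_module R A)"
  let ?F = "{a. x a \<noteq> \<zero>} \<union> {a. y a \<noteq> \<zero>}"
  have F: "finite ?F" "?F \<subseteq> A" using x y support_subset by (auto simp: free_module_iff)
  have "{a. x a \<oplus> y a \<noteq> \<zero>} \<subseteq> ?F" by auto
  then have "linear_extension R M w (\<lambda>a. x a \<oplus> y a) = (\<Oplus>\<^bsub>M\<^esub>a\<in>?F. (x a \<oplus> y a) \<odot>\<^bsub>M\<^esub> w a)"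
    by (rule linear_extension_eq[OF R.free_add_closed[OF x y] w F(1) _ F(2)])
  also have "\<dots> = (\<Oplus>\<^bsub>M\<^esub>a\<in>?F. x a \<odot>\<^bsub>M\<^esub> w a \<oplus>\<^bsub>M\<^esub> y a \<odot>\<^bsub>M\<^esub> w a)"
    using R.free_val[OF x] R.free_val[OF y] w F(2)
    by (intro M.finsum_cong') (auto simp: smult_l_distr Pi_iff subset_iff intro!: smult_closed)
  also have "\<dots> = (\<Oplus>\<^bsub>M\<^esub>a\<in>?F. x a \<odot>\<^bsub>M\<^esub> w a) \<oplus>\<^bsub>M\<^esub> (\<Oplus>\<^bsub>M\<^esub>a\<in>?F. y a \<odot>\<^bsub>M\<^esub> w a)"
    using R.free_val[OF x] R.free_val[OF y] w F(2)
    by (intro M.finsum_addf) (auto simp: Pi_iff subset_iff intro!: smult_closed)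
  also have "\<dots> = linear_extension R M w x \<oplus>\<^bsub>M\<^esub> linear_extension R M w y"
    using linear_extension_eq[OF x w F(1) _ F(2)] linear_extension_eq[OF y w F(1) _ F(2)] by simp
  finally show "linear_extension R M w (x \<oplus>\<^bsub>free_module R A\<^esub> y) = linear_extension R M w x \<oplus>\<^bsub>M\<^esub> linear_extension R M w y"
    by simp
qed

lemma linear_extension_basis:
  assumes "w \<in> A \<rightarrow> carrier M" "a \<in> A"
  shows "linear_extension R M w (basis_elt R a) = w a"
proof -
  have "linear_extension R M w (basis_elt R a) = (\<Oplus>\<^bsub>M\<^esub>b\<in>{a}. basis_elt R a b \<odot>\<^bsub>M\<^esub> w b)"
    by (rule linear_extension_eq[OF R.basis_elt_in[OF assms(2)] assms(1)]) (use assms in \<open>auto simp: basis_elt_def\<close>)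
  also have "\<dots> = w a" using assms by (auto simp: basis_elt_def Pi_iff)
  finally show ?thesis .
qed

lemma linear_extension_add:
  assumes x: "x \<in> carrier (free_module R A)" and w: "w \<in> A \<rightarrow> carrier M" and w': "w' \<in> A \<rightarrow> carrier M"
  shows "linear_extension R M (\<lambda>a. w a \<oplus>\<^bsub>M\<^esub> w' a) x = linear_extension R M w x \<oplus>\<^bsub>M\<^esub> linear_extension R M w' x"
proof -
  note s = subsetD[OF support_subset[OF x]]
  have "(\<Oplus>\<^bsub>M\<^esub>a\<in>{a. x a \<noteq> \<zero>}. x a \<odot>\<^bsub>M\<^esub> (w a \<oplus>\<^bsub>M\<^esub> w' a)) =
      (\<Oplus>\<^bsub>M\<^esub>a\<in>{a. x a \<noteq> \<zero>}. x a \<odot>\<^bsub>M\<^esub> w a \<oplus>\<^bsub>M\<^esub> x a \<odot>\<^bsub>M\<^esub> w' a)"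
    using R.free_val[OF x] w w' s
    by (intro M.finsum_cong') (auto simp: smult_r_distr Pi_iff intro!: smult_closed)
  also have "\<dots> = linear_extension R M w x \<oplus>\<^bsub>M\<^esub> linear_extension R M w' x"
    unfolding linear_extension_def using R.free_val[OF x] w w' s
    by (intro M.finsum_addf) (auto simp: Pi_iff intro!: smult_closed)
  finally show ?thesis by (simp add: linear_extension_def)
qed

lemma linear_extension_smult:
  assumes x: "x \<in> carrier (free_module R A)" and w: "w \<in> A \<rightarrow> carrier M" and c: "c \<in> carrier R"
  shows "linear_extension R M (\<lambda>a. c \<odot>\<^bsub>M\<^esub> w a) x = c \<odot>\<^bsub>M\<^esub> linear_extension R M w x"
proof -
  note s = subsetD[OF support_subset[OF x]]
  have f: "finite {a. x a \<noteq> \<zero>}" using x by (simp add: free_module_iff)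
  have "(\<Oplus>\<^bsub>M\<^esub>a\<in>{a. x a \<noteq> \<zero>}. x a \<odot>\<^bsub>M\<^esub> (c \<odot>\<^bsub>M\<^esub> w a)) = (\<Oplus>\<^bsub>M\<^esub>a\<in>{a. x a \<noteq> \<zero>}. c \<odot>\<^bsub>M\<^esub> (x a \<odot>\<^bsub>M\<^esub> w a))"
    using R.free_val[OF x] w s c
    by (intro M.finsum_cong') (auto simp: Pi_iff intro!: smult_closed smult_commute)
  also have "\<dots> = c \<odot>\<^bsub>M\<^esub> linear_extension R M w x"
    unfolding linear_extension_def using R.free_val[OF x] w s c f
    by (intro finsum_smult_ldistr[symmetric]) (auto simp: Pi_iff intro!: smult_closed)
  finally show ?thesis by (simp add: linear_extension_def)
qed

lemma linear_extension_cong: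
  assumes "x \<in> carrier (free_module R A)" "w \<in> A \<rightarrow> carrier M" "\<And>a. a \<in> A \<Longrightarrow> w' a = w a"
  shows "linear_extension R M w' x = linear_extension R M w x"
  unfolding linear_extension_def using subsetD[OF support_subset[OF assms(1)]] assms R.free_val[OF assms(1)]
  by (intro M.finsum_cong') (auto simp: Pi_iff intro!: smult_closed)

end

context module
begin

lemma r_coset_mem: "y \<in> N +>\<^bsub>M\<^esub> x \<longleftrightarrow> (\<exists>h\<in>N. y = h \<oplus>\<^bsub>M\<^esub> x)"
  by (auto simp: a_r_coset_def')

text \<open>Cosets and the quotient by a fixed submodule.\<close>

context
  fixes N assumes N: "submodule N R M"
begin

lemma submodule_subset: "N \<subseteq> carrier M"
  by (rule submoduleE(1)[OF N])

lemma submodule_zero: "\<zero>\<^bsub>M\<^esub> \<in> N"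
proof -
  obtain h where h: "h \<in> N" using submoduleE(2)[OF N] by blast
  then show ?thesis using submoduleE(4)[OF N, of \<zero> h] submodule_subset by auto
qed

lemma coset_self: "x \<in> carrier M \<Longrightarrow> x \<in> N +>\<^bsub>M\<^esub> x"
  using submodule_zero by (auto simp: r_coset_mem intro!: bexI[of _ "\<zero>\<^bsub>M\<^esub>"])

lemma coset_eq_iff:
  assumes x: "x \<in> carrier M" and y: "y \<in> carrier M"
  shows "N +>\<^bsub>M\<^esub> x = N +>\<^bsub>M\<^esub> y \<longleftrightarrow> (\<exists>h\<in>N. x = h \<oplus>\<^bsub>M\<^esub> y)"
proof
  assume "N +>\<^bsub>M\<^esub> x = N +>\<^bsub>M\<^esub> y"
  then show "\<exists>h\<in>N. x = h \<oplus>\<^bsub>M\<^esub> y" using coset_self[OF x] by (simp add: r_coset_mem)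
next
  assume "\<exists>h\<in>N. x = h \<oplus>\<^bsub>M\<^esub> y"
  then obtain h where h: "h \<in> N" "x = h \<oplus>\<^bsub>M\<^esub> y" by blast
  have hM: "h \<in> carrier M" using h submodule_subset by blast
  show "N +>\<^bsub>M\<^esub> x = N +>\<^bsub>M\<^esub> y"
  proof (intro equalityI subsetI)
    fix z assume "z \<in> N +>\<^bsub>M\<^esub> x"
    then obtain h' where "h' \<in> N" "z = h' \<oplus>\<^bsub>M\<^esub> x" by (auto simp: r_coset_mem)
    then have "h' \<oplus>\<^bsub>M\<^esub> h \<in> N" "z = (h' \<oplus>\<^bsub>M\<^esub> h) \<oplus>\<^bsub>M\<^esub> y"
      using h hM y submoduleE(5)[OF N] submodule_subset by (auto simp: M.a_assoc subset_iff)
    then show "z \<in> N +>\<^bsub>M\<^esub> y" by (auto simp: r_coset_mem)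
  next
    fix z assume "z \<in> N +>\<^bsub>M\<^esub> y"
    then obtain h' where h': "h' \<in> N" "z = h' \<oplus>\<^bsub>M\<^esub> y" by (auto simp: r_coset_mem)
    then have "h' \<in> carrier M" using submodule_subset by blast
    then have "z = (h' \<oplus>\<^bsub>M\<^esub> \<ominus>\<^bsub>M\<^esub> h) \<oplus>\<^bsub>M\<^esub> x"
      using h h' hM y by (simp add: M.a_assoc) (simp add: M.a_assoc[symmetric] M.l_neg)
    moreover have "h' \<oplus>\<^bsub>M\<^esub> \<ominus>\<^bsub>M\<^esub> h \<in> N" using h h' submoduleE(3,5)[OF N] by blast
    ultimately show "z \<in> N +>\<^bsub>M\<^esub> x" by (auto simp: r_coset_mem)
  qed
qed

lemma coset_add:
  assumes x: "x \<in> carrier M" and y: "y \<in> carrier M"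
  shows "(N +>\<^bsub>M\<^esub> x) <+>\<^bsub>M\<^esub> (N +>\<^bsub>M\<^esub> y) = N +>\<^bsub>M\<^esub> (x \<oplus>\<^bsub>M\<^esub> y)"
proof (intro equalityI subsetI)
  fix z assume "z \<in> (N +>\<^bsub>M\<^esub> x) <+>\<^bsub>M\<^esub> (N +>\<^bsub>M\<^esub> y)"
  then obtain h h' where h: "h \<in> N" "h' \<in> N" "z = (h \<oplus>\<^bsub>M\<^esub> x) \<oplus>\<^bsub>M\<^esub> (h' \<oplus>\<^bsub>M\<^esub> y)"
    by (auto simp: set_add_def' r_coset_mem)
  then have "z = (h \<oplus>\<^bsub>M\<^esub> h') \<oplus>\<^bsub>M\<^esub> (x \<oplus>\<^bsub>M\<^esub> y)"
    using x y submodule_subset by (auto simp: M.a_ac subset_iff)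
  then show "z \<in> N +>\<^bsub>M\<^esub> (x \<oplus>\<^bsub>M\<^esub> y)" using h submoduleE(5)[OF N] by (auto simp: r_coset_mem)
next
  fix z assume "z \<in> N +>\<^bsub>M\<^esub> (x \<oplus>\<^bsub>M\<^esub> y)"
  then obtain h where h: "h \<in> N" "z = h \<oplus>\<^bsub>M\<^esub> (x \<oplus>\<^bsub>M\<^esub> y)" by (auto simp: r_coset_mem)
  then have "z = (h \<oplus>\<^bsub>M\<^esub> x) \<oplus>\<^bsub>M\<^esub> (\<zero>\<^bsub>M\<^esub> \<oplus>\<^bsub>M\<^esub> y)" using x y submodule_subset by (auto simp: M.a_assoc subset_iff)
  moreover have "h \<oplus>\<^bsub>M\<^esub> x \<in> N +>\<^bsub>M\<^esub> x" "\<zero>\<^bsub>M\<^esub> \<oplus>\<^bsub>M\<^esub> y \<in> N +>\<^bsub>M\<^esub> y"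
    unfolding r_coset_mem using h submodule_zero by blast+
  ultimately show "z \<in> (N +>\<^bsub>M\<^esub> x) <+>\<^bsub>M\<^esub> (N +>\<^bsub>M\<^esub> y)" unfolding set_add_def' by blast
qed

lemma coset_absorb: "x \<in> carrier M \<Longrightarrow> N <+>\<^bsub>M\<^esub> (N +>\<^bsub>M\<^esub> x) = N +>\<^bsub>M\<^esub> x"
  using coset_add[of "\<zero>\<^bsub>M\<^esub>" x] submodule_subset by simp

lemma image_coset_absorb:
  assumes f: "\<And>h. h \<in> K \<Longrightarrow> f (h \<oplus>\<^bsub>L\<^esub> x) \<in> N +>\<^bsub>M\<^esub> f x" and x: "x \<in> K +>\<^bsub>L\<^esub> x" and fx: "f x \<in> carrier M"
  shows "N <+>\<^bsub>M\<^esub> (f ` (K +>\<^bsub>L\<^esub> x)) = N +>\<^bsub>M\<^esub> f x"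
proof (intro equalityI subsetI)
  fix z assume "z \<in> N <+>\<^bsub>M\<^esub> (f ` (K +>\<^bsub>L\<^esub> x))"
  then obtain h y where h: "h \<in> N" "y \<in> K +>\<^bsub>L\<^esub> x" "z = h \<oplus>\<^bsub>M\<^esub> f y" by (auto simp: set_add_def')
  then have "f y \<in> N +>\<^bsub>M\<^esub> f x" using f by (auto simp: a_r_coset_def')
  then have "z \<in> N <+>\<^bsub>M\<^esub> (N +>\<^bsub>M\<^esub> f x)" using h by (auto simp: set_add_def')
  then show "z \<in> N +>\<^bsub>M\<^esub> f x" by (simp add: coset_absorb fx)
next
  fix z assume "z \<in> N +>\<^bsub>M\<^esub> f x"
  then show "z \<in> N <+>\<^bsub>M\<^esub> (f ` (K +>\<^bsub>L\<^esub> x))" using x by (auto simp: r_coset_mem set_add_def')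
qed

lemma coset_smult:
  assumes c: "c \<in> carrier R" and x: "x \<in> carrier M"
  shows "N <+>\<^bsub>M\<^esub> ((\<lambda>x. c \<odot>\<^bsub>M\<^esub> x) ` (N +>\<^bsub>M\<^esub> x)) = N +>\<^bsub>M\<^esub> (c \<odot>\<^bsub>M\<^esub> x)"
proof (rule image_coset_absorb)
  fix h assume h: "h \<in> N"
  then show "c \<odot>\<^bsub>M\<^esub> (h \<oplus>\<^bsub>M\<^esub> x) \<in> N +>\<^bsub>M\<^esub> (c \<odot>\<^bsub>M\<^esub> x)"
    using c x submodule_subset submoduleE(4)[OF N c h] by (auto simp: r_coset_mem smult_r_distr subset_iff)
qed (use c x coset_self in auto)

lemma carrier_quotient_module: "X \<in> carrier (quotient_module M N) \<longleftrightarrow> (\<exists>x\<in>carrier M. X = N +>\<^bsub>M\<^esub> x)"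
  by (auto simp: quotient_module_def A_RCOSETS_def')

lemma quotient_module_ops:
  "\<lbrakk>x \<in> carrier M; y \<in> carrier M\<rbrakk> \<Longrightarrow> (N +>\<^bsub>M\<^esub> x) \<oplus>\<^bsub>quotient_module M N\<^esub> (N +>\<^bsub>M\<^esub> y) = N +>\<^bsub>M\<^esub> (x \<oplus>\<^bsub>M\<^esub> y)"
  "\<lbrakk>c \<in> carrier R; x \<in> carrier M\<rbrakk> \<Longrightarrow> c \<odot>\<^bsub>quotient_module M N\<^esub> (N +>\<^bsub>M\<^esub> x) = N +>\<^bsub>M\<^esub> (c \<odot>\<^bsub>M\<^esub> x)"
  by (simp_all add: quotient_module_def coset_add coset_smult)

lemma quotient_map_linear: "(\<lambda>x. N +>\<^bsub>M\<^esub> x) \<in> linear_maps R M (quotient_module M N)"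
  by (rule linear_mapsI) (auto simp: carrier_quotient_module quotient_module_ops)

lemma linear_map_from_quotient:
  assumes L: "module R L" and \<phi>: "\<phi> \<in> linear_maps R M L" and ker: "\<And>h. h \<in> N \<Longrightarrow> \<phi> h = \<zero>\<^bsub>L\<^esub>"
  shows "\<exists>f\<in>linear_maps R (quotient_module M N) L. \<forall>x\<in>carrier M. f (N +>\<^bsub>M\<^esub> x) = \<phi> x"
proof -
  interpret L: module R L by (rule L)
  define f where "f X = \<phi> (SOME y. y \<in> X)" for X
  have f: "f (N +>\<^bsub>M\<^esub> x) = \<phi> x" if x: "x \<in> carrier M" for x
  proof -
    define y where "y = (SOME y. y \<in> N +>\<^bsub>M\<^esub> x)"
    have "y \<in> N +>\<^bsub>M\<^esub> x" unfolding y_def by (rule someI) (rule coset_self[OF x])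
    then obtain h where h: "h \<in> N" "y = h \<oplus>\<^bsub>M\<^esub> x" by (auto simp: r_coset_mem)
    have "\<phi> y = \<phi> h \<oplus>\<^bsub>L\<^esub> \<phi> x" using h x submodule_subset by (auto intro!: linear_mapsD(2)[OF \<phi>])
    also have "\<dots> = \<phi> x" using h ker linear_mapsD(1)[OF \<phi> x] by simp
    finally show ?thesis by (simp add: f_def y_def)
  qed
  moreover have "f \<in> linear_maps R (quotient_module M N) L"
    by (rule linear_mapsI)
      (auto simp: carrier_quotient_module quotient_module_ops f linear_mapsD[OF \<phi>])
  ultimately show ?thesis by blast
qed

end

lemma submodule_span:
  assumes S: "S \<subseteq> carrier M"
  shows "submodule (submodule_span R M S) R M"
proof (rule submoduleI)
  have M: "carrier M \<in> {N. submodule N R M \<and> S \<subseteq> N}" using carrier_is_submodule S by simp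
  then show "submodule_span R M S \<subseteq> carrier M" unfolding submodule_span_def by blast
qed (auto simp: submodule_span_def submodule_zero intro: submoduleE)

lemma submodule_span_least: "\<lbrakk>submodule N R M; S \<subseteq> N\<rbrakk> \<Longrightarrow> submodule_span R M S \<subseteq> N"
  by (auto simp: submodule_span_def)

lemma submodule_span_superset: "S \<subseteq> submodule_span R M S"
  by (auto simp: submodule_span_def)

lemma submodule_kernel:
  assumes L: "module R L" and \<phi>: "\<phi> \<in> linear_maps R M L"
  shows "submodule {x \<in> carrier M. \<phi> x = \<zero>\<^bsub>L\<^esub>} R M"
proof -
  interpret L: module R L by (rule L)
  have "\<phi> (\<ominus>\<^bsub>M\<^esub> a) = \<ominus>\<^bsub>L\<^esub> \<phi> a" if "a \<in> carrier M" for a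
    using linear_maps_zero_minus(2)[OF module_axioms L \<phi> M.zero_closed that] that linear_mapsD(1)[OF \<phi> that]
      linear_maps_zero_minus(1)[OF module_axioms L \<phi>]
    by (simp add: a_minus_def)
  then show ?thesis
    by (intro submoduleI) (auto simp: linear_mapsD[OF \<phi>] linear_maps_zero_minus(1)[OF module_axioms L \<phi>])
qed

end

lemma module_hom_module:
  fixes M :: "('k, 'a, 'p) module_scheme"
  assumes L: "module k L"
    and closed: "\<And>x y. \<lbrakk>x \<in> carrier M; y \<in> carrier M\<rbrakk> \<Longrightarrow> x \<oplus>\<^bsub>M\<^esub> y \<in> carrier M"
      "\<And>c x. \<lbrakk>c \<in> carrier k; x \<in> carrier M\<rbrakk> \<Longrightarrow> c \<odot>\<^bsub>M\<^esub> x \<in> carrier M"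
  shows "module k (hom_module k M L)"
proof -
  interpret L: module k L by (rule L)
  show ?thesis
  proof (rule function_module[OF L, where D = "carrier M"])
    fix f g assume "f \<in> carrier (hom_module k M L)" "g \<in> carrier (hom_module k M L)" "\<And>x. x \<in> carrier M \<Longrightarrow> f x = g x"
    then show "f = g" by (intro extensionalityI[of f "carrier M" g]) (auto simp: hom_module_def)
  qed (auto simp: hom_module_def linear_maps_def Pi_iff closed L.M.a_ac L.smult_r_distr intro: L.smult_commute)
qed

section \<open>Cochains are determined by their values on group elements\<close>

text \<open>The multilinear map on \<open>n\<close>-tuples of elements of a free module with values \<open>v\<close> on tuples of basis
  elements, obtained by linear extension in one variable after the other.\<close>

primrec multilinear_extension ::
  "('k, 'm) ring_scheme \<Rightarrow> ('k, 'b, 'q) module_scheme \<Rightarrow> ('a list \<Rightarrow> 'b) \<Rightarrow> ('a \<Rightarrow> 'k) list \<Rightarrow> 'b"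
  where "multilinear_extension k M v [] = v []"
  | "multilinear_extension k M v (x # xs) =
      linear_extension k M (\<lambda>a. multilinear_extension k M (\<lambda>as. v (a # as)) xs) x"

lemma tuples_0 [simp]: "tuples A 0 = {[]}"
  by (auto simp: tuples_def)

lemma tuples_Cons [simp]: "x # xs \<in> tuples A n \<longleftrightarrow> (\<exists>m. n = Suc m \<and> x \<in> A \<and> xs \<in> tuples A m)"
  by (auto simp: tuples_def)

lemma tuples_SucE:
  assumes "xs \<in> tuples A (Suc n)"
  obtains y ys where "xs = y # ys" "y \<in> A" "ys \<in> tuples A n"
  using assms by (cases xs) (auto simp: tuples_def)

context module
begin

lemma multilinear_extension_closed:
  assumes "xs \<in> tuples (carrier (free_module R A)) n" "v \<in> tuples A n \<rightarrow> carrier M"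
  shows "multilinear_extension R M v xs \<in> carrier M"
  using assms
proof (induction n arbitrary: xs v)
  case (Suc n)
  from Suc.prems(1) obtain y ys where xs: "xs = y # ys" "y \<in> carrier (free_module R A)" "ys \<in> tuples (carrier (free_module R A)) n"
    by (rule tuples_SucE)
  have "(\<lambda>a. multilinear_extension R M (\<lambda>as. v (a # as)) ys) \<in> A \<rightarrow> carrier M"
    using Suc xs by (auto simp: Pi_iff)
  from linear_mapsD(1)[OF linear_extension_linear[OF this] xs(2)] show ?case by (simp add: xs(1))
qed auto

lemma multilinear_extension_slot:
  assumes "xs \<in> tuples (carrier (free_module R A)) n" "v \<in> tuples A n \<rightarrow> carrier M" "i < n"
  shows "(\<lambda>y. multilinear_extension R M v (xs[i := y])) \<in> linear_maps R (free_module R A) M"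
  using assms
proof (induction n arbitrary: xs v i)
  case (Suc n)
  from Suc.prems(1) obtain y ys where xs: "xs = y # ys" "y \<in> carrier (free_module R A)" "ys \<in> tuples (carrier (free_module R A)) n"
    by (rule tuples_SucE)
  have w: "(\<lambda>a. multilinear_extension R M (\<lambda>as. v (a # as)) ys) \<in> A \<rightarrow> carrier M"
    if "ys \<in> tuples (carrier (free_module R A)) n" for ys
    using Suc.prems multilinear_extension_closed[OF that] by (auto simp: Pi_iff)
  show ?case
  proof (cases i)
    case 0
    then show ?thesis using linear_extension_linear[OF w[OF xs(3)]] xs by simp
  next
    case (Suc j)
    have j: "j < n" using Suc Suc.prems by simp
    have IH: "(\<lambda>y. multilinear_extension R M (\<lambda>as. v (a # as)) (ys[j := y])) \<in> linear_maps R (free_module R A) M"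
      if "a \<in> A" for a
      using Suc.IH[OF xs(3) _ j, of "\<lambda>as. v (a # as)"] Suc.prems(2) that by (auto simp: Pi_iff)
    have up: "ys[j := z] \<in> tuples (carrier (free_module R A)) n" if "z \<in> carrier (free_module R A)" for z
      using xs(3) that set_update_subset_insert[of ys j z] by (auto simp: tuples_def)
    show ?thesis
    proof (rule linear_mapsI)
      fix z assume z: "z \<in> carrier (free_module R A)"
      show "multilinear_extension R M v (xs[i := z]) \<in> carrier M"
        using linear_mapsD(1)[OF linear_extension_linear[OF w[OF up[OF z]]] xs(2)] by (simp add: xs Suc)
      fix c assume c: "c \<in> carrier R"
      have "linear_extension R M (\<lambda>a. multilinear_extension R M (\<lambda>as. v (a # as)) (ys[j := c \<odot>\<^bsub>free_module R A\<^esub> z])) y =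
          linear_extension R M (\<lambda>a. c \<odot>\<^bsub>M\<^esub> multilinear_extension R M (\<lambda>as. v (a # as)) (ys[j := z])) y"
        using w[OF up[OF z]] c linear_mapsD(3)[OF IH c z]
        by (intro linear_extension_cong[OF xs(2)]) (auto simp: Pi_iff)
      also have "\<dots> = c \<odot>\<^bsub>M\<^esub> linear_extension R M (\<lambda>a. multilinear_extension R M (\<lambda>as. v (a # as)) (ys[j := z])) y"
        by (rule linear_extension_smult[OF xs(2) w[OF up[OF z]] c])
      finally show "multilinear_extension R M v (xs[i := c \<odot>\<^bsub>free_module R A\<^esub> z]) =
          c \<odot>\<^bsub>M\<^esub> multilinear_extension R M v (xs[i := z])"
        by (simp add: xs Suc)
    next
      fix z z' assume z: "z \<in> carrier (free_module R A)" "z' \<in> carrier (free_module R A)"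
      have "linear_extension R M (\<lambda>a. multilinear_extension R M (\<lambda>as. v (a # as)) (ys[j := z \<oplus>\<^bsub>free_module R A\<^esub> z'])) y =
          linear_extension R M (\<lambda>a. multilinear_extension R M (\<lambda>as. v (a # as)) (ys[j := z]) \<oplus>\<^bsub>M\<^esub>
            multilinear_extension R M (\<lambda>as. v (a # as)) (ys[j := z'])) y"
        using w[OF up[OF z(1)]] w[OF up[OF z(2)]] linear_mapsD(2)[OF IH z]
        by (intro linear_extension_cong[OF xs(2)]) (auto simp: Pi_iff)
      also have "\<dots> = linear_extension R M (\<lambda>a. multilinear_extension R M (\<lambda>as. v (a # as)) (ys[j := z])) y \<oplus>\<^bsub>M\<^esub>
          linear_extension R M (\<lambda>a. multilinear_extension R M (\<lambda>as. v (a # as)) (ys[j := z'])) y"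
        by (rule linear_extension_add[OF xs(2) w[OF up[OF z(1)]] w[OF up[OF z(2)]]])
      finally show "multilinear_extension R M v (xs[i := z \<oplus>\<^bsub>free_module R A\<^esub> z']) =
          multilinear_extension R M v (xs[i := z]) \<oplus>\<^bsub>M\<^esub> multilinear_extension R M v (xs[i := z'])"
        by (simp add: xs Suc)
    qed
  qed
qed simp

lemma multilinear_extension_basis:
  assumes "as \<in> tuples A n" "v \<in> tuples A n \<rightarrow> carrier M"
  shows "multilinear_extension R M v (map (basis_elt R) as) = v as"
  using assms
proof (induction n arbitrary: as v)
  case (Suc n)
  from Suc.prems(1) obtain b bs where as: "as = b # bs" "b \<in> A" "bs \<in> tuples A n" by (rule tuples_SucE)
  have bs: "map (basis_elt R) bs \<in> tuples (carrier (free_module R A)) n"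
    using as(3) by (auto simp: tuples_def intro!: R.basis_elt_in)
  have "(\<lambda>a. multilinear_extension R M (\<lambda>as. v (a # as)) (map (basis_elt R) bs)) \<in> A \<rightarrow> carrier M"
    using multilinear_extension_closed[OF bs] Suc.prems(2) by (auto simp: Pi_iff)
  then show ?case
    using linear_extension_basis[OF _ as(2)] Suc.IH[OF as(3), of "\<lambda>as. v (b # as)"] Suc.prems(2) as
    by (simp add: Pi_iff)
qed auto

end

context cring
begin

lemma tuples_update: "\<lbrakk>xs \<in> tuples A n; a \<in> A\<rbrakk> \<Longrightarrow> xs[i := a] \<in> tuples A n"
  using set_update_subset_insert[of xs i a] by (auto simp: tuples_def)

lemma tensor_relations_subset:
  assumes M: "module R M"
  shows "tensor_relations R M n \<subseteq> carrier (free_module R (tuples (carrier M) n))"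
proof -
  interpret M: module R M by (rule M)
  interpret F: module R "free_module R (tuples (carrier M) n)" by (rule module_free)
  have b: "basis_elt R (xs[i := a]) \<in> carrier (free_module R (tuples (carrier M) n))"
    if "xs \<in> tuples (carrier M) n" "a \<in> carrier M" for xs i a
    using that by (intro basis_elt_in tuples_update)
  show ?thesis
    unfolding tensor_relations_def Let_def
    using F.smult_closed[OF _ b] F.M.add.m_closed[OF b b]
    by (auto intro!: F.M.minus_closed b simp del: free_module_sel)
qed

lemma submodule_tensor_null:
  assumes "module R M"
  shows "submodule (tensor_null R M n) R (free_module R (tuples (carrier M) n))"
  unfolding tensor_null_def
  by (rule module.submodule_span[OF module_free tensor_relations_subset[OF assms]])

lemma tensor_relations_in_null: "tensor_relations R M n \<subseteq> tensor_null R M n"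
  unfolding tensor_null_def by (rule module.submodule_span_superset[OF module_free])

lemma group_tensor_eq:
  "gs \<in> tuples (carrier G) n \<Longrightarrow> group_tensor R G gs =
    tensor_null R (group_ring R G) n +>\<^bsub>free_module R (tuples (carrier (group_ring R G)) n)\<^esub> basis_elt R (map (basis_elt R) gs)"
  by (simp add: group_tensor_def pure_tensor_def tuples_def)

lemma map_basis_in: "gs \<in> tuples (carrier G) n \<Longrightarrow> map (basis_elt R) gs \<in> tuples (carrier (group_ring R G)) n"
  by (auto simp: tuples_def intro!: basis_elt_in)

lemma group_tensor_in: "gs \<in> tuples (carrier G) n \<Longrightarrow> group_tensor R G gs \<in> carrier (tensor_power R (group_ring R G) n)"
  unfolding tensor_power_def module.carrier_quotient_module[OF module_free submodule_tensor_null[OF module_group_ring]]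
  by (rule bexI[where x = "basis_elt R (map (basis_elt R) gs)"], erule group_tensor_eq)
    (intro basis_elt_in map_basis_in)

text \<open>The multilinear extension, extended linearly to the free module on all tuples, kills the relations
  of the tensor power.\<close>

lemma tensor_power_map_exists:
  assumes L: "module R L" and v: "v \<in> tuples (carrier G) n \<rightarrow> carrier L"
  shows "\<exists>f\<in>linear_maps R (tensor_power R (group_ring R G) n) L.
    \<forall>gs\<in>tuples (carrier G) n. f (group_tensor R G gs) = v gs"
proof -
  let ?A = "group_ring R G"
  let ?F = "free_module R (tuples (carrier ?A) n)"
  interpret L: module R L by (rule L)
  interpret F: module R ?F by (rule module_free)
  define m where "m = multilinear_extension R L v"
  define \<phi> where "\<phi> = linear_extension R L m"
  have m: "m \<in> tuples (carrier ?A) n \<rightarrow> carrier L"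
    using L.multilinear_extension_closed[OF _ v] by (auto simp: m_def)
  have \<phi>: "\<phi> \<in> linear_maps R ?F L" unfolding \<phi>_def by (rule L.linear_extension_linear[OF m])
  have \<phi>_basis: "\<phi> (basis_elt R xs) = m xs" if "xs \<in> tuples (carrier ?A) n" for xs
    unfolding \<phi>_def by (rule L.linear_extension_basis[OF m that])
  have b: "basis_elt R xs \<in> carrier ?F" if "xs \<in> tuples (carrier ?A) n" for xs
    by (rule basis_elt_in[OF that])
  have rel: "\<phi> r = \<zero>\<^bsub>L\<^esub>" if "r \<in> tensor_relations R ?A n" for r
  proof -
    from that[unfolded tensor_relations_def Let_def] show ?thesis
    proof (elim UnE CollectE exE conjE)
      fix xs i x y
      assume add: "r = basis_elt R (xs[i := x \<oplus>\<^bsub>?A\<^esub> y]) \<ominus>\<^bsub>?F\<^esub> (basis_elt R (xs[i := x]) \<oplus>\<^bsub>?F\<^esub> basis_elt R (xs[i := y]))"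
        "xs \<in> tuples (carrier ?A) n" "i < n" "x \<in> carrier ?A" "y \<in> carrier ?A"
      have slot: "(\<lambda>y. m (xs[i := y])) \<in> linear_maps R (free_module R (carrier G)) L"
        unfolding m_def using add by (intro L.multilinear_extension_slot[OF _ v]) simp_all
      have xy: "x \<oplus>\<^bsub>?A\<^esub> y \<in> carrier ?A" using module.axioms(2)[OF module_group_ring] add(4,5)
        by (metis abelian_group.axioms(1) abelian_monoid.a_closed)
      note u = tuples_update[OF add(2)]
      have "\<phi> r = m (xs[i := x \<oplus>\<^bsub>?A\<^esub> y]) \<ominus>\<^bsub>L\<^esub> (m (xs[i := x]) \<oplus>\<^bsub>L\<^esub> m (xs[i := y]))"
        unfolding add(1) linear_maps_zero_minus(2)[OF module_free L \<phi> b[OF u[OF xy]] F.M.add.m_closed[OF b[OF u[OF add(4)]] b[OF u[OF add(5)]]]]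
          linear_mapsD(2)[OF \<phi> b[OF u[OF add(4)]] b[OF u[OF add(5)]]]
        by (simp only: \<phi>_basis u add xy)
      also have "\<dots> = \<zero>\<^bsub>L\<^esub>"
        using linear_mapsD(1,2)[OF slot] add(4,5) by (simp add: L.M.r_neg a_minus_def)
      finally show "\<phi> r = \<zero>\<^bsub>L\<^esub>" .
    next
      fix xs i c x
      assume smult: "r = basis_elt R (xs[i := c \<odot>\<^bsub>?A\<^esub> x]) \<ominus>\<^bsub>?F\<^esub> (c \<odot>\<^bsub>?F\<^esub> basis_elt R (xs[i := x]))"
        "xs \<in> tuples (carrier ?A) n" "i < n" "c \<in> carrier R" "x \<in> carrier ?A"
      have slot: "(\<lambda>y. m (xs[i := y])) \<in> linear_maps R (free_module R (carrier G)) L"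
        unfolding m_def using smult by (intro L.multilinear_extension_slot[OF _ v]) simp_all
      have cx: "c \<odot>\<^bsub>?A\<^esub> x \<in> carrier ?A" by (rule module.smult_closed[OF module_group_ring smult(4,5)])
      note u = tuples_update[OF smult(2)]
      have "\<phi> r = m (xs[i := c \<odot>\<^bsub>?A\<^esub> x]) \<ominus>\<^bsub>L\<^esub> (c \<odot>\<^bsub>L\<^esub> m (xs[i := x]))"
        unfolding smult(1) linear_maps_zero_minus(2)[OF module_free L \<phi> b[OF u[OF cx]] F.smult_closed[OF smult(4) b[OF u[OF smult(5)]]]]
          linear_mapsD(3)[OF \<phi> smult(4) b[OF u[OF smult(5)]]]
        by (simp only: \<phi>_basis u smult cx)
      also have "\<dots> = \<zero>\<^bsub>L\<^esub>"
        using linear_mapsD(1,3)[OF slot] smult(4,5) by (simp add: L.M.r_neg a_minus_def)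
      finally show "\<phi> r = \<zero>\<^bsub>L\<^esub>" .
    qed
  qed
  have "tensor_null R ?A n \<subseteq> {x \<in> carrier ?F. \<phi> x = \<zero>\<^bsub>L\<^esub>}"
    unfolding tensor_null_def
    by (rule F.submodule_span_least[OF F.submodule_kernel[OF L \<phi>]])
      (use rel tensor_relations_subset[OF module_group_ring] in blast)
  then obtain f where f: "f \<in> linear_maps R (tensor_power R ?A n) L"
    "\<And>x. x \<in> carrier ?F \<Longrightarrow> f (tensor_null R ?A n +>\<^bsub>?F\<^esub> x) = \<phi> x"
    using F.linear_map_from_quotient[OF submodule_tensor_null[OF module_group_ring] L \<phi>]
    unfolding tensor_power_def by blast
  have "f (group_tensor R G gs) = v gs" if gs: "gs \<in> tuples (carrier G) n" for gs
    using f(2)[OF b[OF map_basis_in[OF gs]]] \<phi>_basis[OF map_basis_in[OF gs]]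
      L.multilinear_extension_basis[OF gs v] by (simp add: group_tensor_eq[OF gs] m_def)
  then show ?thesis using f(1) by blast
qed

text \<open>Tuples of arbitrary elements are reduced to tuples of basis elements one slot at a time, using that
  a linear map on the tensor power is linear in each slot.\<close>

lemma tensor_power_map_eq:
  assumes L: "module R L"
    and f: "f \<in> linear_maps R (tensor_power R (group_ring R G) n) L"
    and g: "g \<in> linear_maps R (tensor_power R (group_ring R G) n) L"
    and eq: "\<And>gs. gs \<in> tuples (carrier G) n \<Longrightarrow> f (group_tensor R G gs) = g (group_tensor R G gs)"
    and X: "X \<in> carrier (tensor_power R (group_ring R G) n)"
  shows "f X = g X"
proof -
  let ?A = "group_ring R G"
  let ?F = "free_module R (tuples (carrier ?A) n)"
  let ?q = "\<lambda>x. tensor_null R ?A n +>\<^bsub>?F\<^esub> x"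
  interpret F: module R ?F by (rule module_free)
  note sub = submodule_tensor_null[OF module_group_ring, of G n]
  have q: "?q \<in> linear_maps R ?F (tensor_power R ?A n)"
    unfolding tensor_power_def by (rule F.quotient_map_linear[OF sub])
  have lin: "(\<lambda>x. h (?q x)) \<in> linear_maps R ?F L" if h: "h \<in> linear_maps R (tensor_power R ?A n) L" for h
    by (rule linear_mapsI) (simp_all only: linear_mapsD[OF q] linear_mapsD[OF h])
  have b: "basis_elt R xs \<in> carrier ?F" if "xs \<in> tuples (carrier ?A) n" for xs
    by (rule basis_elt_in[OF that])
  have slot: "(\<lambda>a. h (?q (basis_elt R (xs[i := a])))) \<in> linear_maps R (free_module R (carrier G)) L"
    if h: "h \<in> linear_maps R (tensor_power R ?A n) L" and xs: "xs \<in> tuples (carrier ?A) n" and i: "i < n" for h xs i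
  proof -
    note u = tuples_update[OF xs]
    have null: "?q x = ?q y" if "x \<ominus>\<^bsub>?F\<^esub> y \<in> tensor_relations R ?A n" "x \<in> carrier ?F" "y \<in> carrier ?F" for x y
    proof -
      have "x \<ominus>\<^bsub>?F\<^esub> y \<in> tensor_null R ?A n" using that(1) tensor_relations_in_null by blast
      moreover have "x = (x \<ominus>\<^bsub>?F\<^esub> y) \<oplus>\<^bsub>?F\<^esub> y"
        using that(2,3) by (simp add: a_minus_def F.M.a_assoc F.M.l_neg del: free_module_sel group_ring_sel)
      ultimately show ?thesis using F.coset_eq_iff[OF sub that(2,3)] by blast
    qed
    show ?thesis
    proof (rule linear_mapsI)
      fix a assume "a \<in> carrier (free_module R (carrier G))"
      then have a: "a \<in> carrier ?A" by simp
      show "h (?q (basis_elt R (xs[i := a]))) \<in> carrier L"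
        by (intro linear_mapsD(1)[OF lin[OF h]] b u a)
      fix c assume c: "c \<in> carrier R"
      have ca: "c \<odot>\<^bsub>?A\<^esub> a \<in> carrier ?A" by (rule module.smult_closed[OF module_group_ring c a])
      have "?q (basis_elt R (xs[i := c \<odot>\<^bsub>?A\<^esub> a])) = ?q (c \<odot>\<^bsub>?F\<^esub> basis_elt R (xs[i := a]))"
        by (rule null) (use xs i c a ca in \<open>auto simp: tensor_relations_def Let_def simp del: free_module_sel group_ring_sel
            intro!: F.smult_closed b u\<close>)
      then show "h (?q (basis_elt R (xs[i := c \<odot>\<^bsub>free_module R (carrier G)\<^esub> a]))) = c \<odot>\<^bsub>L\<^esub> h (?q (basis_elt R (xs[i := a])))"
        using linear_mapsD(3)[OF lin[OF h] c b[OF u[OF a]]] by simp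
    next
      fix a a' assume "a \<in> carrier (free_module R (carrier G))" "a' \<in> carrier (free_module R (carrier G))"
      then have a: "a \<in> carrier ?A" "a' \<in> carrier ?A" by simp_all
      have aa: "a \<oplus>\<^bsub>?A\<^esub> a' \<in> carrier ?A" using module.axioms(2)[OF module_group_ring] a
        by (metis abelian_group.axioms(1) abelian_monoid.a_closed)
      have "?q (basis_elt R (xs[i := a \<oplus>\<^bsub>?A\<^esub> a'])) = ?q (basis_elt R (xs[i := a]) \<oplus>\<^bsub>?F\<^esub> basis_elt R (xs[i := a']))"
        by (rule null) (use xs i a aa in \<open>auto simp: tensor_relations_def Let_def simp del: free_module_sel group_ring_sel
            intro!: F.M.add.m_closed b u\<close>)
      then show "h (?q (basis_elt R (xs[i := a \<oplus>\<^bsub>free_module R (carrier G)\<^esub> a']))) =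
          h (?q (basis_elt R (xs[i := a]))) \<oplus>\<^bsub>L\<^esub> h (?q (basis_elt R (xs[i := a'])))"
        using linear_mapsD(2)[OF lin[OF h] b[OF u[OF a(1)]] b[OF u[OF a(2)]]] by simp
    qed
  qed
  \<comment> \<open>only the slots from \<open>j\<close> on are required to contain basis elements\<close>
  have main: "f (?q (basis_elt R xs)) = g (?q (basis_elt R xs))"
    if "j \<le> n" "xs \<in> tuples (carrier ?A) n" "\<And>i. \<lbrakk>j \<le> i; i < n\<rbrakk> \<Longrightarrow> xs ! i \<in> basis_elt R ` carrier G" for j xs
    using that
  proof (induction j arbitrary: xs)
    case 0
    have "\<exists>g\<in>carrier G. x = basis_elt R g" if "x \<in> set xs" for x
      using 0(2,3) that by (auto simp: in_set_conv_nth tuples_def)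
    then obtain s where s: "\<And>x. x \<in> set xs \<Longrightarrow> s x \<in> carrier G \<and> x = basis_elt R (s x)" by metis
    have "map s xs \<in> tuples (carrier G) n" using s 0 by (auto simp: tuples_def)
    moreover have "map (basis_elt R) (map s xs) = xs" using s by (simp add: map_idI)
    ultimately show ?case using eq[of "map s xs"] group_tensor_eq[of "map s xs" G n] by (simp del: map_map)
  next
    case (Suc j)
    have xj: "xs ! j \<in> carrier (free_module R (carrier G))" using Suc.prems by (auto simp: tuples_def)
    have "f (?q (basis_elt R (xs[j := xs ! j]))) = g (?q (basis_elt R (xs[j := xs ! j])))"
    proof (rule linear_maps_free_eq[OF L slot[OF f] slot[OF g] _ xj])
      fix a assume a: "a \<in> carrier G"
      show "f (?q (basis_elt R (xs[j := basis_elt R a]))) = g (?q (basis_elt R (xs[j := basis_elt R a])))"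
      proof (rule Suc.IH)
        show "xs[j := basis_elt R a] \<in> tuples (carrier ?A) n"
          using a by (intro tuples_update Suc.prems) (simp add: basis_elt_in)
        show "xs[j := basis_elt R a] ! i \<in> basis_elt R ` carrier G" if "j \<le> i" "i < n" for i
          using that a Suc.prems by (cases "i = j") (auto simp: tuples_def)
      qed (use Suc.prems in simp)
    qed (use Suc.prems in simp_all)
    then show ?case by simp
  qed
  obtain x where x: "x \<in> carrier ?F" "X = ?q x"
    using X F.carrier_quotient_module[OF sub] unfolding tensor_power_def by blast
  show ?thesis unfolding x(2)
    by (rule linear_maps_free_eq[OF L lin[OF f] lin[OF g] main[of n] x(1)]) auto
qed

lemma tensor_power_closed:
  assumes X: "X \<in> carrier (tensor_power R (group_ring R G) n)"
  shows "Y \<in> carrier (tensor_power R (group_ring R G) n) \<Longrightarrow> X \<oplus>\<^bsub>tensor_power R (group_ring R G) n\<^esub> Y \<in> carrier (tensor_power R (group_ring R G) n)"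
    and "c \<in> carrier R \<Longrightarrow> c \<odot>\<^bsub>tensor_power R (group_ring R G) n\<^esub> X \<in> carrier (tensor_power R (group_ring R G) n)"
proof -
  let ?F = "free_module R (tuples (carrier (group_ring R G)) n)"
  interpret T: module R ?F by (rule module_free)
  note sub = submodule_tensor_null[OF module_group_ring, of G n]
  obtain x where x: "x \<in> carrier ?F" "X = tensor_null R (group_ring R G) n +>\<^bsub>?F\<^esub> x"
    using X unfolding tensor_power_def T.carrier_quotient_module[OF sub] by blast
  show "c \<odot>\<^bsub>tensor_power R (group_ring R G) n\<^esub> X \<in> carrier (tensor_power R (group_ring R G) n)" if c: "c \<in> carrier R"
    unfolding x(2) tensor_power_def T.quotient_module_ops(2)[OF sub c x(1)] T.carrier_quotient_module[OF sub]
    using T.smult_closed[OF c x(1)] by blast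
  assume "Y \<in> carrier (tensor_power R (group_ring R G) n)"
  then obtain y where y: "y \<in> carrier ?F" "Y = tensor_null R (group_ring R G) n +>\<^bsub>?F\<^esub> y"
    unfolding tensor_power_def T.carrier_quotient_module[OF sub] by blast
  show "X \<oplus>\<^bsub>tensor_power R (group_ring R G) n\<^esub> Y \<in> carrier (tensor_power R (group_ring R G) n)"
    unfolding x(2) y(2) tensor_power_def T.quotient_module_ops(1)[OF sub x(1) y(1)] T.carrier_quotient_module[OF sub]
    using T.M.a_closed[OF x(1) y(1)] by blast
qed

lemma module_hochschild: "module R (hochschild_cochains R G n)"
  unfolding hochschild_cochains_def
  by (rule module_hom_module[OF module_group_ring]) (rule tensor_power_closed; assumption)+

lemma cochain_eqI:
  assumes "f \<in> carrier (hochschild_cochains R G n)" "g \<in> carrier (hochschild_cochains R G n)"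
    and "\<And>gs. gs \<in> tuples (carrier G) n \<Longrightarrow> f (group_tensor R G gs) = g (group_tensor R G gs)"
  shows "f = g"
proof (rule extensionalityI[of f "carrier (tensor_power R (group_ring R G) n)" g])
  show "f X = g X" if "X \<in> carrier (tensor_power R (group_ring R G) n)" for X
  proof (rule tensor_power_map_eq[OF module_group_ring])
    show "f \<in> linear_maps R (tensor_power R (group_ring R G) n) (group_ring R G)"
      "g \<in> linear_maps R (tensor_power R (group_ring R G) n) (group_ring R G)"
      using assms(1,2) by (auto simp: hochschild_cochains_def hom_module_def)
  qed (use assms(3) that in auto)
qed (use assms(1,2) in \<open>auto simp: hochschild_cochains_def hom_module_def\<close>)

lemma cochain_of:
  assumes v: "v \<in> tuples (carrier G) n \<rightarrow> carrier (group_ring R G)"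
  shows "cochain_of R G n v \<in> carrier (hochschild_cochains R G n)"
    and "gs \<in> tuples (carrier G) n \<Longrightarrow> cochain_of R G n v (group_tensor R G gs) = v gs"
proof -
  let ?T = "tensor_power R (group_ring R G) n"
  obtain f where f: "f \<in> linear_maps R ?T (group_ring R G)"
    "\<And>gs. gs \<in> tuples (carrier G) n \<Longrightarrow> f (group_tensor R G gs) = v gs"
    using tensor_power_map_exists[OF module_group_ring v] by blast
  let ?P = "\<lambda>f. f \<in> carrier (hochschild_cochains R G n) \<and> (\<forall>gs\<in>tuples (carrier G) n. f (group_tensor R G gs) = v gs)"
  note closed = tensor_power_closed[of _ G n]
  have "restrict f (carrier ?T) \<in> linear_maps R ?T (group_ring R G)"
    using f(1) closed by (auto simp: linear_maps_def)
  then have P: "?P (restrict f (carrier ?T))"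
    using f(2) group_tensor_in by (auto simp: hochschild_cochains_def hom_module_def)
  have "\<exists>!f. ?P f"
  proof (rule ex1I[of ?P, OF P])
    fix h assume "?P h"
    then show "h = restrict f (carrier ?T)" using P by (intro cochain_eqI) auto
  qed
  from theI'[OF this]
  show "cochain_of R G n v \<in> carrier (hochschild_cochains R G n)"
    and "gs \<in> tuples (carrier G) n \<Longrightarrow> cochain_of R G n v (group_tensor R G gs) = v gs"
    unfolding cochain_of_def by blast+
qed

end

section \<open>Cochain complexes\<close>

text \<open>Cochain complexes of modules over \<open>k\<close>.\<close>

definition cochain_complex ::
  "('k, 'm) ring_scheme \<Rightarrow> (nat \<Rightarrow> ('k, 'a, 'p) module_scheme) \<Rightarrow> (nat \<Rightarrow> 'a \<Rightarrow> 'a) \<Rightarrow> bool"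
  where "cochain_complex k C d \<longleftrightarrow>
    (\<forall>n. module k (C n)) \<and> (\<forall>n. d n \<in> linear_maps k (C n) (C (Suc n))) \<and>
    (\<forall>n. \<forall>x\<in>carrier (C n). d (Suc n) (d n x) = \<zero>\<^bsub>C (Suc (Suc n))\<^esub>)"

text \<open>The class of a cocycle.\<close>

definition cohomology_class ::
  "(nat \<Rightarrow> ('k, 'a, 'p) module_scheme) \<Rightarrow> (nat \<Rightarrow> 'a \<Rightarrow> 'a) \<Rightarrow> nat \<Rightarrow> 'a \<Rightarrow> 'a set"
  where "cohomology_class C d n z = coboundaries C d n +>\<^bsub>C n\<^esub> z"

text \<open>Cochain maps between complexes over possibly different rings, additive but not necessarily linear.\<close>

definition additive_cochain_map ::
  "(nat \<Rightarrow> ('k, 'a, 'p) module_scheme) \<Rightarrow> (nat \<Rightarrow> 'a \<Rightarrow> 'a) \<Rightarrow> (nat \<Rightarrow> ('l, 'b, 'q) module_scheme) \<Rightarrow>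
    (nat \<Rightarrow> 'b \<Rightarrow> 'b) \<Rightarrow> (nat \<Rightarrow> 'a \<Rightarrow> 'b) \<Rightarrow> bool"
  where "additive_cochain_map C d D e F \<longleftrightarrow>
    (\<forall>n. \<forall>x\<in>carrier (C n). F n x \<in> carrier (D n)) \<and>
    (\<forall>n. \<forall>x\<in>carrier (C n). \<forall>y\<in>carrier (C n). F n (x \<oplus>\<^bsub>C n\<^esub> y) = F n x \<oplus>\<^bsub>D n\<^esub> F n y) \<and>
    (\<forall>n. \<forall>x\<in>carrier (C n). F (Suc n) (d n x) = e n (F n x))"

lemma additive_map_zero:
  assumes M: "module k M" and N: "module l N" and F: "\<And>x. x \<in> carrier M \<Longrightarrow> F x \<in> carrier N"
    and add: "\<And>x y. \<lbrakk>x \<in> carrier M; y \<in> carrier M\<rbrakk> \<Longrightarrow> F (x \<oplus>\<^bsub>M\<^esub> y) = F x \<oplus>\<^bsub>N\<^esub> F y"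
  shows "F \<zero>\<^bsub>M\<^esub> = \<zero>\<^bsub>N\<^esub>"
proof -
  interpret M: module k M by (rule M)
  interpret N: module l N by (rule N)
  have "F \<zero>\<^bsub>M\<^esub> \<oplus>\<^bsub>N\<^esub> F \<zero>\<^bsub>M\<^esub> = F \<zero>\<^bsub>M\<^esub>" using add[of "\<zero>\<^bsub>M\<^esub>" "\<zero>\<^bsub>M\<^esub>"] by simp
  then show ?thesis using F[of "\<zero>\<^bsub>M\<^esub>"] by (metis M.zero_closed N.M.add.l_cancel_one')
qed

context
  fixes k :: "('k, 'm) ring_scheme" and C :: "nat \<Rightarrow> ('k, 'a, 'p) module_scheme" and d :: "nat \<Rightarrow> 'a \<Rightarrow> 'a"
  assumes cc: "cochain_complex k C d"
begin

lemma complex_module: "module k (C n)"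
  and complex_diff: "d n \<in> linear_maps k (C n) (C (Suc n))"
  and complex_diff_diff: "x \<in> carrier (C n) \<Longrightarrow> d (Suc n) (d n x) = \<zero>\<^bsub>C (Suc (Suc n))\<^esub>"
  using cc by (auto simp: cochain_complex_def)

lemma submodule_cocycles: "submodule (cocycles C d n) k (C n)"
  unfolding cocycles_def by (rule module.submodule_kernel[OF complex_module complex_module complex_diff])

lemma module_cocycles: "module k ((C n)\<lparr>carrier := cocycles C d n\<rparr>)"
  by (rule submodule.submodule_is_module[OF submodule_cocycles complex_module])

lemma cocycle_closed: "z \<in> cocycles C d n \<Longrightarrow> z \<in> carrier (C n)"
  by (simp add: cocycles_def)

lemma zero_in_cocycles: "\<zero>\<^bsub>C n\<^esub> \<in> cocycles C d n"
  using module.submodule_zero[OF complex_module submodule_cocycles] .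

lemma coboundary_cocycle: "b \<in> coboundaries C d n \<Longrightarrow> b \<in> cocycles C d n"
  using complex_diff_diff linear_mapsD(1)[OF complex_diff] zero_in_cocycles
  by (cases n) (auto simp: coboundaries_def cocycles_def)

lemma submodule_coboundaries: "submodule (coboundaries C d n) k ((C n)\<lparr>carrier := cocycles C d n\<rparr>)"
proof -
  interpret Z: module k "(C n)\<lparr>carrier := cocycles C d n\<rparr>" by (rule module_cocycles)
  have zero: "\<zero>\<^bsub>C n\<^esub> \<in> coboundaries C d n"
  proof (cases n)
    case (Suc m)
    have "d m \<zero>\<^bsub>C m\<^esub> = \<zero>\<^bsub>C n\<^esub>"
      using linear_maps_zero_minus(1)[OF complex_module complex_module complex_diff, of m] Suc by simp
    moreover have "\<zero>\<^bsub>C m\<^esub> \<in> carrier (C m)" using zero_in_cocycles cocycle_closed by blast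
    ultimately show ?thesis using Suc by (auto simp: coboundaries_def intro!: image_eqI[of _ _ "\<zero>\<^bsub>C m\<^esub>"])
  qed (simp add: coboundaries_def)
  have smult: "c \<odot>\<^bsub>C n\<^esub> x \<in> coboundaries C d n" if c: "c \<in> carrier k" and x: "x \<in> coboundaries C d n" for c x
  proof (cases n)
    case 0
    interpret M: module k "C 0" by (rule complex_module)
    show ?thesis using c x 0 by (simp add: coboundaries_def)
  next
    case (Suc m)
    interpret M: module k "C m" by (rule complex_module)
    obtain y where "y \<in> carrier (C m)" "x = d m y" using x Suc by (auto simp: coboundaries_def)
    then show ?thesis using linear_mapsD(3)[OF complex_diff c, of y m] c Suc
      by (auto simp: coboundaries_def intro!: image_eqI[of _ _ "c \<odot>\<^bsub>C m\<^esub> y"])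
  qed
  show ?thesis
  proof (rule Z.submoduleI)
    show "coboundaries C d n \<subseteq> carrier ((C n)\<lparr>carrier := cocycles C d n\<rparr>)"
      using coboundary_cocycle by auto
    show "a \<oplus>\<^bsub>(C n)\<lparr>carrier := cocycles C d n\<rparr>\<^esub> b \<in> coboundaries C d n"
      if ab: "a \<in> coboundaries C d n" "b \<in> coboundaries C d n" for a b
    proof (cases n)
      case 0
      interpret M: module k "C 0" by (rule complex_module)
      show ?thesis using that 0 by (simp add: coboundaries_def)
    next
      case (Suc m)
      interpret M: module k "C m" by (rule complex_module)
      obtain x y where "x \<in> carrier (C m)" "a = d m x" "y \<in> carrier (C m)" "b = d m y"
        using ab Suc by (auto simp: coboundaries_def)
      then show ?thesis using linear_mapsD(2)[OF complex_diff, of x m y] Suc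
        by (auto simp: coboundaries_def intro!: image_eqI[of _ _ "x \<oplus>\<^bsub>C m\<^esub> y"])
    qed
    show "\<ominus>\<^bsub>(C n)\<lparr>carrier := cocycles C d n\<rparr>\<^esub> a \<in> coboundaries C d n" if a: "a \<in> coboundaries C d n" for a
    proof -
      have "(\<ominus>\<^bsub>k\<^esub> \<one>\<^bsub>k\<^esub>) \<odot>\<^bsub>C n\<^esub> a = \<ominus>\<^bsub>(C n)\<lparr>carrier := cocycles C d n\<rparr>\<^esub> a"
        using Z.smult_l_minus[of "\<one>\<^bsub>k\<^esub>" a] Z.smult_one[of a] coboundary_cocycle[OF a] by simp
      then show ?thesis using smult[OF _ a, of "\<ominus>\<^bsub>k\<^esub> \<one>\<^bsub>k\<^esub>"] by simp
    qed
  qed (use zero smult in auto)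
qed

lemma cohomology_class_alt:
  "cohomology_class C d n z = coboundaries C d n +>\<^bsub>(C n)\<lparr>carrier := cocycles C d n\<rparr>\<^esub> z"
  by (simp add: cohomology_class_def a_r_coset_def')

lemma cohomology_carrier:
  "X \<in> carrier (cohomology C d n) \<longleftrightarrow> (\<exists>z\<in>cocycles C d n. X = cohomology_class C d n z)"
  using module.carrier_quotient_module[OF module_cocycles submodule_coboundaries]
  by (simp add: cohomology_def cohomology_class_alt)

lemma cohomology_class_eq_iff:
  assumes "z \<in> cocycles C d n" "z' \<in> cocycles C d n"
  shows "cohomology_class C d n z = cohomology_class C d n z' \<longleftrightarrow> (\<exists>b\<in>coboundaries C d n. z = b \<oplus>\<^bsub>C n\<^esub> z')"
  using module.coset_eq_iff[OF module_cocycles submodule_coboundaries, of z n z'] assms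
  by (simp add: cohomology_class_alt)

lemma cohomology_ops:
  "\<lbrakk>z \<in> cocycles C d n; z' \<in> cocycles C d n\<rbrakk> \<Longrightarrow>
    cohomology_class C d n z \<oplus>\<^bsub>cohomology C d n\<^esub> cohomology_class C d n z' = cohomology_class C d n (z \<oplus>\<^bsub>C n\<^esub> z')"
  "\<lbrakk>c \<in> carrier k; z \<in> cocycles C d n\<rbrakk> \<Longrightarrow>
    c \<odot>\<^bsub>cohomology C d n\<^esub> cohomology_class C d n z = cohomology_class C d n (c \<odot>\<^bsub>C n\<^esub> z)"
  using module.quotient_module_ops[OF module_cocycles submodule_coboundaries, where n1 = n]
  by (simp_all add: cohomology_class_alt cohomology_def)

lemma cocycle_ops:
  "\<lbrakk>z \<in> cocycles C d n; z' \<in> cocycles C d n\<rbrakk> \<Longrightarrow> z \<oplus>\<^bsub>C n\<^esub> z' \<in> cocycles C d n"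
  "\<lbrakk>c \<in> carrier k; z \<in> cocycles C d n\<rbrakk> \<Longrightarrow> c \<odot>\<^bsub>C n\<^esub> z \<in> cocycles C d n"
  using module.submoduleE(4,5)[OF complex_module submodule_cocycles] by auto

lemma cohomology_class_in: "z \<in> cocycles C d n \<Longrightarrow> cohomology_class C d n z \<in> carrier (cohomology C d n)"
  using cohomology_carrier by blast

lemma cohomology_add_closed:
  assumes "X \<in> carrier (cohomology C d n)" "Y \<in> carrier (cohomology C d n)"
  shows "X \<oplus>\<^bsub>cohomology C d n\<^esub> Y \<in> carrier (cohomology C d n)"
proof -
  obtain x y where "x \<in> cocycles C d n" "X = cohomology_class C d n x" "y \<in> cocycles C d n" "Y = cohomology_class C d n y"
    using assms cohomology_carrier by metis
  then show ?thesis by (simp add: cohomology_ops cohomology_class_in cocycle_ops)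
qed

lemma cohomology_smult_closed:
  assumes "c \<in> carrier k" "X \<in> carrier (cohomology C d n)"
  shows "c \<odot>\<^bsub>cohomology C d n\<^esub> X \<in> carrier (cohomology C d n)"
proof -
  obtain x where "x \<in> cocycles C d n" "X = cohomology_class C d n x"
    using assms cohomology_carrier by metis
  then show ?thesis using assms by (simp add: cohomology_ops cohomology_class_in cocycle_ops)
qed

end

lemma additive_cochain_mapD:
  assumes "additive_cochain_map C d D e F"
  shows "x \<in> carrier (C n) \<Longrightarrow> F n x \<in> carrier (D n)"
    and "\<lbrakk>x \<in> carrier (C n); y \<in> carrier (C n)\<rbrakk> \<Longrightarrow> F n (x \<oplus>\<^bsub>C n\<^esub> y) = F n x \<oplus>\<^bsub>D n\<^esub> F n y"
    and "x \<in> carrier (C n) \<Longrightarrow> F (Suc n) (d n x) = e n (F n x)"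
  using assms by (auto simp: additive_cochain_map_def)

context
  fixes k :: "('k, 'm) ring_scheme" and l :: "('l, 'm2) ring_scheme"
    and C :: "nat \<Rightarrow> ('k, 'a, 'p) module_scheme" and D :: "nat \<Rightarrow> ('l, 'b, 'q) module_scheme"
    and d e F
  assumes C: "cochain_complex k C d" and D: "cochain_complex l D e" and F: "additive_cochain_map C d D e F"
begin

lemma additive_cochain_map_zero: "F n \<zero>\<^bsub>C n\<^esub> = \<zero>\<^bsub>D n\<^esub>"
  by (rule additive_map_zero[OF complex_module[OF C] complex_module[OF D]]) (rule additive_cochain_mapD[OF F]; assumption)+

lemma additive_cochain_map_cocycle:
  assumes "z \<in> cocycles C d n"
  shows "F n z \<in> cocycles D e n"
proof -
  have "z \<in> carrier (C n)" "d n z = \<zero>\<^bsub>C (Suc n)\<^esub>" using assms by (auto simp: cocycles_def)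
  then show ?thesis
    using additive_cochain_mapD[OF F, of z n] additive_cochain_map_zero[of "Suc n"] by (simp add: cocycles_def)
qed

lemma additive_cochain_map_coboundary:
  assumes "b \<in> coboundaries C d n"
  shows "F n b \<in> coboundaries D e n"
proof (cases n)
  case 0
  then show ?thesis using assms additive_cochain_map_zero[of 0] by (simp add: coboundaries_def)
next
  case (Suc m)
  then obtain x where "x \<in> carrier (C m)" "b = d m x" using assms by (auto simp: coboundaries_def)
  then show ?thesis using additive_cochain_mapD[OF F, of x m] Suc by (simp add: coboundaries_def)
qed

lemma cohomology_map_class:
  assumes z: "z \<in> cocycles C d n"
  shows "cohomology_map D e F n (cohomology_class C d n z) = cohomology_class D e n (F n z)"
proof -
  let ?Z = "(D n)\<lparr>carrier := cocycles D e n\<rparr>"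
  have "coboundaries D e n <+>\<^bsub>?Z\<^esub> (F n ` (coboundaries C d n +>\<^bsub>C n\<^esub> z)) = coboundaries D e n +>\<^bsub>?Z\<^esub> F n z"
  proof (rule module.image_coset_absorb[OF module_cocycles[OF D] submodule_coboundaries[OF D]])
    fix h assume h: "h \<in> coboundaries C d n"
    then have "h \<in> carrier (C n)" using coboundary_cocycle[OF C] cocycle_closed[OF C] by blast
    then have "F n (h \<oplus>\<^bsub>C n\<^esub> z) = F n h \<oplus>\<^bsub>D n\<^esub> F n z"
      using additive_cochain_mapD(2)[OF F] z cocycle_closed[OF C] by blast
    then show "F n (h \<oplus>\<^bsub>C n\<^esub> z) \<in> coboundaries D e n +>\<^bsub>?Z\<^esub> F n z"
      using additive_cochain_map_coboundary[OF h] by (auto simp: a_r_coset_def')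
  next
    show "z \<in> coboundaries C d n +>\<^bsub>C n\<^esub> z"
      using module.coset_self[OF module_cocycles[OF C] submodule_coboundaries[OF C], of z n] z by (simp add: a_r_coset_def')
    show "F n z \<in> carrier ?Z" using additive_cochain_map_cocycle[OF z] by simp
  qed
  then show ?thesis by (simp add: cohomology_map_def cohomology_class_def a_r_coset_def' set_add_def')
qed

lemma cohomology_map_closed:
  assumes "X \<in> carrier (cohomology C d n)"
  shows "cohomology_map D e F n X \<in> carrier (cohomology D e n)"
  using assms cohomology_map_class additive_cochain_map_cocycle
  by (auto simp: cohomology_carrier[OF C] cohomology_carrier[OF D])

end

text \<open>Hypothesis \<open>surj\<close> is stronger than surjectivity on cohomology: a cocycle is required to lift itself,
  and not only up to a coboundary.\<close>

lemma cohomology_map_iso: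
  assumes C: "cochain_complex k C d" and D: "cochain_complex k D e" and F: "additive_cochain_map C d D e F"
    and smult: "\<And>n c x. \<lbrakk>c \<in> carrier k; x \<in> carrier (C n)\<rbrakk> \<Longrightarrow> F n (c \<odot>\<^bsub>C n\<^esub> x) = c \<odot>\<^bsub>D n\<^esub> F n x"
    and surj: "\<And>w. w \<in> cocycles D e n \<Longrightarrow> \<exists>z\<in>cocycles C d n. F n z = w"
    and inj: "\<And>z. \<lbrakk>z \<in> cocycles C d n; F n z \<in> coboundaries D e n\<rbrakk> \<Longrightarrow> z \<in> coboundaries C d n"
  shows "cohomology_map D e F n \<in> linear_isos k (cohomology C d n) (cohomology D e n)"
proof -
  note F_class = cohomology_map_class[OF C D F] and F_cocycle = additive_cochain_map_cocycle[OF C D F]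
  have "cohomology_map D e F n \<in> linear_maps k (cohomology C d n) (cohomology D e n)"
  proof (rule linear_mapsI)
    show "cohomology_map D e F n X \<in> carrier (cohomology D e n)" if "X \<in> carrier (cohomology C d n)" for X
      by (rule cohomology_map_closed[OF C D F that])
    show "cohomology_map D e F n (X \<oplus>\<^bsub>cohomology C d n\<^esub> Y) =
        cohomology_map D e F n X \<oplus>\<^bsub>cohomology D e n\<^esub> cohomology_map D e F n Y"
      if "X \<in> carrier (cohomology C d n)" "Y \<in> carrier (cohomology C d n)" for X Y
      using that additive_cochain_mapD(2)[OF F] cocycle_closed[OF C]
      by (auto simp: cohomology_carrier[OF C] cohomology_ops[OF C] cohomology_ops[OF D] cocycle_ops[OF C] F_class F_cocycle)
    show "cohomology_map D e F n (c \<odot>\<^bsub>cohomology C d n\<^esub> X) = c \<odot>\<^bsub>cohomology D e n\<^esub> cohomology_map D e F n X"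
      if "c \<in> carrier k" "X \<in> carrier (cohomology C d n)" for c X
      using that smult cocycle_closed[OF C]
      by (auto simp: cohomology_carrier[OF C] cohomology_ops[OF C] cohomology_ops[OF D] cocycle_ops[OF C] F_class F_cocycle)
  qed
  moreover have "inj_on (cohomology_map D e F n) (carrier (cohomology C d n))"
  proof (rule inj_onI)
    fix X Y assume "X \<in> carrier (cohomology C d n)" "Y \<in> carrier (cohomology C d n)"
      and eq: "cohomology_map D e F n X = cohomology_map D e F n Y"
    then obtain x y where xy: "x \<in> cocycles C d n" "X = cohomology_class C d n x" "y \<in> cocycles C d n" "Y = cohomology_class C d n y"
      by (auto simp: cohomology_carrier[OF C])
    interpret C: module k "C n" by (rule complex_module[OF C])
    interpret D: module k "D n" by (rule complex_module[OF D])
    have xyC: "x \<in> carrier (C n)" "y \<in> carrier (C n)" using xy cocycle_closed[OF C] by auto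
    have FC: "F n x \<in> carrier (D n)" "F n y \<in> carrier (D n)" using xyC additive_cochain_mapD(1)[OF F] by auto
    obtain b where b: "b \<in> coboundaries D e n" "F n x = b \<oplus>\<^bsub>D n\<^esub> F n y"
      using eq xy F_class F_cocycle cohomology_class_eq_iff[OF D] by metis
    have bD: "b \<in> carrier (D n)" using b(1) coboundary_cocycle[OF D] cocycle_closed[OF D] by blast
    let ?m = "\<ominus>\<^bsub>k\<^esub> \<one>\<^bsub>k\<^esub>"
    let ?z = "x \<oplus>\<^bsub>C n\<^esub> (?m \<odot>\<^bsub>C n\<^esub> y)"
    have z: "?z \<in> cocycles C d n" using xy cocycle_ops[OF C] by simp
    have "F n ?z = F n x \<oplus>\<^bsub>D n\<^esub> (?m \<odot>\<^bsub>D n\<^esub> F n y)"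
      using xyC smult additive_cochain_mapD(2)[OF F] by simp
    also have "\<dots> = b" using b(2) FC bD by (simp add: D.smult_l_minus D.M.a_assoc D.M.r_neg)
    finally have "?z \<in> coboundaries C d n" using inj[OF z] b(1) by simp
    moreover have "x = ?z \<oplus>\<^bsub>C n\<^esub> y" using xyC by (simp add: C.smult_l_minus C.M.a_assoc C.M.l_neg)
    ultimately show "X = Y" using xy cohomology_class_eq_iff[OF C] by blast
  qed
  moreover have "cohomology_map D e F n ` carrier (cohomology C d n) = carrier (cohomology D e n)"
  proof (intro equalityI subsetI)
    fix W assume "W \<in> carrier (cohomology D e n)"
    then obtain w where "w \<in> cocycles D e n" "W = cohomology_class D e n w" by (auto simp: cohomology_carrier[OF D])
    then obtain z where "z \<in> cocycles C d n" "W = cohomology_class D e n (F n z)" using surj by blast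
    then show "W \<in> cohomology_map D e F n ` carrier (cohomology C d n)"
      using F_class[of z n] by (auto simp: cohomology_carrier[OF C] intro!: image_eqI[of _ _ "cohomology_class C d n z"])
  qed (use cohomology_map_closed[OF C D F] in blast)
  ultimately show ?thesis by (simp add: linear_isos_def bij_betw_def)
qed

lemma linear_isos_inverse:
  assumes f: "f \<in> linear_isos k M N"
    and closed: "\<And>x y. \<lbrakk>x \<in> carrier M; y \<in> carrier M\<rbrakk> \<Longrightarrow> x \<oplus>\<^bsub>M\<^esub> y \<in> carrier M"
      "\<And>c x. \<lbrakk>c \<in> carrier k; x \<in> carrier M\<rbrakk> \<Longrightarrow> c \<odot>\<^bsub>M\<^esub> x \<in> carrier M"
  shows "inv_into (carrier M) f \<in> linear_isos k N M"
proof -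
  let ?g = "inv_into (carrier M) f"
  have bij: "bij_betw f (carrier M) (carrier N)" and lin: "f \<in> linear_maps k M N"
    using f by (auto simp: linear_isos_def)
  have g: "?g y \<in> carrier M" "f (?g y) = y" if "y \<in> carrier N" for y
    using that bij by (auto simp: bij_betw_def inv_into_into f_inv_into_f)
  have gf: "?g (f x) = x" if "x \<in> carrier M" for x
    using that bij by (simp add: bij_betw_def)
  have "?g \<in> linear_maps k N M"
  proof (rule linear_mapsI)
    fix x y assume xy: "x \<in> carrier N" "y \<in> carrier N"
    have "x \<oplus>\<^bsub>N\<^esub> y = f (?g x \<oplus>\<^bsub>M\<^esub> ?g y)" using linear_mapsD(2)[OF lin] g xy by simp
    then show "?g (x \<oplus>\<^bsub>N\<^esub> y) = ?g x \<oplus>\<^bsub>M\<^esub> ?g y" using gf closed g xy by simp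
  next
    fix c x assume cx: "c \<in> carrier k" "x \<in> carrier N"
    have "c \<odot>\<^bsub>N\<^esub> x = f (c \<odot>\<^bsub>M\<^esub> ?g x)" using linear_mapsD(3)[OF lin] g cx by simp
    then show "?g (c \<odot>\<^bsub>N\<^esub> x) = c \<odot>\<^bsub>M\<^esub> ?g x" using gf closed g cx by simp
  qed (rule g)
  then show ?thesis using bij_betw_inv_into[OF bij] by (simp add: linear_isos_def)
qed

section \<open>Coefficients of autopoietic cochains\<close>

text \<open>The coefficient \<open>\<lambda> (g\<^sub>1, \<dots>, g\<^sub>n)\<close> of an autopoietic cochain.\<close>

definition coefficient ::
  "('k, 'm) ring_scheme \<Rightarrow> ('g, 'n) monoid_scheme \<Rightarrow>
    ((('g \<Rightarrow> 'k) list \<Rightarrow> 'k) set \<Rightarrow> 'g \<Rightarrow> 'k) \<Rightarrow> 'g list \<Rightarrow> 'k"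
  where "coefficient k G f gs = f (group_tensor k G gs) (list_mult G gs)"

text \<open>The autopoietic cochain with prescribed coefficients.\<close>

definition AP_of ::
  "('k, 'm) ring_scheme \<Rightarrow> ('g, 'n) monoid_scheme \<Rightarrow> nat \<Rightarrow> ('g list \<Rightarrow> 'k) \<Rightarrow>
    (('g \<Rightarrow> 'k) list \<Rightarrow> 'k) set \<Rightarrow> 'g \<Rightarrow> 'k"
  where "AP_of k G n c =
    cochain_of k G n (\<lambda>gs. c gs \<odot>\<^bsub>group_ring k G\<^esub> basis_elt k (list_mult G gs))"

abbreviation sign :: "('k, 'm) ring_scheme \<Rightarrow> nat \<Rightarrow> 'k"
  where "sign k i \<equiv> (\<ominus>\<^bsub>k\<^esub> \<one>\<^bsub>k\<^esub>) [^]\<^bsub>k\<^esub> i"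

text \<open>A commutative ring \<open>k\<close> of coefficients and a group \<open>G\<close>.\<close>

locale group_coefficients = R: cring k + G: group G
  for k :: "('k, 'm) ring_scheme" and G :: "('g, 'n) monoid_scheme"
begin

abbreviation "A \<equiv> group_ring k G"

lemma sign_closed [simp]: "sign k i \<in> carrier k"
  by simp

lemma list_mult_tuple: "gs \<in> tuples (carrier G) n \<Longrightarrow> list_mult G gs \<in> carrier G"
  by (auto simp: tuples_def)

lemma scaled_basis: "c \<in> carrier k \<Longrightarrow> c \<odot>\<^bsub>A\<^esub> basis_elt k a = (\<lambda>b. if b = a then c else \<zero>\<^bsub>k\<^esub>)"
  by (auto simp: basis_elt_def fun_eq_iff)

lemma scaled_basis_in: "\<lbrakk>c \<in> carrier k; a \<in> carrier G\<rbrakk> \<Longrightarrow> (\<lambda>b. if b = a then c else \<zero>\<^bsub>k\<^esub>) \<in> carrier A"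
  by (auto simp: free_module_iff)

lemma AP_iff:
  "f \<in> carrier (AP_cochains k G n) \<longleftrightarrow> f \<in> carrier (hochschild_cochains k G n) \<and>
    (\<forall>gs\<in>tuples (carrier G) n. \<exists>c\<in>carrier k. f (group_tensor k G gs) = (\<lambda>b. if b = list_mult G gs then c else \<zero>\<^bsub>k\<^esub>))"
  by (auto simp: AP_cochains_def scaled_basis[simplified])

lemma AP_hochschild: "f \<in> carrier (AP_cochains k G n) \<Longrightarrow> f \<in> carrier (hochschild_cochains k G n)"
  by (simp add: AP_iff)

lemma
  assumes "f \<in> carrier (AP_cochains k G n)" "gs \<in> tuples (carrier G) n"
  shows coefficient_closed: "coefficient k G f gs \<in> carrier k"
    and AP_value: "f (group_tensor k G gs) = (\<lambda>b. if b = list_mult G gs then coefficient k G f gs else \<zero>\<^bsub>k\<^esub>)"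
proof -
  obtain c where c: "c \<in> carrier k" "f (group_tensor k G gs) = (\<lambda>b. if b = list_mult G gs then c else \<zero>\<^bsub>k\<^esub>)"
    using assms by (auto simp: AP_iff)
  have eq: "coefficient k G f gs = c" by (simp add: coefficient_def c)
  show "coefficient k G f gs \<in> carrier k"
    and "f (group_tensor k G gs) = (\<lambda>b. if b = list_mult G gs then coefficient k G f gs else \<zero>\<^bsub>k\<^esub>)"
    unfolding eq by (rule c)+
qed

lemma AP_eqI:
  assumes "f \<in> carrier (AP_cochains k G n)" "g \<in> carrier (AP_cochains k G n)"
    and "\<And>gs. gs \<in> tuples (carrier G) n \<Longrightarrow> coefficient k G f gs = coefficient k G g gs"
  shows "f = g"
  by (rule R.cochain_eqI[of f G n g]) (use assms AP_hochschild AP_value in auto)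

lemma
  assumes c: "\<And>gs. gs \<in> tuples (carrier G) n \<Longrightarrow> c gs \<in> carrier k"
  shows AP_of_in: "AP_of k G n c \<in> carrier (AP_cochains k G n)"
    and coefficient_AP_of: "gs \<in> tuples (carrier G) n \<Longrightarrow> coefficient k G (AP_of k G n c) gs = c gs"
proof -
  define v where "v = (\<lambda>gs. c gs \<odot>\<^bsub>A\<^esub> basis_elt k (list_mult G gs))"
  have v_eq: "v gs = (\<lambda>b. if b = list_mult G gs then c gs else \<zero>\<^bsub>k\<^esub>)" if "gs \<in> tuples (carrier G) n" for gs
    using scaled_basis[OF c[OF that]] by (simp add: v_def)
  have v: "v \<in> tuples (carrier G) n \<rightarrow> carrier A"
    using v_eq c list_mult_tuple scaled_basis_in by auto
  have eq: "AP_of k G n c = cochain_of k G n v" by (simp add: AP_of_def v_def)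
  show "AP_of k G n c \<in> carrier (AP_cochains k G n)"
    unfolding AP_iff eq using R.cochain_of[OF v] v_eq c by auto
  show "coefficient k G (AP_of k G n c) gs = c gs" if "gs \<in> tuples (carrier G) n"
    unfolding coefficient_def eq using R.cochain_of(2)[OF v that] v_eq[OF that] by simp
qed

lemma hochschild_ops:
  assumes "gs \<in> tuples (carrier G) n"
  shows "(f \<oplus>\<^bsub>hochschild_cochains k G n\<^esub> g) (group_tensor k G gs) = f (group_tensor k G gs) \<oplus>\<^bsub>A\<^esub> g (group_tensor k G gs)"
    and "(c \<odot>\<^bsub>hochschild_cochains k G n\<^esub> f) (group_tensor k G gs) = c \<odot>\<^bsub>A\<^esub> f (group_tensor k G gs)"
    and "\<zero>\<^bsub>hochschild_cochains k G n\<^esub> (group_tensor k G gs) = \<zero>\<^bsub>A\<^esub>"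
  using R.group_tensor_in[OF assms] by (simp_all add: hochschild_cochains_def hom_module_def)

lemma AP_sel:
  "f \<oplus>\<^bsub>AP_cochains k G n\<^esub> g = f \<oplus>\<^bsub>hochschild_cochains k G n\<^esub> g"
  "c \<odot>\<^bsub>AP_cochains k G n\<^esub> f = c \<odot>\<^bsub>hochschild_cochains k G n\<^esub> f"
  "\<zero>\<^bsub>AP_cochains k G n\<^esub> = \<zero>\<^bsub>hochschild_cochains k G n\<^esub>"
  by (simp_all add: AP_cochains_def)

lemma coefficient_add: "gs \<in> tuples (carrier G) n \<Longrightarrow>
    coefficient k G (f \<oplus>\<^bsub>AP_cochains k G n\<^esub> g) gs = coefficient k G f gs \<oplus>\<^bsub>k\<^esub> coefficient k G g gs"
  by (simp add: coefficient_def AP_sel hochschild_ops)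

lemma coefficient_smult: "gs \<in> tuples (carrier G) n \<Longrightarrow>
    coefficient k G (c \<odot>\<^bsub>AP_cochains k G n\<^esub> f) gs = c \<otimes>\<^bsub>k\<^esub> coefficient k G f gs"
  by (simp add: coefficient_def AP_sel hochschild_ops)

lemma coefficient_zero: "gs \<in> tuples (carrier G) n \<Longrightarrow> coefficient k G \<zero>\<^bsub>AP_cochains k G n\<^esub> gs = \<zero>\<^bsub>k\<^esub>"
  by (simp add: coefficient_def AP_sel hochschild_ops)

lemma module_AP: "module k (AP_cochains k G n)"
proof -
  interpret H: module k "hochschild_cochains k G n" by (rule R.module_hochschild)
  have add: "f \<oplus>\<^bsub>hochschild_cochains k G n\<^esub> g \<in> carrier (AP_cochains k G n)"
    if f: "f \<in> carrier (AP_cochains k G n)" and g: "g \<in> carrier (AP_cochains k G n)" for f g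
    unfolding AP_iff
  proof (intro conjI ballI)
    fix gs assume gs: "gs \<in> tuples (carrier G) n"
    show "\<exists>c\<in>carrier k. (f \<oplus>\<^bsub>hochschild_cochains k G n\<^esub> g) (group_tensor k G gs) =
        (\<lambda>b. if b = list_mult G gs then c else \<zero>\<^bsub>k\<^esub>)"
      by (rule bexI[where x = "coefficient k G f gs \<oplus>\<^bsub>k\<^esub> coefficient k G g gs"])
        (use gs f g in \<open>auto simp: hochschild_ops AP_value coefficient_closed fun_eq_iff\<close>)
  qed (use f g AP_hochschild in simp)
  have smult: "c \<odot>\<^bsub>hochschild_cochains k G n\<^esub> f \<in> carrier (AP_cochains k G n)"
    if c: "c \<in> carrier k" and f: "f \<in> carrier (AP_cochains k G n)" for c f
    unfolding AP_iff
  proof (intro conjI ballI)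
    fix gs assume gs: "gs \<in> tuples (carrier G) n"
    show "\<exists>a\<in>carrier k. (c \<odot>\<^bsub>hochschild_cochains k G n\<^esub> f) (group_tensor k G gs) =
        (\<lambda>b. if b = list_mult G gs then a else \<zero>\<^bsub>k\<^esub>)"
      by (rule bexI[where x = "c \<otimes>\<^bsub>k\<^esub> coefficient k G f gs"])
        (use gs f c in \<open>auto simp: hochschild_ops AP_value coefficient_closed fun_eq_iff\<close>)
  qed (use c f AP_hochschild in simp)
  have "submodule (carrier (AP_cochains k G n)) k (hochschild_cochains k G n)"
  proof (rule H.submoduleI)
    show "\<zero>\<^bsub>hochschild_cochains k G n\<^esub> \<in> carrier (AP_cochains k G n)"
      unfolding AP_iff
    proof (intro conjI ballI)
      fix gs assume gs: "gs \<in> tuples (carrier G) n"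
      show "\<exists>a\<in>carrier k. \<zero>\<^bsub>hochschild_cochains k G n\<^esub> (group_tensor k G gs) =
          (\<lambda>b. if b = list_mult G gs then a else \<zero>\<^bsub>k\<^esub>)"
        by (rule bexI[where x = "\<zero>\<^bsub>k\<^esub>"]) (use gs in \<open>auto simp: hochschild_ops fun_eq_iff\<close>)
    qed simp
    show "\<ominus>\<^bsub>hochschild_cochains k G n\<^esub> f \<in> carrier (AP_cochains k G n)" if f: "f \<in> carrier (AP_cochains k G n)" for f
      using smult[OF _ f, of "\<ominus>\<^bsub>k\<^esub> \<one>\<^bsub>k\<^esub>"] AP_hochschild[OF f] by (simp add: H.smult_l_minus)
  qed (use add smult AP_hochschild in auto)
  then have "module k ((hochschild_cochains k G n)\<lparr>carrier := carrier (AP_cochains k G n)\<rparr>)"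
    by (rule submodule.submodule_is_module[OF _ R.module_hochschild])
  then show ?thesis by (simp add: AP_cochains_def)
qed

lemma group_ring_mult: "(x \<otimes>\<^bsub>A\<^esub> y) g = (if g \<in> carrier G then
    (\<Oplus>\<^bsub>k\<^esub>h\<in>{h \<in> carrier G. x h \<noteq> \<zero>\<^bsub>k\<^esub>}. x h \<otimes>\<^bsub>k\<^esub> y (inv\<^bsub>G\<^esub> h \<otimes>\<^bsub>G\<^esub> g)) else \<zero>\<^bsub>k\<^esub>)"
  by (simp add: group_ring_def)

text \<open>In the zero ring the basis elements vanish and have empty support, so that this ring needs
  attention in the next two lemmas.\<close>

lemma one_eq_zero: "\<lbrakk>\<one>\<^bsub>k\<^esub> = \<zero>\<^bsub>k\<^esub>; c \<in> carrier k\<rbrakk> \<Longrightarrow> c = \<zero>\<^bsub>k\<^esub>"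
  by (metis R.r_null R.r_one)

lemma group_ring_mult_left:
  assumes "c \<in> carrier k" "a \<in> carrier G" "b \<in> carrier G"
  shows "basis_elt k a \<otimes>\<^bsub>A\<^esub> (\<lambda>x. if x = b then c else \<zero>\<^bsub>k\<^esub>) = (\<lambda>x. if x = a \<otimes>\<^bsub>G\<^esub> b then c else \<zero>\<^bsub>k\<^esub>)"
proof
  fix g
  let ?y = "\<lambda>x. if x = b then c else \<zero>\<^bsub>k\<^esub>"
  have "(\<Oplus>\<^bsub>k\<^esub>h\<in>{h \<in> carrier G. basis_elt k a h \<noteq> \<zero>\<^bsub>k\<^esub>}. basis_elt k a h \<otimes>\<^bsub>k\<^esub> ?y (inv\<^bsub>G\<^esub> h \<otimes>\<^bsub>G\<^esub> g)) =
      (\<Oplus>\<^bsub>k\<^esub>h\<in>{a}. basis_elt k a h \<otimes>\<^bsub>k\<^esub> ?y (inv\<^bsub>G\<^esub> h \<otimes>\<^bsub>G\<^esub> g))"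
    by (rule R.add.finprod_mono_neutral_cong_left)
      (use assms one_eq_zero in \<open>auto simp: basis_elt_def simp del: G.inv_closed\<close>)
  also have "\<dots> = ?y (inv\<^bsub>G\<^esub> a \<otimes>\<^bsub>G\<^esub> g)" using assms by (simp add: basis_elt_def)
  finally show "(basis_elt k a \<otimes>\<^bsub>A\<^esub> ?y) g = (if g = a \<otimes>\<^bsub>G\<^esub> b then c else \<zero>\<^bsub>k\<^esub>)"
    unfolding group_ring_mult by (simp only:) (use assms G.cancel_inv_left in auto)
qed

lemma group_ring_mult_right:
  assumes "c \<in> carrier k" "a \<in> carrier G" "b \<in> carrier G"
  shows "(\<lambda>x. if x = b then c else \<zero>\<^bsub>k\<^esub>) \<otimes>\<^bsub>A\<^esub> basis_elt k a = (\<lambda>x. if x = b \<otimes>\<^bsub>G\<^esub> a then c else \<zero>\<^bsub>k\<^esub>)"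
proof
  fix g
  let ?y = "\<lambda>x. if x = b then c else \<zero>\<^bsub>k\<^esub>"
  have "(\<Oplus>\<^bsub>k\<^esub>h\<in>{h \<in> carrier G. ?y h \<noteq> \<zero>\<^bsub>k\<^esub>}. ?y h \<otimes>\<^bsub>k\<^esub> basis_elt k a (inv\<^bsub>G\<^esub> h \<otimes>\<^bsub>G\<^esub> g)) =
      (\<Oplus>\<^bsub>k\<^esub>h\<in>{b}. ?y h \<otimes>\<^bsub>k\<^esub> basis_elt k a (inv\<^bsub>G\<^esub> h \<otimes>\<^bsub>G\<^esub> g))"
    by (rule R.add.finprod_mono_neutral_cong_left)
      (use assms one_eq_zero in \<open>auto simp: basis_elt_def simp del: G.inv_closed\<close>)
  also have "\<dots> = c \<otimes>\<^bsub>k\<^esub> basis_elt k a (inv\<^bsub>G\<^esub> b \<otimes>\<^bsub>G\<^esub> g)" using assms by (simp add: basis_elt_def)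
  finally show "(?y \<otimes>\<^bsub>A\<^esub> basis_elt k a) g = (if g = b \<otimes>\<^bsub>G\<^esub> a then c else \<zero>\<^bsub>k\<^esub>)"
    unfolding group_ring_mult by (simp only:) (use assms G.cancel_inv_left in \<open>auto simp: basis_elt_def\<close>)
qed

lemma finsum_group_ring_apply:
  assumes "finite I" "\<And>i. i \<in> I \<Longrightarrow> F i \<in> carrier A"
  shows "(\<Oplus>\<^bsub>A\<^esub>i\<in>I. F i) g = (\<Oplus>\<^bsub>k\<^esub>i\<in>I. F i g)"
proof -
  interpret A: module k A by (rule R.module_group_ring)
  show ?thesis
    using assms
  proof (induction I rule: finite_induct)
    case (insert i I)
    have "F j g \<in> carrier k" if "j \<in> insert i I" for j
      using insert.prems[OF that] R.free_val[of "F j" "carrier G" g] by simp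
    then show ?case using insert by (simp add: Pi_iff del: group_ring_sel(1))
  qed simp
qed

lemma nerve_face_in:
  assumes "gs \<in> tuples (carrier G) (Suc n)" "i \<le> Suc n"
  shows "face (nerve G) (Suc n) i gs \<in> tuples (carrier G) n"
proof -
  obtain hs where hs: "hs \<in> tuples (carrier G) (Suc (Suc n))" "quotients G hs = gs"
    using G.quotients_surj[OF assms(1)] by blast
  have "take i hs @ drop (Suc i) hs \<in> tuples (carrier G) (Suc n)"
    using hs(1) assms(2) by (auto simp: tuples_def dest: in_set_takeD in_set_dropD)
  then show ?thesis using G.quotients_in G.quotients_face[OF hs(1) assms(2)] hs(2) by metis
qed

lemma list_mult_merge_at:
  assumes "gs \<in> tuples (carrier G) (Suc n)" "1 \<le> i" "i \<le> n"
  shows "list_mult G (merge_at G i gs) = list_mult G gs"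
proof -
  have gs: "set gs \<subseteq> carrier G" "length gs = Suc n" using assms(1) by (auto simp: tuples_def)
  have T: "set (take j gs) \<subseteq> carrier G" "set (drop j gs) \<subseteq> carrier G" for j
    using gs by (meson order_trans set_take_subset set_drop_subset)+
  have c: "gs ! (i - 1) \<in> carrier G" "gs ! i \<in> carrier G" using assms by (auto intro: tuples_nth)
  have "drop (i - 1) gs = gs ! (i - 1) # gs ! i # drop (Suc i) gs"
    using assms gs Cons_nth_drop_Suc[of "i - 1" gs] Cons_nth_drop_Suc[of i gs] by simp
  then have "gs = take (i - 1) gs @ gs ! (i - 1) # gs ! i # drop (Suc i) gs"
    using append_take_drop_id[of "i - 1" gs] by simp
  then have "list_mult G gs = list_mult G (take (i - 1) gs @ gs ! (i - 1) # gs ! i # drop (Suc i) gs)" by simp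
  also have "\<dots> = list_mult G (merge_at G i gs)"
    using c T by (simp add: merge_at_def G.list_mult_append G.m_assoc)
  finally show ?thesis by simp
qed

text \<open>On coefficients, the Hochschild differential is the coboundary of the nerve.\<close>

lemma
  assumes f: "f \<in> carrier (AP_cochains k G n)"
  shows hochschild_diff_AP: "hochschild_diff k G n f \<in> carrier (AP_cochains k G (Suc n))"
    and coefficient_hochschild_diff: "gs \<in> tuples (carrier G) (Suc n) \<Longrightarrow>
      coefficient k G (hochschild_diff k G n f) gs =
      (\<Oplus>\<^bsub>k\<^esub>i\<in>{..Suc n}. sign k i \<otimes>\<^bsub>k\<^esub> coefficient k G f (face (nerve G) (Suc n) i gs))"
proof -
  define D where "D gs = (\<Oplus>\<^bsub>k\<^esub>i\<in>{..Suc n}. sign k i \<otimes>\<^bsub>k\<^esub> coefficient k G f (face (nerve G) (Suc n) i gs))" for gs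
  have cf: "coefficient k G f (face (nerve G) (Suc n) i gs) \<in> carrier k"
    if "gs \<in> tuples (carrier G) (Suc n)" "i \<le> Suc n" for gs i
    by (rule coefficient_closed[OF f nerve_face_in[OF that]])
  have Dc: "D gs \<in> carrier k" if "gs \<in> tuples (carrier G) (Suc n)" for gs
    unfolding D_def by (rule R.finsum_closed) (use cf[OF that] in auto)
  define v where "v gs =
       (basis_elt k (hd gs) \<otimes>\<^bsub>A\<^esub> f (group_tensor k G (tl gs)))
       \<oplus>\<^bsub>A\<^esub> (\<Oplus>\<^bsub>A\<^esub>i\<in>{1..n}. sign k i \<odot>\<^bsub>A\<^esub> f (group_tensor k G (merge_at G i gs)))
       \<oplus>\<^bsub>A\<^esub> (sign k (Suc n) \<odot>\<^bsub>A\<^esub> (f (group_tensor k G (butlast gs)) \<otimes>\<^bsub>A\<^esub> basis_elt k (last gs)))" for gs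
  have v: "v gs = D gs \<odot>\<^bsub>A\<^esub> basis_elt k (list_mult G gs)" if gs: "gs \<in> tuples (carrier G) (Suc n)" for gs
  proof
    fix x
    let ?g = "list_mult G gs"
    let ?c = "\<lambda>i. coefficient k G f (face (nerve G) (Suc n) i gs)"
    obtain a as where as: "gs = a # as" "a \<in> carrier G" "as \<in> tuples (carrier G) n" using gs by (rule tuples_SucE)
    have gsC: "set gs \<subseteq> carrier G" "length gs = Suc n" "gs \<noteq> []" using gs by (auto simp: tuples_def)
    have bl: "butlast gs \<in> tuples (carrier G) n" "last gs \<in> carrier G"
      using gsC by (auto simp: tuples_def dest: in_set_butlastD)
    have lm_bl: "list_mult G (butlast gs) \<otimes>\<^bsub>G\<^esub> last gs = ?g"
    proof -
      have "?g = list_mult G (butlast gs @ [last gs])" using gsC by simp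
      also have "\<dots> = list_mult G (butlast gs) \<otimes>\<^bsub>G\<^esub> last gs"
        using bl by (subst G.list_mult_append) (auto simp: tuples_def)
      finally show ?thesis by simp
    qed
    have c0: "?c 0 = coefficient k G f as" by (simp add: nerve_sel as)
    have c1: "?c i = coefficient k G f (merge_at G i gs)" if "i \<in> {1..n}" for i
      using that by (simp add: nerve_sel)
    have c2: "?c (Suc n) = coefficient k G f (butlast gs)" by (simp add: nerve_sel)
    have t0: "basis_elt k (hd gs) \<otimes>\<^bsub>A\<^esub> f (group_tensor k G (tl gs)) = (\<lambda>x. if x = ?g then ?c 0 else \<zero>\<^bsub>k\<^esub>)"
      using AP_value[OF f as(3)] group_ring_mult_left[OF coefficient_closed[OF f as(3)] as(2) list_mult_tuple[OF as(3)]]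
      unfolding c0 by (simp add: as(1))
    have t1: "f (group_tensor k G (merge_at G i gs)) = (\<lambda>x. if x = ?g then ?c i else \<zero>\<^bsub>k\<^esub>)" if i: "i \<in> {1..n}" for i
    proof -
      have "merge_at G i gs \<in> tuples (carrier G) n"
        using nerve_face_in[OF gs, of i] i by (simp add: nerve_sel)
      from AP_value[OF f this] show ?thesis
        unfolding c1[OF i] using list_mult_merge_at[OF gs, of i] i by simp
    qed
    have t2: "f (group_tensor k G (butlast gs)) \<otimes>\<^bsub>A\<^esub> basis_elt k (last gs) = (\<lambda>x. if x = ?g then ?c (Suc n) else \<zero>\<^bsub>k\<^esub>)"
      using AP_value[OF f bl(1)] group_ring_mult_right[OF coefficient_closed[OF f bl(1)] bl(2) list_mult_tuple[OF bl(1)]]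
      unfolding c2 by (simp add: lm_bl)
    have cc: "?c i \<in> carrier k" if "i \<le> Suc n" for i by (rule cf[OF gs that])
    have gC: "?g \<in> carrier G" by (rule list_mult_tuple[OF gs])
    have "(\<Oplus>\<^bsub>A\<^esub>i\<in>{1..n}. sign k i \<odot>\<^bsub>A\<^esub> f (group_tensor k G (merge_at G i gs))) x =
        (\<Oplus>\<^bsub>k\<^esub>i\<in>{1..n}. (sign k i \<odot>\<^bsub>A\<^esub> f (group_tensor k G (merge_at G i gs))) x)"
    proof (rule finsum_group_ring_apply)
      fix i assume i: "i \<in> {1..n}"
      show "sign k i \<odot>\<^bsub>A\<^esub> f (group_tensor k G (merge_at G i gs)) \<in> carrier A"
        unfolding t1[OF i] by (intro module.smult_closed[OF R.module_group_ring] scaled_basis_in) (use i gC cc in auto)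
    qed simp
    also have "\<dots> = (\<Oplus>\<^bsub>k\<^esub>i\<in>{1..n}. sign k i \<otimes>\<^bsub>k\<^esub> (if x = ?g then ?c i else \<zero>\<^bsub>k\<^esub>))"
      by (rule R.finsum_cong') (use cc t1 in auto)
    finally have vx: "v gs x = (if x = ?g then ?c 0 else \<zero>\<^bsub>k\<^esub>)
       \<oplus>\<^bsub>k\<^esub> (\<Oplus>\<^bsub>k\<^esub>i\<in>{1..n}. sign k i \<otimes>\<^bsub>k\<^esub> (if x = ?g then ?c i else \<zero>\<^bsub>k\<^esub>))
       \<oplus>\<^bsub>k\<^esub> (sign k (Suc n) \<otimes>\<^bsub>k\<^esub> (if x = ?g then ?c (Suc n) else \<zero>\<^bsub>k\<^esub>))"
      unfolding v_def t0 t2 by simp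
    show "v gs x = (D gs \<odot>\<^bsub>A\<^esub> basis_elt k ?g) x"
    proof (cases "x = ?g")
      case True
      have I: "{..Suc n} = insert 0 (insert (Suc n) {1..n})" by auto
      have "D gs = ?c 0 \<oplus>\<^bsub>k\<^esub> (sign k (Suc n) \<otimes>\<^bsub>k\<^esub> ?c (Suc n) \<oplus>\<^bsub>k\<^esub> (\<Oplus>\<^bsub>k\<^esub>i\<in>{1..n}. sign k i \<otimes>\<^bsub>k\<^esub> ?c i))"
        unfolding D_def I using cc by (subst R.finsum_insert; (subst R.finsum_insert)?) (auto simp: Pi_iff)
      moreover have "(\<Oplus>\<^bsub>k\<^esub>i\<in>{1..n}. sign k i \<otimes>\<^bsub>k\<^esub> ?c i) \<in> carrier k"
        by (rule R.finsum_closed) (use cc in auto)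
      ultimately have "v gs x = D gs" unfolding vx using True cc by (simp add: R.a_ac)
      then show ?thesis using scaled_basis[OF Dc[OF gs], of ?g] True by metis
    next
      case False
      have "(\<Oplus>\<^bsub>k\<^esub>i\<in>{1..n}. sign k i \<otimes>\<^bsub>k\<^esub> \<zero>\<^bsub>k\<^esub>) = \<zero>\<^bsub>k\<^esub>"
        by (rule R.add.finprod_one_eqI) simp
      then have "v gs x = \<zero>\<^bsub>k\<^esub>" unfolding vx using False by simp
      then show ?thesis using scaled_basis[OF Dc[OF gs], of ?g] False by metis
    qed
  qed
  have vA: "v \<in> tuples (carrier G) (Suc n) \<rightarrow> carrier A"
  proof
    fix gs assume gs: "gs \<in> tuples (carrier G) (Suc n)"
    show "v gs \<in> carrier A"
      unfolding v[OF gs] scaled_basis[OF Dc[OF gs]] by (rule scaled_basis_in[OF Dc[OF gs] list_mult_tuple[OF gs]])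
  qed
  have eq: "hochschild_diff k G n f = cochain_of k G (Suc n) v"
    unfolding hochschild_diff_def Let_def v_def[abs_def] ..
  have val: "hochschild_diff k G n f (group_tensor k G gs) = (\<lambda>b. if b = list_mult G gs then D gs else \<zero>\<^bsub>k\<^esub>)"
    if gs: "gs \<in> tuples (carrier G) (Suc n)" for gs
    unfolding eq R.cochain_of(2)[OF vA gs] v[OF gs] by (rule scaled_basis[OF Dc[OF gs]])
  show "hochschild_diff k G n f \<in> carrier (AP_cochains k G (Suc n))"
    unfolding AP_iff using val Dc R.cochain_of(1)[OF vA] eq by auto
  show "coefficient k G (hochschild_diff k G n f) gs = (\<Oplus>\<^bsub>k\<^esub>i\<in>{..Suc n}. sign k i \<otimes>\<^bsub>k\<^esub> coefficient k G f (face (nerve G) (Suc n) i gs))"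
    if "gs \<in> tuples (carrier G) (Suc n)"
    using val[OF that] by (simp add: coefficient_def D_def)
qed

end

section \<open>Singular cochains\<close>

context cring
begin

lemma singular_cochainD:
  assumes "u \<in> carrier (singular_cochains R X p)"
  shows "singular_chain p X c \<Longrightarrow> u c \<in> carrier R"
    and "\<lbrakk>singular_chain p X c; singular_chain p X c'\<rbrakk> \<Longrightarrow> u (c + c') = u c \<oplus> u c'"
    and "u \<in> extensional (singular_chain_set p X)"
  using assms by (auto simp: singular_cochains_def hom_def)

lemma singular_cochainI:
  assumes "\<And>c. singular_chain p X c \<Longrightarrow> u c \<in> carrier R"
    and "\<And>c c'. \<lbrakk>singular_chain p X c; singular_chain p X c'\<rbrakk> \<Longrightarrow> u (c + c') = u c \<oplus> u c'"
    and "u \<in> extensional (singular_chain_set p X)"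
  shows "u \<in> carrier (singular_cochains R X p)"
  using assms by (auto simp: singular_cochains_def hom_def)

lemma singular_cochains_sel [simp]:
  "u \<oplus>\<^bsub>singular_cochains R X p\<^esub> v = (\<lambda>c\<in>singular_chain_set p X. u c \<oplus> v c)"
  "a \<odot>\<^bsub>singular_cochains R X p\<^esub> u = (\<lambda>c\<in>singular_chain_set p X. a \<otimes> u c)"
  "\<zero>\<^bsub>singular_cochains R X p\<^esub> = (\<lambda>c\<in>singular_chain_set p X. \<zero>)"
  by (simp_all add: singular_cochains_def)

lemma singular_cochain_zero:
  assumes "u \<in> carrier (singular_cochains R X p)"
  shows "u 0 = \<zero>"
proof -
  have "u 0 \<oplus> u 0 = u 0" using singular_cochainD(2)[OF assms, of 0 0] by simp
  then show ?thesis using singular_cochainD(1)[OF assms, of 0] by (metis add.l_cancel_one' singular_chain_0)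
qed

lemma singular_cochain_minus:
  assumes u: "u \<in> carrier (singular_cochains R X p)" and c: "singular_chain p X c"
  shows "u (- c) = \<ominus> u c"
proof -
  have c': "singular_chain p X (- c)" using c by (simp add: singular_chain_minus)
  have "u (- c) \<oplus> u c = \<zero>"
    using singular_cochainD(2)[OF u c' c] singular_cochain_zero[OF u] by simp
  then show ?thesis using singular_cochainD(1)[OF u] c c' by (metis minus_equality)
qed

lemma singular_cochain_diff:
  assumes u: "u \<in> carrier (singular_cochains R X p)" and c: "singular_chain p X c" "singular_chain p X c'"
  shows "u (c - c') = u c \<ominus> u c'"
  using singular_cochainD(2)[OF u c(1), of "- c'"] singular_cochain_minus[OF u c(2)] c
  by (simp add: singular_chain_minus a_minus_def)

lemma singular_cochain_sign:
  assumes u: "u \<in> carrier (singular_cochains R X p)" and c: "singular_chain p X c"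
  shows "u (frag_cmul ((-1) ^ i) c) = (\<ominus> \<one>) [^] i \<otimes> u c"
proof (induction i)
  case 0
  then show ?case using singular_cochainD(1)[OF u c] by simp
next
  case (Suc i)
  have "frag_cmul ((-1) ^ Suc i) c = - frag_cmul ((-1) ^ i) c" by simp
  then have "u (frag_cmul ((-1) ^ Suc i) c) = \<ominus> u (frag_cmul ((-1) ^ i) c)"
    using singular_cochain_minus[OF u singular_chain_cmul[OF c]] by metis
  then show ?case using Suc singular_cochainD(1)[OF u c] by (simp add: l_minus r_minus)
qed

lemma singular_cochain_sum:
  assumes u: "u \<in> carrier (singular_cochains R X p)" and I: "finite I" "\<And>i. i \<in> I \<Longrightarrow> singular_chain p X (c i)"
  shows "u (\<Sum>i\<in>I. c i) = (\<Oplus>i\<in>I. u (c i))"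
  using I
proof (induction I rule: finite_induct)
  case empty
  then show ?case using singular_cochain_zero[OF u] by simp
next
  case (insert i I)
  then show ?case
    using singular_cochainD[OF u] by (simp add: Pi_iff singular_chain_sum)
qed

lemma singular_cochain_boundary:
  assumes u: "u \<in> carrier (singular_cochains R X p)" and \<sigma>: "singular_simplex (Suc p) X \<sigma>"
  shows "u (chain_boundary (Suc p) (frag_of \<sigma>)) =
    (\<Oplus>i\<in>{..Suc p}. (\<ominus> \<one>) [^] i \<otimes> u (frag_of (singular_face (Suc p) i \<sigma>)))"
proof -
  have f: "singular_chain p X (frag_of (singular_face (Suc p) i \<sigma>))" if "i \<le> Suc p" for i
    using singular_simplex_singular_face[OF \<sigma> _ that] by (simp add: singular_chain_of)
  have "u (chain_boundary (Suc p) (frag_of \<sigma>)) =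
      (\<Oplus>i\<in>{..Suc p}. u (frag_cmul ((-1) ^ i) (frag_of (singular_face (Suc p) i \<sigma>))))"
    by (simp only: chain_boundary_of nat.simps if_False)
      (rule singular_cochain_sum[OF u], auto intro!: singular_chain_cmul f)
  also have "\<dots> = (\<Oplus>i\<in>{..Suc p}. (\<ominus> \<one>) [^] i \<otimes> u (frag_of (singular_face (Suc p) i \<sigma>)))"
    by (rule finsum_cong') (use f singular_cochain_sign[OF u] singular_cochainD(1)[OF u] in auto)
  finally show ?thesis .
qed

lemma singular_cochain_eqI:
  assumes u: "u \<in> carrier (singular_cochains R X p)" and v: "v \<in> carrier (singular_cochains R X p)"
    and eq: "\<And>\<sigma>. singular_simplex p X \<sigma> \<Longrightarrow> u (frag_of \<sigma>) = v (frag_of \<sigma>)"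
  shows "u = v"
proof (rule extensionalityI[OF singular_cochainD(3)[OF u] singular_cochainD(3)[OF v]])
  fix c assume "c \<in> singular_chain_set p X"
  then have "Poly_Mapping.keys c \<subseteq> singular_simplex_set p X" by (simp add: singular_chain_def)
  then have "singular_chain p X c \<and> u c = v c"
  proof (induction c rule: frag_induction)
    case zero
    then show ?case using u v by (simp add: singular_cochain_zero)
  next
    case (one x)
    then show ?case using eq by (simp add: singular_chain_of)
  next
    case (diff a b)
    then show ?case using u v by (simp add: singular_cochain_diff singular_chain_diff)
  qed
  then show "u c = v c" ..
qed

lemma singular_cochain_exists:
  assumes "\<And>\<sigma>. singular_simplex p X \<sigma> \<Longrightarrow> c \<sigma> \<in> carrier R"
  shows "\<exists>u\<in>carrier (singular_cochains R X p). \<forall>\<sigma>. singular_simplex p X \<sigma> \<longrightarrow> u (frag_of \<sigma>) = c \<sigma>"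
proof -
  have im: "c ` singular_simplex_set p X \<subseteq> carrier (add_monoid R)" using assms by auto
  obtain h where h: "h \<in> hom (free_Abelian_group (singular_simplex_set p X)) (add_monoid R)"
    "\<And>\<sigma>. \<sigma> \<in> singular_simplex_set p X \<Longrightarrow> h (frag_of \<sigma>) = c \<sigma>"
    using comm_group.free_Abelian_group_universal[OF a_comm_group im] by metis
  have H: "h x \<in> carrier R" "singular_chain p X y \<Longrightarrow> h (x + y) = h x \<oplus> h y" if "singular_chain p X x" for x y
    using h(1) that by (auto simp: hom_def singular_chain_def)
  show ?thesis
  proof (intro bexI)
    show "restrict h (singular_chain_set p X) \<in> carrier (singular_cochains R X p)"
      by (rule singular_cochainI) (auto simp: H singular_chain_add)
    show "\<forall>\<sigma>. singular_simplex p X \<sigma> \<longrightarrow> restrict h (singular_chain_set p X) (frag_of \<sigma>) = c \<sigma>"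
      using h(2) by (simp add: singular_chain_of)
  qed
qed

lemma module_singular: "module R (singular_cochains R X p)"
proof (rule function_module[OF module_self, where D = "singular_chain_set p X"])
  fix u v assume uv: "u \<in> carrier (singular_cochains R X p)" "v \<in> carrier (singular_cochains R X p)"
  note D = singular_cochainD[OF uv(1)] singular_cochainD[OF uv(2)]
  show "u = v" if "\<And>c. c \<in> singular_chain_set p X \<Longrightarrow> u c = v c"
    by (rule extensionalityI[OF D(3) D(6)]) (rule that)
  show "u \<oplus>\<^bsub>singular_cochains R X p\<^esub> v \<in> carrier (singular_cochains R X p)"
    by (rule singular_cochainI) (auto simp: D singular_chain_add a_ac)
  show "a \<odot>\<^bsub>singular_cochains R X p\<^esub> u \<in> carrier (singular_cochains R X p)" if "a \<in> carrier R" for a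
    by (rule singular_cochainI) (use that in \<open>auto simp: D singular_chain_add r_distr\<close>)
next
  show "\<zero>\<^bsub>singular_cochains R X p\<^esub> \<in> carrier (singular_cochains R X p)"
    by (rule singular_cochainI) (auto simp: singular_chain_add)
qed (auto dest: singular_cochainD(1))

lemma singular_codiff_eq: "singular_chain (Suc p) X c \<Longrightarrow> singular_codiff X p u c = u (chain_boundary (Suc p) c)"
  by (simp add: singular_codiff_def)

lemma singular_codiff_closed:
  assumes u: "u \<in> carrier (singular_cochains R X p)"
  shows "singular_codiff X p u \<in> carrier (singular_cochains R X (Suc p))"
  by (rule singular_cochainI)
    (auto simp: singular_codiff_eq singular_chain_boundary_alt singular_cochainD[OF u] singular_chain_add chain_boundary_add,
      simp add: singular_codiff_def)

lemma singular_complex: "cochain_complex R (singular_cochains R X) (singular_codiff X)"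
  unfolding cochain_complex_def
proof (intro conjI allI ballI)
  fix p
  show "module R (singular_cochains R X p)" by (rule module_singular)
  show "singular_codiff X p \<in> linear_maps R (singular_cochains R X p) (singular_cochains R X (Suc p))"
    by (rule linear_mapsI)
      (auto simp: singular_codiff_closed, auto simp: singular_codiff_def fun_eq_iff restrict_def singular_chain_boundary_alt)
  fix u assume u: "u \<in> carrier (singular_cochains R X p)"
  show "singular_codiff X (Suc p) (singular_codiff X p u) = \<zero>\<^bsub>singular_cochains R X (Suc (Suc p))\<^esub>"
  proof
    fix c
    show "singular_codiff X (Suc p) (singular_codiff X p u) c = \<zero>\<^bsub>singular_cochains R X (Suc (Suc p))\<^esub> c"
      using chain_boundary_boundary_alt[of "Suc p" X c] singular_cochain_zero[OF u]
      by (auto simp: singular_codiff_def restrict_def singular_chain_boundary_alt)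
  qed
qed

end

section \<open>Comparison of the two complexes\<close>

text \<open>The cochain map from singular cochains of the classifying space to autopoietic cochains: the
  coefficient at \<open>(g\<^sub>1, \<dots>, g\<^sub>n)\<close> is the value on the characteristic map of that simplex of the nerve.\<close>

definition cell_evaluation ::
  "('k, 'm) ring_scheme \<Rightarrow> ('g, 'n) monoid_scheme \<Rightarrow> nat \<Rightarrow>
    (((nat \<times> 'g list) \<times> (nat \<Rightarrow> real)) set chain \<Rightarrow> 'k) \<Rightarrow> (('g \<Rightarrow> 'k) list \<Rightarrow> 'k) set \<Rightarrow> 'g \<Rightarrow> 'k"
  where "cell_evaluation k G n u = AP_of k G n (\<lambda>gs. u (frag_of (cell (nerve G) n gs)))"

context group_coefficients
begin

abbreviation "BG \<equiv> classifying_space G"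

lemma cell_simplex: "gs \<in> tuples (carrier G) n \<Longrightarrow> singular_simplex n BG (cell (nerve G) n gs)"
  unfolding classifying_space_def by (rule singular_simplex_cell) (simp add: nerve_sel)

lemma
  assumes u: "u \<in> carrier (singular_cochains k BG n)"
  shows cell_evaluation_in: "cell_evaluation k G n u \<in> carrier (AP_cochains k G n)"
    and coefficient_cell_evaluation: "gs \<in> tuples (carrier G) n \<Longrightarrow>
      coefficient k G (cell_evaluation k G n u) gs = u (frag_of (cell (nerve G) n gs))"
proof -
  have c: "u (frag_of (cell (nerve G) n gs)) \<in> carrier k" if "gs \<in> tuples (carrier G) n" for gs
    by (rule R.singular_cochainD(1)[OF u]) (simp add: singular_chain_of cell_simplex[OF that])
  show "cell_evaluation k G n u \<in> carrier (AP_cochains k G n)"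
    unfolding cell_evaluation_def by (rule AP_of_in) (rule c)
  show "coefficient k G (cell_evaluation k G n u) gs = u (frag_of (cell (nerve G) n gs))" if "gs \<in> tuples (carrier G) n"
    unfolding cell_evaluation_def using c that by (rule coefficient_AP_of)
qed

lemma cell_evaluation_add:
  assumes u: "u \<in> carrier (singular_cochains k BG n)" and v: "v \<in> carrier (singular_cochains k BG n)"
  shows "cell_evaluation k G n (u \<oplus>\<^bsub>singular_cochains k BG n\<^esub> v) =
    cell_evaluation k G n u \<oplus>\<^bsub>AP_cochains k G n\<^esub> cell_evaluation k G n v"
proof -
  interpret S: module k "singular_cochains k BG n" by (rule R.module_singular)
  interpret P: module k "AP_cochains k G n" by (rule module_AP)
  show ?thesis
    by (rule AP_eqI[of _ n])
      (use S.M.a_closed[OF u v] in \<open>auto simp: cell_evaluation_in u v coefficient_cell_evaluation coefficient_add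
        singular_chain_of cell_simplex simp del: R.singular_cochains_sel\<close>, simp add: singular_chain_of cell_simplex)
qed

lemma cell_evaluation_smult:
  assumes u: "u \<in> carrier (singular_cochains k BG n)" and c: "c \<in> carrier k"
  shows "cell_evaluation k G n (c \<odot>\<^bsub>singular_cochains k BG n\<^esub> u) = c \<odot>\<^bsub>AP_cochains k G n\<^esub> cell_evaluation k G n u"
proof -
  interpret S: module k "singular_cochains k BG n" by (rule R.module_singular)
  interpret P: module k "AP_cochains k G n" by (rule module_AP)
  show ?thesis
    by (rule AP_eqI[of _ n])
      (use S.smult_closed[OF c u] c in \<open>auto simp: cell_evaluation_in u coefficient_cell_evaluation coefficient_smult
        singular_chain_of cell_simplex simp del: R.singular_cochains_sel\<close>, simp add: singular_chain_of cell_simplex)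
qed

lemma cell_evaluation_diff:
  assumes u: "u \<in> carrier (singular_cochains k BG n)"
  shows "cell_evaluation k G (Suc n) (singular_codiff BG n u) = hochschild_diff k G n (cell_evaluation k G n u)"
proof (rule AP_eqI[of _ "Suc n"])
  note du = R.singular_codiff_closed[OF u]
  show "cell_evaluation k G (Suc n) (singular_codiff BG n u) \<in> carrier (AP_cochains k G (Suc n))"
    by (rule cell_evaluation_in[OF du])
  show "hochschild_diff k G n (cell_evaluation k G n u) \<in> carrier (AP_cochains k G (Suc n))"
    by (rule hochschild_diff_AP[OF cell_evaluation_in[OF u]])
  fix gs assume gs: "gs \<in> tuples (carrier G) (Suc n)"
  have "coefficient k G (cell_evaluation k G (Suc n) (singular_codiff BG n u)) gs =
      u (chain_boundary (Suc n) (frag_of (cell (nerve G) (Suc n) gs)))"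
    using coefficient_cell_evaluation[OF du gs] cell_simplex[OF gs]
    by (simp add: R.singular_codiff_eq singular_chain_of)
  also have "\<dots> = (\<Oplus>\<^bsub>k\<^esub>i\<in>{..Suc n}. sign k i \<otimes>\<^bsub>k\<^esub> u (frag_of (singular_face (Suc n) i (cell (nerve G) (Suc n) gs))))"
    by (rule R.singular_cochain_boundary[OF u cell_simplex[OF gs]])
  also have "\<dots> = (\<Oplus>\<^bsub>k\<^esub>i\<in>{..Suc n}. sign k i \<otimes>\<^bsub>k\<^esub> coefficient k G (cell_evaluation k G n u) (face (nerve G) (Suc n) i gs))"
  proof (rule R.finsum_cong')
    fix i assume "i \<in> {..Suc n}"
    then have i: "i \<le> Suc n" by simp
    have "singular_face (Suc n) i (cell (nerve G) (Suc n) gs) = cell (nerve G) n (face (nerve G) (Suc n) i gs)"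
      using gs i by (intro singular_face_cell) (simp_all add: nerve_sel(1))
    then show "sign k i \<otimes>\<^bsub>k\<^esub> u (frag_of (singular_face (Suc n) i (cell (nerve G) (Suc n) gs))) =
        sign k i \<otimes>\<^bsub>k\<^esub> coefficient k G (cell_evaluation k G n u) (face (nerve G) (Suc n) i gs)"
      by (simp only: coefficient_cell_evaluation[OF u nerve_face_in[OF gs i]])
  qed (use coefficient_closed[OF cell_evaluation_in[OF u] nerve_face_in[OF gs]] in auto)
  also have "\<dots> = coefficient k G (hochschild_diff k G n (cell_evaluation k G n u)) gs"
    by (rule coefficient_hochschild_diff[OF cell_evaluation_in[OF u] gs, symmetric])
  finally show "coefficient k G (cell_evaluation k G (Suc n) (singular_codiff BG n u)) gs =
      coefficient k G (hochschild_diff k G n (cell_evaluation k G n u)) gs" .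
qed

lemma edge_cochain_exists:
  assumes f: "f \<in> carrier (AP_cochains k G n)"
  shows "\<exists>u\<in>carrier (singular_cochains k BG n).
    \<forall>\<sigma>. singular_simplex n BG \<sigma> \<longrightarrow> u (frag_of \<sigma>) = coefficient k G f (G.EG.edges n \<sigma>)"
  by (rule R.singular_cochain_exists) (rule coefficient_closed[OF f G.EG.edges_in])

text \<open>The singular cochain whose value on a singular simplex is the coefficient at its edges. This is a
  section of \<open>cell_evaluation\<close> and a cochain map, too.\<close>

definition edge_cochain ::
  "nat \<Rightarrow> ((('g \<Rightarrow> 'k) list \<Rightarrow> 'k) set \<Rightarrow> 'g \<Rightarrow> 'k) \<Rightarrow> ((nat \<times> 'g list) \<times> (nat \<Rightarrow> real)) set chain \<Rightarrow> 'k"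
  where "edge_cochain n f = (SOME u. u \<in> carrier (singular_cochains k BG n) \<and>
    (\<forall>\<sigma>. singular_simplex n BG \<sigma> \<longrightarrow> u (frag_of \<sigma>) = coefficient k G f (G.EG.edges n \<sigma>)))"

lemma
  assumes f: "f \<in> carrier (AP_cochains k G n)"
  shows edge_cochain_in: "edge_cochain n f \<in> carrier (singular_cochains k BG n)"
    and edge_cochain_simplex: "singular_simplex n BG \<sigma> \<Longrightarrow>
      edge_cochain n f (frag_of \<sigma>) = coefficient k G f (G.EG.edges n \<sigma>)"
  using someI_ex[OF edge_cochain_exists[OF f, unfolded Bex_def]] unfolding edge_cochain_def by blast+

lemma cell_evaluation_edge_cochain:
  assumes f: "f \<in> carrier (AP_cochains k G n)"
  shows "cell_evaluation k G n (edge_cochain n f) = f"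
  by (rule AP_eqI[of _ n])
    (simp_all add: cell_evaluation_in edge_cochain_in f coefficient_cell_evaluation edge_cochain_simplex
      cell_simplex G.edges_cell)

lemma edge_cochain_diff:
  assumes f: "f \<in> carrier (AP_cochains k G n)"
  shows "singular_codiff BG n (edge_cochain n f) = edge_cochain (Suc n) (hochschild_diff k G n f)"
proof (rule R.singular_cochain_eqI)
  note u = edge_cochain_in[OF f]
  show "singular_codiff BG n (edge_cochain n f) \<in> carrier (singular_cochains k BG (Suc n))"
    by (rule R.singular_codiff_closed[OF u])
  show "edge_cochain (Suc n) (hochschild_diff k G n f) \<in> carrier (singular_cochains k BG (Suc n))"
    by (rule edge_cochain_in[OF hochschild_diff_AP[OF f]])
  fix \<sigma> assume \<sigma>: "singular_simplex (Suc n) BG \<sigma>"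
  note e = G.EG.edges_in[OF \<sigma>]
  have "singular_codiff BG n (edge_cochain n f) (frag_of \<sigma>) =
      (\<Oplus>\<^bsub>k\<^esub>i\<in>{..Suc n}. sign k i \<otimes>\<^bsub>k\<^esub> edge_cochain n f (frag_of (singular_face (Suc n) i \<sigma>)))"
    using R.singular_cochain_boundary[OF u \<sigma>] \<sigma> by (simp add: R.singular_codiff_eq singular_chain_of del: sum.atMost_Suc)
  also have "\<dots> = (\<Oplus>\<^bsub>k\<^esub>i\<in>{..Suc n}. sign k i \<otimes>\<^bsub>k\<^esub> coefficient k G f (face (nerve G) (Suc n) i (G.EG.edges (Suc n) \<sigma>)))"
  proof (rule R.finsum_cong')
    fix i assume "i \<in> {..Suc n}"
    then have i: "i \<le> Suc n" by simp
    have "singular_simplex n BG (singular_face (Suc n) i \<sigma>)"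
      using singular_simplex_singular_face[OF \<sigma> _ i] by simp
    then show "sign k i \<otimes>\<^bsub>k\<^esub> edge_cochain n f (frag_of (singular_face (Suc n) i \<sigma>)) =
        sign k i \<otimes>\<^bsub>k\<^esub> coefficient k G f (face (nerve G) (Suc n) i (G.EG.edges (Suc n) \<sigma>))"
      by (simp only: edge_cochain_simplex[OF f] G.EG.edges_face[OF \<sigma> i])
  qed (use coefficient_closed[OF f nerve_face_in[OF e]] in auto)
  also have "\<dots> = edge_cochain (Suc n) (hochschild_diff k G n f) (frag_of \<sigma>)"
    by (simp only: edge_cochain_simplex[OF hochschild_diff_AP[OF f] \<sigma>] coefficient_hochschild_diff[OF f e])
  finally show "singular_codiff BG n (edge_cochain n f) (frag_of \<sigma>) =
      edge_cochain (Suc n) (hochschild_diff k G n f) (frag_of \<sigma>)" .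
qed

lemma AP_zero: "\<zero>\<^bsub>AP_cochains k G n\<^esub> \<in> carrier (AP_cochains k G n)"
  using module.carrier_is_submodule[OF module_AP] module.submodule_zero[OF module_AP] by blast

lemma AP_complex: "cochain_complex k (AP_cochains k G) (hochschild_diff k G)"
  unfolding cochain_complex_def
proof (intro conjI allI ballI)
  fix n
  show "module k (AP_cochains k G n)" by (rule module_AP)
  interpret S: module k "singular_cochains k BG n" by (rule R.module_singular)
  have lin: "singular_codiff BG n \<in> linear_maps k (singular_cochains k BG n) (singular_cochains k BG (Suc n))" for n
    using complex_diff[OF R.singular_complex] .
  have diff_eq: "hochschild_diff k G n f = cell_evaluation k G (Suc n) (singular_codiff BG n (edge_cochain n f))"
    if "f \<in> carrier (AP_cochains k G n)" for f n
    using cell_evaluation_diff[OF edge_cochain_in[OF that]] cell_evaluation_edge_cochain[OF that] by simp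
  show "hochschild_diff k G n \<in> linear_maps k (AP_cochains k G n) (AP_cochains k G (Suc n))"
  proof (rule linear_mapsI)
    show "hochschild_diff k G n f \<in> carrier (AP_cochains k G (Suc n))" if "f \<in> carrier (AP_cochains k G n)" for f
      by (rule hochschild_diff_AP[OF that])
    fix f assume f: "f \<in> carrier (AP_cochains k G n)"
    note u = edge_cochain_in[OF f]
    show "hochschild_diff k G n (f \<oplus>\<^bsub>AP_cochains k G n\<^esub> g) =
        hochschild_diff k G n f \<oplus>\<^bsub>AP_cochains k G (Suc n)\<^esub> hochschild_diff k G n g"
      if g: "g \<in> carrier (AP_cochains k G n)" for g
    proof -
      note v = edge_cochain_in[OF g]
      have "f \<oplus>\<^bsub>AP_cochains k G n\<^esub> g = cell_evaluation k G n (edge_cochain n f \<oplus>\<^bsub>singular_cochains k BG n\<^esub> edge_cochain n g)"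
        by (simp only: cell_evaluation_add[OF u v] cell_evaluation_edge_cochain[OF f] cell_evaluation_edge_cochain[OF g])
      then show ?thesis
        by (simp only: cell_evaluation_diff[OF S.M.a_closed[OF u v], symmetric] linear_mapsD(2)[OF lin u v]
            cell_evaluation_add[OF R.singular_codiff_closed[OF u] R.singular_codiff_closed[OF v]] diff_eq[OF f] diff_eq[OF g])
    qed
    show "hochschild_diff k G n (c \<odot>\<^bsub>AP_cochains k G n\<^esub> f) = c \<odot>\<^bsub>AP_cochains k G (Suc n)\<^esub> hochschild_diff k G n f"
      if c: "c \<in> carrier k" for c
    proof -
      have "c \<odot>\<^bsub>AP_cochains k G n\<^esub> f = cell_evaluation k G n (c \<odot>\<^bsub>singular_cochains k BG n\<^esub> edge_cochain n f)"
        by (simp only: cell_evaluation_smult[OF u c] cell_evaluation_edge_cochain[OF f])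
      then show ?thesis
        by (simp only: cell_evaluation_diff[OF S.smult_closed[OF c u], symmetric] linear_mapsD(3)[OF lin c u]
            cell_evaluation_smult[OF R.singular_codiff_closed[OF u] c] diff_eq[OF f])
    qed
  qed
  fix f assume f: "f \<in> carrier (AP_cochains k G n)"
  note u = edge_cochain_in[OF f]
  have "hochschild_diff k G (Suc n) (hochschild_diff k G n f) =
      cell_evaluation k G (Suc (Suc n)) (singular_codiff BG (Suc n) (singular_codiff BG n (edge_cochain n f)))"
    by (simp only: diff_eq[OF f] cell_evaluation_diff[OF R.singular_codiff_closed[OF u]])
  also have "\<dots> = cell_evaluation k G (Suc (Suc n)) \<zero>\<^bsub>singular_cochains k BG (Suc (Suc n))\<^esub>"
    using complex_diff_diff[OF R.singular_complex u] by simp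
  also have "\<dots> = \<zero>\<^bsub>AP_cochains k G (Suc (Suc n))\<^esub>"
    by (rule additive_map_zero[OF R.module_singular module_AP])
      (rule cell_evaluation_in cell_evaluation_add; assumption)+
  finally show "hochschild_diff k G (Suc n) (hochschild_diff k G n f) = \<zero>\<^bsub>AP_cochains k G (Suc (Suc n))\<^esub>" .
qed

lemma cell_evaluation_cochain_map:
  "additive_cochain_map (singular_cochains k BG) (singular_codiff BG) (AP_cochains k G) (hochschild_diff k G) (cell_evaluation k G)"
  unfolding additive_cochain_map_def
  using cell_evaluation_in cell_evaluation_add cell_evaluation_diff by blast

lemma cell_evaluation_surj:
  assumes w: "w \<in> cocycles (AP_cochains k G) (hochschild_diff k G) n"
  shows "\<exists>u\<in>cocycles (singular_cochains k BG) (singular_codiff BG) n. cell_evaluation k G n u = w"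
proof (rule bexI)
  have wA: "w \<in> carrier (AP_cochains k G n)" and dw: "hochschild_diff k G n w = \<zero>\<^bsub>AP_cochains k G (Suc n)\<^esub>"
    using w by (auto simp: cocycles_def)
  show "cell_evaluation k G n (edge_cochain n w) = w" by (rule cell_evaluation_edge_cochain[OF wA])
  have "singular_codiff BG n (edge_cochain n w) = \<zero>\<^bsub>singular_cochains k BG (Suc n)\<^esub>"
  proof (rule R.singular_cochain_eqI)
    interpret S: module k "singular_cochains k BG (Suc n)" by (rule R.module_singular)
    show "singular_codiff BG n (edge_cochain n w) \<in> carrier (singular_cochains k BG (Suc n))"
      by (rule R.singular_codiff_closed[OF edge_cochain_in[OF wA]])
    show "\<zero>\<^bsub>singular_cochains k BG (Suc n)\<^esub> \<in> carrier (singular_cochains k BG (Suc n))" by (rule S.M.zero_closed)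
    fix \<sigma> assume \<sigma>: "singular_simplex (Suc n) BG \<sigma>"
    then show "singular_codiff BG n (edge_cochain n w) (frag_of \<sigma>) = \<zero>\<^bsub>singular_cochains k BG (Suc n)\<^esub> (frag_of \<sigma>)"
      unfolding edge_cochain_diff[OF wA] dw
      by (simp add: edge_cochain_simplex[OF AP_zero \<sigma>] coefficient_zero[OF G.EG.edges_in[OF \<sigma>]] singular_chain_of)
  qed
  then show "edge_cochain n w \<in> cocycles (singular_cochains k BG) (singular_codiff BG) n"
    using edge_cochain_in[OF wA] by (simp add: cocycles_def)
qed

lemma homotopy_base_linear:
  "G.EG.homotopy_base n (c + c') = G.EG.homotopy_base n c + G.EG.homotopy_base n c'"
  by (simp add: G.EG.homotopy_base_def frag_extend_add)

text \<open>On a cocycle \<open>u\<close>, the straightening homotopy gives \<open>u (\<sigma>) = u (straightened \<sigma>) + w (boundary of \<sigma>)\<close> with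
  \<open>w\<close> the composition of \<open>u\<close> with the homotopy, and the first summand is the coefficient of the image of \<open>u\<close>
  at the edges of \<open>\<sigma>\<close>. In degree \<open>0\<close> the term with \<open>w\<close> is absent.\<close>

lemma cell_evaluation_inj:
  assumes u: "u \<in> cocycles (singular_cochains k BG) (singular_codiff BG) n"
    and cob: "cell_evaluation k G n u \<in> coboundaries (AP_cochains k G) (hochschild_diff k G) n"
  shows "u \<in> coboundaries (singular_cochains k BG) (singular_codiff BG) n"
proof -
  have uS: "u \<in> carrier (singular_cochains k BG n)" and du: "singular_codiff BG n u = \<zero>\<^bsub>singular_cochains k BG (Suc n)\<^esub>"
    using u by (auto simp: cocycles_def)
  have ub: "u (chain_boundary (Suc n) c) = \<zero>\<^bsub>k\<^esub>" if "singular_chain (Suc n) BG c" for c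
    using fun_cong[OF du, of c] that by (simp add: R.singular_codiff_eq)
  have straight: "u (G.EG.straighten_base n (frag_of \<sigma>)) = coefficient k G (cell_evaluation k G n u) (G.EG.edges n \<sigma>)"
    if "singular_simplex n BG \<sigma>" for \<sigma>
    by (simp only: G.straighten_base_of coefficient_cell_evaluation[OF uS G.EG.edges_in[OF that]])
  have straight_chain: "singular_chain n BG (G.EG.straighten_base n (frag_of \<sigma>))" if "singular_simplex n BG \<sigma>" for \<sigma>
    unfolding G.straighten_base_of singular_chain_of by (rule cell_simplex[OF G.EG.edges_in[OF that]])
  show ?thesis
  proof (cases n)
    case 0
    have "u = \<zero>\<^bsub>singular_cochains k BG 0\<^esub>"
    proof (rule R.singular_cochain_eqI)
      interpret S: module k "singular_cochains k BG 0" by (rule R.module_singular)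
      show "u \<in> carrier (singular_cochains k BG 0)" using uS 0 by simp
      show "\<zero>\<^bsub>singular_cochains k BG 0\<^esub> \<in> carrier (singular_cochains k BG 0)" by (rule S.M.zero_closed)
      fix \<sigma> assume \<sigma>: "singular_simplex 0 BG \<sigma>"
      then have c: "singular_chain 0 BG (frag_of \<sigma>)" by (simp add: singular_chain_of)
      have z: "cell_evaluation k G n u = \<zero>\<^bsub>AP_cochains k G n\<^esub>" using cob 0 by (simp add: coboundaries_def)
      have "frag_of \<sigma> = chain_boundary (Suc 0) (G.EG.homotopy_base 0 (frag_of \<sigma>)) + G.EG.straighten_base 0 (frag_of \<sigma>)"
        using G.EG.straighten_base_homotopy_0[OF c] by simp
      then have "u (frag_of \<sigma>) = u (chain_boundary (Suc 0) (G.EG.homotopy_base 0 (frag_of \<sigma>))) \<oplus>\<^bsub>k\<^esub> u (G.EG.straighten_base 0 (frag_of \<sigma>))"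
        using R.singular_cochainD(2)[OF uS] straight_chain 0 \<sigma>
          singular_chain_boundary_alt[OF G.EG.homotopy_base_chain[OF c]] by metis
      also have "\<dots> = \<zero>\<^bsub>k\<^esub>"
        using ub[of "G.EG.homotopy_base 0 (frag_of \<sigma>)"] G.EG.homotopy_base_chain[OF c] straight[of \<sigma>] z \<sigma> 0
          coefficient_zero[OF G.EG.edges_in[OF \<sigma>]] by simp
      finally show "u (frag_of \<sigma>) = \<zero>\<^bsub>singular_cochains k BG 0\<^esub> (frag_of \<sigma>)" using c by simp
    qed
    then show ?thesis using 0 by (simp add: coboundaries_def)
  next
    case (Suc m)
    then obtain f where f: "f \<in> carrier (AP_cochains k G m)" "cell_evaluation k G n u = hochschild_diff k G m f"
      using cob by (auto simp: coboundaries_def)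
    interpret S: module k "singular_cochains k BG m" by (rule R.module_singular)
    define w where "w = (\<lambda>c\<in>singular_chain_set m BG. u (G.EG.homotopy_base m c))"
    have w: "w \<in> carrier (singular_cochains k BG m)"
      by (rule R.singular_cochainI)
        (use R.singular_cochainD[OF uS] Suc G.EG.homotopy_base_chain in
          \<open>auto simp: w_def singular_chain_add homotopy_base_linear\<close>)
    let ?v = "edge_cochain m f \<oplus>\<^bsub>singular_cochains k BG m\<^esub> w"
    have v: "?v \<in> carrier (singular_cochains k BG m)" by (rule S.M.a_closed[OF edge_cochain_in[OF f(1)] w])
    have "u = singular_codiff BG m ?v"
    proof (rule R.singular_cochain_eqI)
      show "u \<in> carrier (singular_cochains k BG (Suc m))" using uS Suc by simp
      show "singular_codiff BG m ?v \<in> carrier (singular_cochains k BG (Suc m))" by (rule R.singular_codiff_closed[OF v])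
      fix \<sigma> assume \<sigma>: "singular_simplex (Suc m) BG \<sigma>"
      then have c: "singular_chain (Suc m) BG (frag_of \<sigma>)" by (simp add: singular_chain_of)
      note b = singular_chain_boundary_alt[OF c]
      let ?H = "G.EG.homotopy_base (Suc m) (frag_of \<sigma>)"
      let ?S = "G.EG.straighten_base (Suc m) (frag_of \<sigma>)"
      let ?B = "G.EG.homotopy_base m (chain_boundary (Suc m) (frag_of \<sigma>))"
      have H: "singular_chain (Suc (Suc m)) BG ?H" by (rule G.EG.homotopy_base_chain[OF c])
      have Sc: "singular_chain (Suc m) BG ?S" using straight_chain[of \<sigma>] \<sigma> Suc by simp
      have B: "singular_chain (Suc m) BG ?B" by (rule G.EG.homotopy_base_chain[OF b])
      note uS' = uS[unfolded Suc]
      have "frag_of \<sigma> = (?S + ?B) + chain_boundary (Suc (Suc m)) ?H"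
        using G.EG.straighten_base_homotopy[OF c] by simp
      then have "u (frag_of \<sigma>) = u ((?S + ?B) + chain_boundary (Suc (Suc m)) ?H)" by (rule arg_cong)
      also have "\<dots> = (u ?S \<oplus>\<^bsub>k\<^esub> u ?B) \<oplus>\<^bsub>k\<^esub> u (chain_boundary (Suc (Suc m)) ?H)"
        by (simp only: R.singular_cochainD(2)[OF uS'] singular_chain_add Sc B singular_chain_boundary_alt[OF H])
      also have "\<dots> = u ?S \<oplus>\<^bsub>k\<^esub> u ?B"
        using ub[of ?H] H Suc R.singular_cochainD(1)[OF uS' Sc] R.singular_cochainD(1)[OF uS' B] by simp
      also have "u ?S = edge_cochain (Suc m) (hochschild_diff k G m f) (frag_of \<sigma>)"
        using straight[of \<sigma>] \<sigma> Suc f(2) by (simp add: edge_cochain_simplex[OF hochschild_diff_AP[OF f(1)] \<sigma>])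
      also have "\<dots> = edge_cochain m f (chain_boundary (Suc m) (frag_of \<sigma>))"
        unfolding edge_cochain_diff[OF f(1), symmetric] by (rule R.singular_codiff_eq[OF c])
      also have "u ?B = w (chain_boundary (Suc m) (frag_of \<sigma>))" using b by (simp add: w_def)
      finally show "u (frag_of \<sigma>) = singular_codiff BG m ?v (frag_of \<sigma>)"
        using b by (simp add: R.singular_codiff_eq[OF c])
    qed
    then show ?thesis using v Suc by (auto simp: coboundaries_def simp del: R.singular_cochains_sel)
  qed
qed

lemma cohomology_cell_evaluation_iso:
  "cohomology_map (AP_cochains k G) (hochschild_diff k G) (cell_evaluation k G) n
    \<in> linear_isos k (singular_cohomology k BG n) (AP_cohomology k G n)"
  unfolding singular_cohomology_def AP_cohomology_def
  by (rule cohomology_map_iso[OF R.singular_complex AP_complex cell_evaluation_cochain_map])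
    (rule cell_evaluation_smult cell_evaluation_surj cell_evaluation_inj; assumption)+

end

section \<open>Naturality\<close>

lemma simplicial_map_nerve:
  assumes G: "group G" and H: "group H" and \<phi>: "\<phi> \<in> hom H G"
  shows "simplicial_map (nerve H) (nerve G) (\<lambda>_. map \<phi>)"
  unfolding simplicial_map_def
proof (intro conjI allI ballI impI)
  interpret \<phi>: group_hom H G \<phi> using G H \<phi> by (simp add: group_hom_def group_hom_axioms_def)
  fix n \<sigma> assume "\<sigma> \<in> simplices (nerve H) n"
  then have \<sigma>: "\<sigma> \<in> tuples (carrier H) n" by (simp add: nerve_sel)
  then show "map \<phi> \<sigma> \<in> simplices (nerve G) n" by (auto simp: nerve_sel tuples_def)
  show "map \<phi> (degen (nerve H) n i \<sigma>) = degen (nerve G) n i (map \<phi> \<sigma>)" for i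
    by (simp add: nerve_sel take_map drop_map)
next
  interpret \<phi>: group_hom H G \<phi> using G H \<phi> by (simp add: group_hom_def group_hom_axioms_def)
  fix n \<sigma> i assume "\<sigma> \<in> simplices (nerve H) (Suc n)" and i: "i \<le> Suc n"
  then have \<sigma>: "\<sigma> \<in> tuples (carrier H) (Suc n)" by (simp add: nerve_sel)
  have "\<phi> (\<sigma> ! (i - 1) \<otimes>\<^bsub>H\<^esub> \<sigma> ! i) = \<phi> (\<sigma> ! (i - 1)) \<otimes>\<^bsub>G\<^esub> \<phi> (\<sigma> ! i)" if "0 < i" "i < Suc n"
    using that by (intro \<phi>.hom_mult tuples_nth[OF \<sigma>]) auto
  then show "map \<phi> (face (nerve H) (Suc n) i \<sigma>) = face (nerve G) (Suc n) i (map \<phi> \<sigma>)"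
    using i tuples_length[OF \<sigma>] by (auto simp: nerve_sel merge_at_def map_tl map_butlast take_map drop_map)
qed

lemma ring_hom_finsum:
  assumes "cring k" "cring k'" and \<rho>: "\<rho> \<in> ring_hom k k'" and I: "finite I" "\<And>i. i \<in> I \<Longrightarrow> F i \<in> carrier k"
  shows "\<rho> (\<Oplus>\<^bsub>k\<^esub>i\<in>I. F i) = (\<Oplus>\<^bsub>k'\<^esub>i\<in>I. \<rho> (F i))"
proof -
  interpret k: cring k by fact
  interpret k': cring k' by fact
  interpret \<rho>: ring_hom_ring k k' \<rho>
    using \<rho> by (intro ring_hom_ringI2) (auto intro: k.ring_axioms k'.ring_axioms)
  show ?thesis
    using I
  proof (induction I rule: finite_induct)
    case (insert i I)
    then show ?case by (simp add: Pi_iff)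
  qed simp
qed

lemma ring_hom_sign:
  assumes "cring k" "cring k'" and \<rho>: "\<rho> \<in> ring_hom k k'"
  shows "\<rho> (sign k i) = sign k' i"
proof -
  interpret k: cring k by fact
  interpret k': cring k' by fact
  interpret \<rho>: ring_hom_ring k k' \<rho>
    using \<rho> by (intro ring_hom_ringI2) (auto intro: k.ring_axioms k'.ring_axioms)
  show ?thesis by (induction i) simp_all
qed

text \<open>Change of rings along \<open>\<rho>\<close> and change of groups along \<open>\<phi>\<close>.\<close>

locale coefficient_change =
  K: group_coefficients k G + K': group_coefficients k' H
  for k :: "('k, 'm) ring_scheme" and k' :: "('l, 'm2) ring_scheme"
    and G :: "('g, 'n) monoid_scheme" and H :: "('h, 'n2) monoid_scheme" +
  fixes \<rho> \<phi>
  assumes \<rho>: "\<rho> \<in> ring_hom k k'" and \<phi>: "\<phi> \<in> hom H G"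
begin

text \<open>The map of singular cochains induced by \<open>\<rho>\<close> and \<open>\<phi>\<close>.\<close>

abbreviation "singular_map \<equiv> \<lambda>p u. \<lambda>c\<in>singular_chain_set p (classifying_space H). \<rho> (u (chain_map p (classifying_map G \<phi>) c))"

lemma map_hom_in: "hs \<in> tuples (carrier H) n \<Longrightarrow> map \<phi> hs \<in> tuples (carrier G) n"
  using \<phi> by (auto simp: tuples_def hom_def)

lemma coefficient_hom_closed: "x \<in> carrier k \<Longrightarrow> \<rho> x \<in> carrier k'"
  using \<rho> by (rule ring_hom_closed)

lemma nerve_map: "simplicial_map (nerve H) (nerve G) (\<lambda>_. map \<phi>)"
  by (rule simplicial_map_nerve[OF K.G.group_axioms K'.G.group_axioms \<phi>])

lemma AP_map_eq: "AP_map k k' G H \<rho> \<phi> n f = AP_of k' H n (\<lambda>hs. \<rho> (coefficient k G f (map \<phi> hs)))"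
  by (simp add: AP_map_def AP_of_def coefficient_def)

lemma
  assumes f: "f \<in> carrier (AP_cochains k G n)"
  shows AP_map_in: "AP_map k k' G H \<rho> \<phi> n f \<in> carrier (AP_cochains k' H n)"
    and coefficient_AP_map: "hs \<in> tuples (carrier H) n \<Longrightarrow>
      coefficient k' H (AP_map k k' G H \<rho> \<phi> n f) hs = \<rho> (coefficient k G f (map \<phi> hs))"
  using K'.AP_of_in[of n "\<lambda>hs. \<rho> (coefficient k G f (map \<phi> hs))"]
    K'.coefficient_AP_of[of n "\<lambda>hs. \<rho> (coefficient k G f (map \<phi> hs))"]
    K.coefficient_closed[OF f map_hom_in] coefficient_hom_closed by (auto simp: AP_map_eq)

lemma AP_map_cochain_map:
  "additive_cochain_map (AP_cochains k G) (hochschild_diff k G) (AP_cochains k' H) (hochschild_diff k' H) (AP_map k k' G H \<rho> \<phi>)"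
  unfolding additive_cochain_map_def
proof (intro conjI allI ballI)
  fix n f assume f: "f \<in> carrier (AP_cochains k G n)"
  show "AP_map k k' G H \<rho> \<phi> n f \<in> carrier (AP_cochains k' H n)" by (rule AP_map_in[OF f])
  show "AP_map k k' G H \<rho> \<phi> n (f \<oplus>\<^bsub>AP_cochains k G n\<^esub> g) =
      AP_map k k' G H \<rho> \<phi> n f \<oplus>\<^bsub>AP_cochains k' H n\<^esub> AP_map k k' G H \<rho> \<phi> n g"
    if g: "g \<in> carrier (AP_cochains k G n)" for g
  proof -
    interpret P: module k "AP_cochains k G n" by (rule K.module_AP)
    interpret P': module k' "AP_cochains k' H n" by (rule K'.module_AP)
    show ?thesis
      by (rule K'.AP_eqI[of _ n])
        (use f g ring_hom_add[OF \<rho>] K.coefficient_closed map_hom_in in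
          \<open>simp_all add: AP_map_in coefficient_AP_map K'.coefficient_add K.coefficient_add\<close>)
  qed
  show "AP_map k k' G H \<rho> \<phi> (Suc n) (hochschild_diff k G n f) = hochschild_diff k' H n (AP_map k k' G H \<rho> \<phi> n f)"
  proof (rule K'.AP_eqI[of _ "Suc n"])
    note df = K.hochschild_diff_AP[OF f]
    show "AP_map k k' G H \<rho> \<phi> (Suc n) (hochschild_diff k G n f) \<in> carrier (AP_cochains k' H (Suc n))"
      by (rule AP_map_in[OF df])
    show "hochschild_diff k' H n (AP_map k k' G H \<rho> \<phi> n f) \<in> carrier (AP_cochains k' H (Suc n))"
      by (rule K'.hochschild_diff_AP[OF AP_map_in[OF f]])
    fix hs assume hs: "hs \<in> tuples (carrier H) (Suc n)"
    have cl: "coefficient k G f (face (nerve G) (Suc n) i (map \<phi> hs)) \<in> carrier k" if "i \<le> Suc n" for i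
      by (rule K.coefficient_closed[OF f K.nerve_face_in[OF map_hom_in[OF hs] that]])
    have "coefficient k' H (AP_map k k' G H \<rho> \<phi> (Suc n) (hochschild_diff k G n f)) hs =
        \<rho> (\<Oplus>\<^bsub>k\<^esub>i\<in>{..Suc n}. sign k i \<otimes>\<^bsub>k\<^esub> coefficient k G f (face (nerve G) (Suc n) i (map \<phi> hs)))"
      by (simp only: coefficient_AP_map[OF df hs] K.coefficient_hochschild_diff[OF f map_hom_in[OF hs]])
    also have "\<dots> = (\<Oplus>\<^bsub>k'\<^esub>i\<in>{..Suc n}. \<rho> (sign k i \<otimes>\<^bsub>k\<^esub> coefficient k G f (face (nerve G) (Suc n) i (map \<phi> hs))))"
      by (rule ring_hom_finsum[OF K.R.is_cring K'.R.is_cring \<rho>]) (use cl in auto)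
    also have "\<dots> = (\<Oplus>\<^bsub>k'\<^esub>i\<in>{..Suc n}. sign k' i \<otimes>\<^bsub>k'\<^esub> coefficient k' H (AP_map k k' G H \<rho> \<phi> n f) (face (nerve H) (Suc n) i hs))"
    proof (rule K'.R.finsum_cong')
      fix i assume "i \<in> {..Suc n}"
      then have i: "i \<le> Suc n" by simp
      have "map \<phi> (face (nerve H) (Suc n) i hs) = face (nerve G) (Suc n) i (map \<phi> hs)"
        using nerve_map hs i by (auto simp: simplicial_map_def nerve_sel(1))
      then show "\<rho> (sign k i \<otimes>\<^bsub>k\<^esub> coefficient k G f (face (nerve G) (Suc n) i (map \<phi> hs))) =
          sign k' i \<otimes>\<^bsub>k'\<^esub> coefficient k' H (AP_map k k' G H \<rho> \<phi> n f) (face (nerve H) (Suc n) i hs)"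
        by (simp only: ring_hom_mult[OF \<rho> K.sign_closed cl[OF i]] ring_hom_sign[OF K.R.is_cring K'.R.is_cring \<rho>]
            coefficient_AP_map[OF f K'.nerve_face_in[OF hs i]])
    qed (use K'.coefficient_closed[OF AP_map_in[OF f] K'.nerve_face_in[OF hs]] in auto)
    also have "\<dots> = coefficient k' H (hochschild_diff k' H n (AP_map k k' G H \<rho> \<phi> n f)) hs"
      by (rule K'.coefficient_hochschild_diff[OF AP_map_in[OF f] hs, symmetric])
    finally show "coefficient k' H (AP_map k k' G H \<rho> \<phi> (Suc n) (hochschild_diff k G n f)) hs =
        coefficient k' H (hochschild_diff k' H n (AP_map k k' G H \<rho> \<phi> n f)) hs" .
  qed
qed

lemma classifying_map_continuous: "continuous_map (classifying_space H) (classifying_space G) (classifying_map G \<phi>)"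
  unfolding classifying_space_def classifying_map_def by (rule continuous_map_realization_map[OF nerve_map])

lemma singular_map_in:
  assumes u: "u \<in> carrier (singular_cochains k (classifying_space G) n)"
  shows "singular_map n u \<in> carrier (singular_cochains k' (classifying_space H) n)"
proof -
  note cm = singular_chain_chain_map[OF _ classifying_map_continuous]
  show ?thesis
    by (rule K'.R.singular_cochainI)
      (use K.R.singular_cochainD[OF u] cm coefficient_hom_closed ring_hom_add[OF \<rho>] in
        \<open>auto simp: singular_chain_add chain_map_add\<close>)
qed

lemma singular_map_cochain_map:
  "additive_cochain_map (singular_cochains k (classifying_space G)) (singular_codiff (classifying_space G))
    (singular_cochains k' (classifying_space H)) (singular_codiff (classifying_space H)) singular_map"
  unfolding additive_cochain_map_def
proof (intro conjI allI ballI)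
  note cm = singular_chain_chain_map[OF _ classifying_map_continuous]
  fix n u assume u: "u \<in> carrier (singular_cochains k (classifying_space G) n)"
  show "singular_map n u \<in> carrier (singular_cochains k' (classifying_space H) n)" by (rule singular_map_in[OF u])
  show "singular_map n (u \<oplus>\<^bsub>singular_cochains k (classifying_space G) n\<^esub> v) =
      singular_map n u \<oplus>\<^bsub>singular_cochains k' (classifying_space H) n\<^esub> singular_map n v"
    if v: "v \<in> carrier (singular_cochains k (classifying_space G) n)" for v
    using K.R.singular_cochainD(1)[OF u] K.R.singular_cochainD(1)[OF v] cm ring_hom_add[OF \<rho>]
    by (auto simp: fun_eq_iff restrict_def)
  show "singular_map (Suc n) (singular_codiff (classifying_space G) n u) =
      singular_codiff (classifying_space H) n (singular_map n u)"
  proof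
    fix c
    show "singular_map (Suc n) (singular_codiff (classifying_space G) n u) c =
        singular_codiff (classifying_space H) n (singular_map n u) c"
      using cm[of "Suc n" c] chain_boundary_chain_map[of "Suc n" "classifying_space H" c "classifying_map G \<phi>"]
      by (auto simp: singular_codiff_def singular_chain_boundary_alt restrict_def)
  qed
qed

lemma cell_evaluation_natural:
  assumes u: "u \<in> carrier (singular_cochains k (classifying_space G) n)"
  shows "cell_evaluation k' H n (singular_map n u) = AP_map k k' G H \<rho> \<phi> n (cell_evaluation k G n u)"
proof (rule K'.AP_eqI[of _ n])
  show "cell_evaluation k' H n (singular_map n u) \<in> carrier (AP_cochains k' H n)"
    by (rule K'.cell_evaluation_in[OF singular_map_in[OF u]])
  show "AP_map k k' G H \<rho> \<phi> n (cell_evaluation k G n u) \<in> carrier (AP_cochains k' H n)"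
    by (rule AP_map_in[OF K.cell_evaluation_in[OF u]])
  fix hs assume hs: "hs \<in> tuples (carrier H) n"
  have "simplex_map n (classifying_map G \<phi>) (cell (nerve H) n hs) = cell (nerve G) n (map \<phi> hs)"
    unfolding classifying_map_def by (rule simplex_map_cell[OF nerve_map])
  then show "coefficient k' H (cell_evaluation k' H n (singular_map n u)) hs =
      coefficient k' H (AP_map k k' G H \<rho> \<phi> n (cell_evaluation k G n u)) hs"
    using K'.cell_simplex[OF hs]
    by (simp add: K'.coefficient_cell_evaluation[OF singular_map_in[OF u] hs] coefficient_AP_map[OF K.cell_evaluation_in[OF u] hs]
        K.coefficient_cell_evaluation[OF u map_hom_in[OF hs]] singular_chain_of)
qed

lemma cohomology_cell_evaluation_natural:
  assumes Y: "Y \<in> carrier (singular_cohomology k (classifying_space G) n)"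
  shows "cohomology_map (AP_cochains k' H) (hochschild_diff k' H) (cell_evaluation k' H) n
      (singular_cohomology_map k' (classifying_space H) \<rho> (classifying_map G \<phi>) n Y) =
    AP_cohomology_map k k' G H \<rho> \<phi> n
      (cohomology_map (AP_cochains k G) (hochschild_diff k G) (cell_evaluation k G) n Y)"
proof -
  note S = K.R.singular_complex[of "classifying_space G"] and S' = K'.R.singular_complex[of "classifying_space H"]
  obtain u where u: "u \<in> cocycles (singular_cochains k (classifying_space G)) (singular_codiff (classifying_space G)) n"
    "Y = cohomology_class (singular_cochains k (classifying_space G)) (singular_codiff (classifying_space G)) n u"
    using Y cohomology_carrier[OF S] unfolding singular_cohomology_def by blast
  note uC = cocycle_closed[OF S u(1)]
  show ?thesis
    unfolding u(2) singular_cohomology_map_def AP_cohomology_map_def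
      cohomology_map_class[OF S S' singular_map_cochain_map u(1)]
      cohomology_map_class[OF S' K'.AP_complex K'.cell_evaluation_cochain_map
        additive_cochain_map_cocycle[OF S S' singular_map_cochain_map u(1)]]
      cohomology_map_class[OF S K.AP_complex K.cell_evaluation_cochain_map u(1)]
      cohomology_map_class[OF K.AP_complex K'.AP_complex AP_map_cochain_map
        additive_cochain_map_cocycle[OF S K.AP_complex K.cell_evaluation_cochain_map u(1)]]
      cell_evaluation_natural[OF uC] ..
qed

lemma singular_cohomology_map_closed:
  assumes "Y \<in> carrier (singular_cohomology k (classifying_space G) n)"
  shows "singular_cohomology_map k' (classifying_space H) \<rho> (classifying_map G \<phi>) n Y
    \<in> carrier (singular_cohomology k' (classifying_space H) n)"
  using cohomology_map_closed[OF K.R.singular_complex K'.R.singular_complex singular_map_cochain_map] assms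
  by (simp add: singular_cohomology_def singular_cohomology_map_def)

end

text \<open>The natural isomorphism, as the inverse of the map induced by evaluation on cells. Evaluation on
  cells commutes with change of rings and groups already on the level of cochains.\<close>

definition comparison ::
  "('k, 'm) ring_scheme \<Rightarrow> ('g, 'n) monoid_scheme \<Rightarrow> nat \<Rightarrow>
    ((('g \<Rightarrow> 'k) list \<Rightarrow> 'k) set \<Rightarrow> 'g \<Rightarrow> 'k) set \<Rightarrow>
    (((nat \<times> 'g list) \<times> (nat \<Rightarrow> real)) set chain \<Rightarrow> 'k) set"
  where "comparison k G n =
    inv_into (carrier (singular_cohomology k (classifying_space G) n))
      (cohomology_map (AP_cochains k G) (hochschild_diff k G) (cell_evaluation k G) n)"

lemma comparison_iso:
  assumes "cring k" "group G"
  shows "comparison k G n \<in> linear_isos k (AP_cohomology k G n) (singular_cohomology k (classifying_space G) n)"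
proof -
  interpret group_coefficients k G using assms by (rule group_coefficients.intro)
  note S = R.singular_complex[of "classifying_space G"]
  show ?thesis
    unfolding comparison_def
    by (rule linear_isos_inverse[OF cohomology_cell_evaluation_iso])
      (simp_all add: singular_cohomology_def cohomology_add_closed[OF S] cohomology_smult_closed[OF S])
qed

lemma comparison_natural:
  assumes kG: "cring k" "cring k'" "group G" "group H" and \<rho>: "\<rho> \<in> ring_hom k k'" and \<phi>: "\<phi> \<in> hom H G"
    and X: "X \<in> carrier (AP_cohomology k G n)"
  shows "comparison k' H n (AP_cohomology_map k k' G H \<rho> \<phi> n X) =
    singular_cohomology_map k' (classifying_space H) \<rho> (classifying_map G \<phi>) n (comparison k G n X)"
proof -
  interpret coefficient_change k k' G H \<rho> \<phi>
    using assms by (intro coefficient_change.intro group_coefficients.intro coefficient_change_axioms.intro)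
  let ?E = "cohomology_map (AP_cochains k G) (hochschild_diff k G) (cell_evaluation k G) n"
  let ?E' = "cohomology_map (AP_cochains k' H) (hochschild_diff k' H) (cell_evaluation k' H) n"
  have bij: "bij_betw ?E (carrier (singular_cohomology k (classifying_space G) n)) (carrier (AP_cohomology k G n))"
    using K.cohomology_cell_evaluation_iso by (simp add: linear_isos_def)
  have bij': "bij_betw ?E' (carrier (singular_cohomology k' (classifying_space H) n)) (carrier (AP_cohomology k' H n))"
    using K'.cohomology_cell_evaluation_iso by (simp add: linear_isos_def)
  have Y: "comparison k G n X \<in> carrier (singular_cohomology k (classifying_space G) n)" "?E (comparison k G n X) = X"
    using bij X by (simp_all add: comparison_def bij_betw_def inv_into_into f_inv_into_f)
  have "AP_cohomology_map k k' G H \<rho> \<phi> n X =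
      ?E' (singular_cohomology_map k' (classifying_space H) \<rho> (classifying_map G \<phi>) n (comparison k G n X))"
    using cohomology_cell_evaluation_natural[OF Y(1)] Y(2) by simp
  then show ?thesis
    using singular_cohomology_map_closed[OF Y(1)] bij' by (simp add: comparison_def bij_betw_def)
qed

theorem lemma2p3:
  shows "\<exists>\<Phi> :: 'k ring \<Rightarrow> 'g monoid \<Rightarrow> nat \<Rightarrow>
              ((('g \<Rightarrow> 'k) list \<Rightarrow> 'k) set \<Rightarrow> 'g \<Rightarrow> 'k) set \<Rightarrow>
              (((nat \<times> 'g list) \<times> (nat \<Rightarrow> real)) set chain \<Rightarrow> 'k) set.
    (\<forall>k G n. cring k \<and> group G \<longrightarrow>
       \<Phi> k G n \<in> linear_isos k (AP_cohomology k G n)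
                               (singular_cohomology k (classifying_space G) n)) \<and>
    (\<forall>k k' G H \<rho> \<phi> n. cring k \<and> cring k' \<and> group G \<and> group H \<and>
        \<rho> \<in> ring_hom k k' \<and> \<phi> \<in> hom H G \<longrightarrow>
       (\<forall>X\<in>carrier (AP_cohomology k G n).
          \<Phi> k' H n (AP_cohomology_map k k' G H \<rho> \<phi> n X) =
          singular_cohomology_map k' (classifying_space H) \<rho> (classifying_map G \<phi>) n (\<Phi> k G n X)))"
proof (rule exI[of _ comparison], intro conjI allI impI ballI)
  fix k :: "'k ring" and G :: "'g monoid" and n
  assume "cring k \<and> group G"
  then show "comparison k G n \<in> linear_isos k (AP_cohomology k G n) (singular_cohomology k (classifying_space G) n)"
    by (intro comparison_iso) simp_all
next
  fix k k' :: "'k ring" and G H :: "'g monoid" and \<rho> \<phi> n X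
  assume "cring k \<and> cring k' \<and> group G \<and> group H \<and> \<rho> \<in> ring_hom k k' \<and> \<phi> \<in> hom H G"
    and "X \<in> carrier (AP_cohomology k G n)"
  then show "comparison k' H n (AP_cohomology_map k k' G H \<rho> \<phi> n X) =
      singular_cohomology_map k' (classifying_space H) \<rho> (classifying_map G \<phi>) n (comparison k G n X)"
    by (intro comparison_natural) simp_all
qed

end
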